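(* Let $\phi,\overline\phi$, $\mathcal{F}$, $\mathcal{M}(\mathcal{F})$ and $\omega_{\mathcal{F}}$ be as in the context. For $x\ge 1$ let $N$ be a uniformly random element of $\mathcal{M}(\mathcal{F})\cap[1,x]$, and let \[ a_1=\frac{1}{\pi}\sqrt{\frac{6}{\log\phi}},\qquad a_2=\frac{\pi^2-6}{2\pi^3}\sqrt{\frac{6}{\log\phi}}. \] Then $\omega_{\mathcal{F}}(N)$ is asymptotically normal: for every real $z$, \[ \lim_{x\to\infty}\mathbb{P}\Bigl(\frac{\omega_{\mathcal{F}}(N)-a_1(\log x)^{1/2}}{\sqrt{a_2}(\log x)^{1/4}}\le z\Bigr)=\frac{1}{\sqrt{2\pi}}\int_{-\infty}^{z}e^{-y^2/2}\,dy. \]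
   Context: Let $\phi$ and $\overline\phi$ be real algebraic integers such that $\phi+\overline\phi$ and $\phi\overline\phi$ are non-zero coprime rational integers and $\phi>\lvert\overline\phi\rvert$. For $n\ge 1$ put $v_n=(\phi^n-\overline\phi^n)/(\phi-\overline\phi)$ (positive integers). A prime $p$ is a primitive divisor of $v_n$ if $p\mid v_n$ but $p\nmid v_1\cdots v_{n-1}$. Let $\mathcal{F}=\{v_n: v_n\text{ has a primitive divisor}\}$ and let $\mathcal{M}(\mathcal{F})$ be the multiplicative monoid of all finite products (including the empty product $1$) of elements of $\mathcal{F}$. Every element of $\mathcal{M}(\mathcal{F})$ has a unique factorisation into elements of $\mathcal{F}$; $\omega_{\mathcal{F}}(n)$ denotes the number of distinct factors (counted without multiplicity) in this factorisation of $n\in\mathcal{M}(\mathcal{F})$. *)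

theory Defs
  imports "HOL-Probability.Probability" "HOL-Computational_Algebra.Computational_Algebra"
begin

definition lucas_real :: "real \<Rightarrow> real \<Rightarrow> nat \<Rightarrow> real" where
  "lucas_real \<phi> \<psi> n = (\<phi> ^ n - \<psi> ^ n) / (\<phi> - \<psi>)"

text \<open>The same sequence as natural numbers. Under the standing hypotheses on \<open>\<phi>\<close> and \<open>\<psi>\<close> no
  rounding takes place; see \<open>real_lucas\<close> and \<open>lucas_pos\<close> below.\<close>

definition lucas :: "real \<Rightarrow> real \<Rightarrow> nat \<Rightarrow> nat" where
  "lucas \<phi> \<psi> n = nat \<lfloor>lucas_real \<phi> \<psi> n\<rfloor>"

definition primitive_divisor :: "real \<Rightarrow> real \<Rightarrow> nat \<Rightarrow> nat \<Rightarrow> bool" where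
  "primitive_divisor \<phi> \<psi> p n \<longleftrightarrow>
     prime p \<and> p dvd lucas \<phi> \<psi> n \<and> \<not> p dvd (\<Prod>k\<in>{1..<n}. lucas \<phi> \<psi> k)"

definition prim_lucas :: "real \<Rightarrow> real \<Rightarrow> nat set" where
  "prim_lucas \<phi> \<psi> = {lucas \<phi> \<psi> n | n. n \<ge> 1 \<and> (\<exists>p. primitive_divisor \<phi> \<psi> p n)}"

definition mult_monoid :: "nat set \<Rightarrow> nat set" where
  "mult_monoid F = {prod_mset A | A. set_mset A \<subseteq> F}"

text \<open>Meaningful when the factorisation into elements of \<open>F\<close> is unique, which is proved for
  \<open>F = prim_lucas \<phi> \<psi>\<close> in \<open>prim_lucas_unique_factorisation\<close> below.\<close>

definition factorisation :: "nat set \<Rightarrow> nat \<Rightarrow> nat multiset" where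
  "factorisation F n = (THE A. set_mset A \<subseteq> F \<and> prod_mset A = n)"

definition omega :: "nat set \<Rightarrow> nat \<Rightarrow> nat" where
  "omega F n = card (set_mset (factorisation F n))"

lemma lucas_real_pos:
  assumes "\<phi> > \<bar>\<psi>\<bar>" "n \<ge> 1"
  shows "lucas_real \<phi> \<psi> n > 0"
proof -
  have "\<psi> ^ n \<le> \<bar>\<psi>\<bar> ^ n" by (metis abs_ge_self power_abs)
  also have "\<dots> < \<phi> ^ n" using assms by (intro power_strict_mono) auto
  finally show ?thesis using assms by (auto simp: lucas_real_def)
qed

lemma lucas_real_Ints:
  assumes "\<phi> > \<bar>\<psi>\<bar>" "\<phi> + \<psi> = of_int P" "\<phi> * \<psi> = of_int Q"
  shows "lucas_real \<phi> \<psi> n \<in> \<int>"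
proof (induction n rule: less_induct)
  case (less n)
  consider "n = 0" | "n = 1" | m where "n = Suc (Suc m)"
    by (metis One_nat_def not0_implies_Suc)
  then show ?case
  proof cases
    case 3
    have "lucas_real \<phi> \<psi> n =
        (\<phi> + \<psi>) * lucas_real \<phi> \<psi> (Suc m) - \<phi> * \<psi> * lucas_real \<phi> \<psi> m"
    proof -
      have "\<phi> - \<psi> \<noteq> 0" using assms(1) by auto
      moreover have "\<phi> ^ Suc (Suc m) - \<psi> ^ Suc (Suc m) =
          (\<phi> + \<psi>) * (\<phi> ^ Suc m - \<psi> ^ Suc m) - \<phi> * \<psi> * (\<phi> ^ m - \<psi> ^ m)"
        by (simp add: algebra_simps)
      ultimately show ?thesis
        by (simp only: 3 lucas_real_def diff_divide_distrib[symmetric] times_divide_eq_right)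
    qed
    moreover have "lucas_real \<phi> \<psi> (Suc m) \<in> \<int>" "lucas_real \<phi> \<psi> m \<in> \<int>"
      using less 3 by auto
    ultimately show ?thesis using assms(2,3) by auto
  qed (use assms(1) in \<open>auto simp: lucas_real_def\<close>)
qed

lemma real_lucas:
  assumes "\<phi> > \<bar>\<psi>\<bar>" "\<phi> + \<psi> = of_int P" "\<phi> * \<psi> = of_int Q" "n \<ge> 1"
  shows "real (lucas \<phi> \<psi> n) = lucas_real \<phi> \<psi> n"
  using lucas_real_Ints[OF assms(1-3), of n] lucas_real_pos[OF assms(1,4)]
  by (auto simp: lucas_def elim!: Ints_cases)

lemma lucas_pos:
  assumes "\<phi> > \<bar>\<psi>\<bar>" "\<phi> + \<psi> = of_int P" "\<phi> * \<psi> = of_int Q" "n \<ge> 1"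
  shows "lucas \<phi> \<psi> n > 0"
  using real_lucas[OF assms] lucas_real_pos[OF assms(1,4)] by simp

lemma multiplicity_prod_mset_eq:
  fixes p v :: nat
  assumes "prime p" "0 \<notin># A" "\<And>w. w \<in># A \<Longrightarrow> w \<noteq> v \<Longrightarrow> \<not> p dvd w"
  shows "multiplicity p (prod_mset A) = count A v * multiplicity p v"
  using assms(2,3)
proof (induction A)
  case (add w A)
  have "multiplicity p (prod_mset (add_mset w A)) = multiplicity p w + multiplicity p (prod_mset A)"
    using add.prems assms(1)
    by (simp add: prime_elem_multiplicity_mult_distrib)
  moreover have "w \<noteq> v \<Longrightarrow> multiplicity p w = 0"
    using add.prems by (simp add: not_dvd_imp_multiplicity_0)
  ultimately show ?case using add by auto
qed auto

lemma prim_lucas_unique_factorisation: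
  assumes "\<phi> > \<bar>\<psi>\<bar>" "\<phi> + \<psi> = of_int P" "\<phi> * \<psi> = of_int Q"
    and "n \<in> mult_monoid (prim_lucas \<phi> \<psi>)"
  shows "\<exists>!A. set_mset A \<subseteq> prim_lucas \<phi> \<psi> \<and> prod_mset A = n"
proof -
  define G where "G m = {lucas \<phi> \<psi> k | k. 1 \<le> k \<and> k < m \<and> (\<exists>p. primitive_divisor \<phi> \<psi> p k)}" for m
  have pos: "0 \<notin> G m" for m
    using lucas_pos[OF assms(1-3)] by (force simp: G_def)
  have uniq: "set_mset A \<subseteq> G m \<Longrightarrow> set_mset B \<subseteq> G m \<Longrightarrow> prod_mset A = prod_mset B \<Longrightarrow> A = B"
    for m A B
  proof (induction m arbitrary: A B)
    case 0
    then show ?case by (auto simp: G_def)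
  next
    case (Suc m)
    show ?case
    proof (cases "1 \<le> m \<and> (\<exists>p. primitive_divisor \<phi> \<psi> p m)")
      case False
      then have "G (Suc m) = G m" unfolding G_def using less_Suc_eq by auto
      then show ?thesis using Suc by metis
    next
      case True
      then obtain p where p: "prime p" "p dvd lucas \<phi> \<psi> m"
        "\<not> p dvd (\<Prod>k\<in>{1..<m}. lucas \<phi> \<psi> k)"
        by (auto simp: primitive_divisor_def)
      let ?v = "lucas \<phi> \<psi> m"
      have nd: "\<not> p dvd w" if w: "w \<in> G (Suc m)" "w \<noteq> ?v" for w
      proof -
        obtain k where k: "w = lucas \<phi> \<psi> k" "1 \<le> k" "k < m"
          using w unfolding G_def less_Suc_eq by blast
        then have "w dvd (\<Prod>k\<in>{1..<m}. lucas \<phi> \<psi> k)" by (auto intro!: dvd_prodI)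
        then show ?thesis using p(3) dvd_trans by blast
      qed
      have mult: "multiplicity p (prod_mset C) = count C ?v * multiplicity p ?v"
        if "set_mset C \<subseteq> G (Suc m)" for C
        by (rule multiplicity_prod_mset_eq) (use that p(1) pos nd in blast)+
      have vpos: "?v > 0" using lucas_pos[OF assms(1-3)] True by blast
      have "multiplicity p ?v > 0"
        using p(1,2) vpos by (simp add: prime_multiplicity_gt_zero_iff)
      then have c: "count A ?v = count B ?v"
        using mult[OF Suc.prems(1)] mult[OF Suc.prems(2)] Suc.prems(3) by simp
      define r where "r C = filter_mset (\<lambda>w. w \<noteq> ?v) C" for C
      have split: "C = replicate_mset (count C ?v) ?v + r C" for C
        by (auto simp: r_def multiset_eq_iff)
      have rsub: "set_mset (r C) \<subseteq> G m" if "set_mset C \<subseteq> G (Suc m)" for C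
        proof
        fix w assume "w \<in># r C"
        then have "w \<in> G (Suc m)" "w \<noteq> ?v" using that by (auto simp: r_def)
        then show "w \<in> G m" unfolding G_def less_Suc_eq by blast
      qed
      have pr: "prod_mset C = ?v ^ count C ?v * prod_mset (r C)" for C
        by (subst split[of C]) simp
      have "prod_mset (r A) = prod_mset (r B)"
        using pr[of A] pr[of B] c Suc.prems(3) vpos by simp
      then have "r A = r B"
        using Suc.IH rsub Suc.prems(1,2) by blast
      then show ?thesis using split[of A] split[of B] c by simp
    qed
  qed
  have ex: "\<exists>m. S \<subseteq> G m" if "finite S" "S \<subseteq> prim_lucas \<phi> \<psi>" for S
    using that
  proof (induction S)
    case (insert w S)
    obtain m k where "S \<subseteq> G m" "w \<in> G k"
      using insert by (auto simp: prim_lucas_def G_def)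
    then have "insert w S \<subseteq> G (max m k)" unfolding G_def by fastforce
    then show ?case by blast
  qed auto
  have "A = B" if "set_mset A \<subseteq> prim_lucas \<phi> \<psi>" "set_mset B \<subseteq> prim_lucas \<phi> \<psi>"
    "prod_mset A = prod_mset B" for A B
    using ex[of "set_mset A \<union> set_mset B"] that uniq by auto
  then show ?thesis using assms(4) by (auto simp: mult_monoid_def)
qed

lemma mult_monoid_sample_space:
  assumes "x \<ge> 1"
  shows "finite {N \<in> mult_monoid F. 1 \<le> real N \<and> real N \<le> x}" (is "finite ?S")
    and "{N \<in> mult_monoid F. 1 \<le> real N \<and> real N \<le> x} \<noteq> {}"
proof -
  have "?S \<subseteq> {..nat \<lfloor>x\<rfloor>}" by (auto simp: le_nat_floor)
  then show "finite ?S" by (rule finite_subset) simp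
  have "1 \<in> mult_monoid F" by (auto simp: mult_monoid_def intro!: exI[of _ "{#}"])
  then show "?S \<noteq> {}" using assms by auto
qed

end

theory Submission
  imports Defs "HOL-Real_Asymp.Real_Asymp"
begin

text \<open>Primitive divisors exist for all but finitely many indices, so the generators are \<open>v\<^sub>n\<close> with
  \<open>log v\<^sub>n = n log \<phi> + O(1)\<close>, up to finitely many \<open>n\<close>, and elements of the monoid up to \<open>x\<close> are
  multiplicity vectors \<open>m\<close> with \<open>\<Sum> m\<^sub>n log v\<^sub>n \<le> log x\<close>, i.e. essentially partitions. In the Boltzmann
  model the \<open>m\<^sub>n\<close> are independent geometric variables with ratio \<open>v\<^sub>n powr - s\<close>, where
  \<open>s = \<pi> / sqrt (6 log \<phi> log x)\<close> makes the mean of \<open>\<Sum> m\<^sub>n log v\<^sub>n\<close> asymptotically \<open>log x\<close>. The uniform law is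
  the Boltzmann law reweighted by \<open>exp (- W)\<close> on \<open>W \<ge> 0\<close>, where \<open>W = s (log x - \<Sum> m\<^sub>n log v\<^sub>n)\<close>.
  The weight lives at scale 1, whereas \<open>W\<close> has standard deviation of order \<open>(log x) powr (1/4)\<close>: it
  therefore acts as conditioning on \<open>W = 0\<close> in the joint Gaussian limit of \<open>W\<close> and the number of
  distinct factors, which leaves a normal law with the conditional variance. This conditioning is
  justified by a local limit theorem at scale 1, which only involves the characteristic
  function at bounded frequencies.\<close>

section \<open>Lucas sequences and primitive divisors\<close>

text \<open>A term \<open>v n\<close> without a primitive divisor has only primes of smaller rank of
  apparition. For n > 6 each of them enters the homogeneous cyclotomic value at most once, and only
  if it divides n, so that value is at most n; but its logarithm is the totient of n times log
  \<phi> up to O(1), which is larger for all large n. The constants come from integrals. The number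
  of distinct factors has Boltzmann mean (integral of exp (- u)) / (s log \<phi>) = a1 sqrt (log x),
  up to O(1), and a2 / a1 = 1/2 - 1 / (pi^2 / 3) is a variance minus a squared covariance over the
  variance of the total. Two obstacles shape the rest. The centring must be exact to o((log
  x)^(1/4)), so sums over the parts are needed with error O(1); hence only monotone summands are
  compared with integrals. And the weight exp (- W) on W >= 0 jumps at 0, so its Fourier transform
  is not integrable; it is written as a bounded function with a single discontinuity times a smooth
  positive kernel, and it is the laws weighted by the kernel that are shown to converge.\<close>

fun lucas_int :: "int \<Rightarrow> int \<Rightarrow> nat \<Rightarrow> int" where
  "lucas_int P Q 0 = 0"
| "lucas_int P Q (Suc 0) = 1"
| "lucas_int P Q (Suc (Suc n)) = P * lucas_int P Q (Suc n) - Q * lucas_int P Q n"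

text \<open>Serves as the Euclidean step for \<open>dvd_v_iff_rank\<close>: modulo a prime dividing
  the term at \<open>Suc n\<close> only the second product is left, and of its three factors only
  the term at \<open>m\<close> can vanish.\<close>

lemma lucas_int_add:
  "lucas_int P Q (m + Suc n) =
     lucas_int P Q (Suc m) * lucas_int P Q (Suc n) - Q * lucas_int P Q m * lucas_int P Q n"
proof (induction n rule: induct_nat_012)
  case (ge2 n)
  have "lucas_int P Q (m + Suc (Suc (Suc n))) =
      P * lucas_int P Q (m + Suc (Suc n)) - Q * lucas_int P Q (m + Suc n)"
    by simp
  then show ?case
    unfolding ge2 by (simp add: algebra_simps)
qed (auto simp: algebra_simps)

text \<open>Pairs each subset avoiding \<open>q\<close> with the one obtained by adding
  \<open>q\<close>. For \<open>A\<close> the set of prime factors of n this is a Moebius sum over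
  the squarefree divisors of n, and it vanishes as soon as \<open>g\<close> is insensitive to
  multiplication of its argument by \<open>q\<close>.\<close>

lemma sum_Pow_signed:
  fixes g :: "nat \<Rightarrow> 'a::comm_ring_1"
  assumes "finite A" "q \<in> A"
  shows "(\<Sum>S\<in>Pow A. (-1) ^ card S * g (\<Prod>S)) =
         (\<Sum>S\<in>Pow (A - {q}). (-1) ^ card S * (g (\<Prod>S) - g (q * \<Prod>S)))"
proof -
  let ?B = "A - {q}"
  have A: "A = insert q ?B" using assms by auto
  have "Pow A = Pow ?B \<union> insert q ` Pow ?B"
    by (subst A) (simp only: Pow_insert)
  moreover have "Pow ?B \<inter> insert q ` Pow ?B = {}" by auto
  ultimately have "(\<Sum>S\<in>Pow A. (-1) ^ card S * g (\<Prod>S)) =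
      (\<Sum>S\<in>Pow ?B. (-1) ^ card S * g (\<Prod>S)) + (\<Sum>S\<in>insert q ` Pow ?B. (-1) ^ card S * g (\<Prod>S))"
    using assms by (simp add: sum.union_disjoint)
  also have "(\<Sum>S\<in>insert q ` Pow ?B. (-1) ^ card S * g (\<Prod>S)) =
      (\<Sum>S\<in>Pow ?B. (-1) ^ card (insert q S) * g (\<Prod>(insert q S)))"
    by (rule sum.reindex_cong[of "insert q"]) (auto simp: inj_on_def)
  also have "\<dots> = (\<Sum>S\<in>Pow ?B. - ((-1) ^ card S * g (q * \<Prod>S)))"
  proof (rule sum.cong[OF refl])
    fix S assume S: "S \<in> Pow ?B"
    then have "finite S" "q \<notin> S" using assms finite_subset by auto
    then show "(-1) ^ card (insert q S) * g (\<Prod>(insert q S)) = - ((-1) ^ card S * g (q * \<Prod>S))"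
      by simp
  qed
  finally show ?thesis
    by (simp add: sum.distrib[symmetric] algebra_simps sum_subtractf sum_negf)
qed

text \<open>In increasing order the i-th element is at least i + 1, so the product is at least
  (1/2)(2/3)...(k/(k + 1)), which telescopes.\<close>

lemma prod_one_minus_inverse_ge:
  fixes S :: "nat set"
  assumes "finite S" "\<And>p. p \<in> S \<Longrightarrow> p \<ge> 2"
  shows "(\<Prod>p\<in>S. 1 - 1 / real p) \<ge> 1 / (real (card S) + 1)"
  using assms
proof (induction S rule: finite_linorder_max_induct)
  case (insert b A)
  have bA: "b \<notin> A" using insert by auto
  have "A \<subseteq> {2..<b}" using insert by auto
  then have "card A \<le> b - 2" using card_mono[of "{2..<b}" A] by simp
  moreover have "b \<ge> 2" using insert by auto
  ultimately have b: "real b \<ge> real (card A) + 2" by linarith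
  have IH: "(\<Prod>p\<in>A. 1 - 1 / real p) \<ge> 1 / (real (card A) + 1)"
    using insert by auto
  have "1 / (real (card (insert b A)) + 1) =
      (1 - 1 / (real (card A) + 2)) * (1 / (real (card A) + 1))"
    using insert(1) bA by (simp add: field_simps)
  also have "\<dots> \<le> (1 - 1 / real b) * (\<Prod>p\<in>A. 1 - 1 / real p)"
    using IH b by (intro mult_mono) (auto simp: frac_le)
  finally show ?case using insert bA by simp
qed simp

lemma ln_eq_sum_multiplicity:
  fixes k :: nat
  assumes "k > 0" "finite A" "prime_factors k \<subseteq> A" "\<And>p. p \<in> A \<Longrightarrow> prime p"
  shows "ln (real k) = (\<Sum>p\<in>A. real (multiplicity p k) * ln (real p))"
proof -
  have "real k = (\<Prod>p\<in>prime_factors k. real p ^ multiplicity p k)"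
    using prime_factorization_nat[OF assms(1)] by (metis (no_types, lifting) of_nat_power of_nat_prod prod.cong)
  then have "ln (real k) = ln (\<Prod>p\<in>prime_factors k. real p ^ multiplicity p k)" by simp
  also have "\<dots> = (\<Sum>p\<in>prime_factors k. ln (real p ^ multiplicity p k))"
    by (rule ln_prod) (auto simp: in_prime_factors_iff prime_gt_0_nat)
  also have "\<dots> = (\<Sum>p\<in>prime_factors k. real (multiplicity p k) * ln (real p))"
    by (intro sum.cong refl ln_realpow)
  also have "\<dots> = (\<Sum>p\<in>A. real (multiplicity p k) * ln (real p))"
    using assms by (intro sum.mono_neutral_left)
      (auto simp: in_prime_factors_iff not_dvd_imp_multiplicity_0)
  finally show ?thesis .
qed

text \<open>Needed for \<open>prim_log_ge\<close>: distinct sets of prime factors of n give distinct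
  quotients of n, so the error terms there run over distinct exponents.\<close>

lemma inj_on_Prod_primes:
  assumes "finite A" "\<And>p. p \<in> A \<Longrightarrow> prime (p::nat)"
  shows "inj_on Prod (Pow A)"
proof (rule inj_onI)
  have *: "S \<subseteq> T" if "S \<subseteq> A" "T \<subseteq> A" "\<Prod>S = \<Prod>T" for S T
  proof
    fix p assume p: "p \<in> S"
    have "finite S" "finite T" using that assms finite_subset by blast+
    then have "p dvd \<Prod>T" using p that(3) dvd_prodI[of S p "\<lambda>x. x"] by simp
    moreover have pp: "prime p" using p that assms(2) by blast
    ultimately obtain q where q: "q \<in> T" "p dvd q"
      using \<open>finite T\<close> prime_dvd_prod_iff[of T p "\<lambda>x. x"] by auto
    then have "p = q" using primes_dvd_imp_eq[OF pp] assms(2) that by blast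
    then show "p \<in> T" using q by simp
  qed
  fix S T assume "S \<in> Pow A" "T \<in> Pow A" "\<Prod>S = \<Prod>T"
  then show "S = T" using *[of S T] *[of T S] by auto
qed

lemma Prod_prime_factors_dvd:
  fixes n :: nat
  assumes "S \<subseteq> prime_factors n" shows "\<Prod>S dvd n"
proof -
  have "finite S" using assms finite_subset by blast
  then show ?thesis using assms
  proof (induction S)
    case (insert p S)
    have "coprime p s" if "s \<in> S" for s
      using insert that by (intro primes_coprime) (auto simp: in_prime_factors_iff)
    then have "coprime p (\<Prod>S)" by (intro prod_coprime_right) auto
    then show ?case using insert by (auto intro!: divides_mult simp: in_prime_factors_iff)
  qed simp
qed

section \<open>Arithmetic of a Lucas sequence: Binet formula, divisibility, prime
  multiplicities\<close>

locale lucas_pair =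
  fixes \<phi> \<psi> :: real and P Q :: int
  assumes sum_eq: "\<phi> + \<psi> = of_int P" and prod_eq: "\<phi> * \<psi> = of_int Q"
    and Q_nz: "Q \<noteq> 0" and coprime_PQ: "coprime P Q" and dominant: "\<phi> > \<bar>\<psi>\<bar>"
begin

abbreviation U :: "nat \<Rightarrow> int" where "U \<equiv> lucas_int P Q"
abbreviation v :: "nat \<Rightarrow> nat" where "v \<equiv> lucas \<phi> \<psi>"

lemma binet: "of_int (U n) * (\<phi> - \<psi>) = \<phi> ^ n - \<psi> ^ n"
proof (induction n rule: induct_nat_012)
  case (ge2 n)
  have "of_int (U (Suc (Suc n))) * (\<phi> - \<psi>) =
      (\<phi> + \<psi>) * (of_int (U (Suc n)) * (\<phi> - \<psi>)) - \<phi> * \<psi> * (of_int (U n) * (\<phi> - \<psi>))"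
    unfolding sum_eq prod_eq by (simp add: algebra_simps)
  then show ?case unfolding ge2 by (simp add: algebra_simps)
qed auto

lemma U_eq_lucas_real: "of_int (U n) = lucas_real \<phi> \<psi> n"
  using binet[of n] dominant unfolding lucas_real_def
  by (metis abs_le_self_iff less_le_not_le nonzero_eq_divide_eq right_minus_eq abs_ge_self)

lemma int_v [simp]: "int (v n) = U n"
proof (cases "n = 0")
  case False
  then have "real (v n) = of_int (U n)"
    using real_lucas[OF dominant sum_eq prod_eq, of n] U_eq_lucas_real[of n] by simp
  then show ?thesis by linarith
qed (simp add: lucas_def lucas_real_def)

lemma real_v: "real (v n) = (\<phi> ^ n - \<psi> ^ n) / (\<phi> - \<psi>)"
  using U_eq_lucas_real[of n] int_v[of n] unfolding lucas_real_def by (metis of_int_of_nat_eq)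

lemma v_pos: "n \<ge> 1 \<Longrightarrow> v n > 0"
  using lucas_pos[OF dominant sum_eq prod_eq] by simp

lemma U_pos: "n \<ge> 1 \<Longrightarrow> U n > 0"
  using v_pos[of n] int_v[of n] by linarith

lemma power_\<phi>: "\<phi> ^ Suc k = of_int (U (Suc k)) * \<phi> - of_int (Q * U k)"
proof (induction k)
  case (Suc k)
  have "\<phi> * \<phi> = of_int P * \<phi> - of_int Q"
    using sum_eq prod_eq by (simp add: algebra_simps flip: sum_eq prod_eq)
  then have "of_int (U (Suc k)) * (\<phi> * \<phi>) = of_int (U (Suc k)) * (of_int P * \<phi> - of_int Q)" by simp
  moreover have "\<phi> ^ Suc (Suc k) = (of_int (U (Suc k)) * \<phi> - of_int (Q * U k)) * \<phi>"
    using Suc by (metis power_Suc2)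
  ultimately show ?case by (simp add: algebra_simps)
qed auto

lemma power_\<psi>: "\<psi> ^ Suc k = of_int (U (Suc k)) * \<psi> - of_int (Q * U k)"
proof -
  have "\<psi> ^ Suc k = \<phi> ^ Suc k - of_int (U (Suc k)) * (\<phi> - \<psi>)"
    using binet[of "Suc k"] by simp
  then show ?thesis unfolding power_\<phi> by (simp add: algebra_simps)
qed

text \<open>The linear expressions in \<open>power_\<phi>\<close> and \<open>power_\<psi>\<close>
  have the same coefficients for both conjugates. Raising them to the power j and subtracting turns
  y^i into \<open>U i\<close> after division by \<phi> - \<psi>.\<close>

lemma U_mult_Suc:
  "U (j * Suc k) = (\<Sum>i\<le>j. of_nat (j choose i) * (U (Suc k)) ^ i * (- Q * U k) ^ (j - i) * U i)"
proof -
  let ?c = "of_int (- Q * U k) :: real"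
  have exp: "(y * of_int (U (Suc k)) + ?c) ^ j =
      (\<Sum>i\<le>j. of_nat (j choose i) * of_int (U (Suc k)) ^ i * ?c ^ (j - i) * y ^ i)" for y :: real
    unfolding binomial_ring by (intro sum.cong refl) (simp add: power_mult_distrib)
  have "of_int (U (j * Suc k)) * (\<phi> - \<psi>) = (\<phi> ^ Suc k) ^ j - (\<psi> ^ Suc k) ^ j"
    unfolding binet power_mult[symmetric] by (simp add: mult.commute)
  also have "\<dots> = (\<phi> * of_int (U (Suc k)) + ?c) ^ j - (\<psi> * of_int (U (Suc k)) + ?c) ^ j"
    unfolding power_\<phi> power_\<psi> by (simp add: mult.commute)
  also have "\<dots> = (\<Sum>i\<le>j. of_nat (j choose i) * of_int (U (Suc k)) ^ i * ?c ^ (j - i) * (\<phi> ^ i - \<psi> ^ i))"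
    unfolding exp sum_subtractf[symmetric] by (intro sum.cong refl) (simp add: algebra_simps)
  also have "\<dots> = of_int (\<Sum>i\<le>j. of_nat (j choose i) * (U (Suc k)) ^ i * (- Q * U k) ^ (j - i) * U i) * (\<phi> - \<psi>)"
    unfolding binet[symmetric] of_int_sum sum_distrib_right by (intro sum.cong refl) simp
  finally have "of_int (U (j * Suc k)) =
      (of_int (\<Sum>i\<le>j. of_nat (j choose i) * (U (Suc k)) ^ i * (- Q * U k) ^ (j - i) * U i) :: real)"
    using dominant by (subst (asm) mult_cancel_right) auto
  then show ?thesis by (simp only: of_int_eq_iff)
qed

text \<open>Modulo a divisor of Q the recurrence is multiplication by P, so \<open>U (Suc n)\<close>
  is congruent to P^n; a common prime would divide both P and Q.\<close>

lemma prime_dvd_U_not_dvd_Q: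
  assumes "prime p" "p dvd U (Suc n)" shows "\<not> p dvd Q"
proof
  assume pQ: "p dvd Q"
  have "p dvd U (Suc n) - P ^ n" for n
  proof (induction n)
    case (Suc n)
    have "U (Suc (Suc n)) - P ^ Suc n = P * (U (Suc n) - P ^ n) - Q * U n"
      by (simp add: algebra_simps)
    then show ?case using dvd_diff[OF dvd_mult[OF Suc, of P] dvd_mult2[OF pQ, of "U n"]] by metis
  qed simp
  then have "p dvd U (Suc n) - (U (Suc n) - P ^ n)" using assms(2) dvd_diff by blast
  then have "p dvd P ^ n" by simp
  then have "p dvd P" using assms(1) prime_dvd_power by blast
  then show False using pQ coprime_PQ assms(1) by (meson coprime_common_divisor not_prime_unit)
qed

text \<open>If \<open>p\<close> divided two consecutive terms, then, being prime to Q, it would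
  divide all earlier ones down to U 1 = 1.\<close>

lemma prime_dvd_U_not_dvd_pred:
  assumes "prime p" "p dvd U (Suc n)" shows "\<not> p dvd U n"
  using assms
proof (induction n)
  case (Suc n)
  have "\<not> p dvd Q" using prime_dvd_U_not_dvd_Q Suc.prems by blast
  moreover have "Q * U n = P * U (Suc n) - U (Suc (Suc n))" by simp
  ultimately show ?case using Suc by (metis dvd_diff dvd_mult prime_dvd_mult_iff)
qed auto

text \<open>The binomial expansion of \<open>\<phi>^(j k) = (U k * \<phi> - Q * U (k - 1))^j\<close> exhibits \<open>U (j k)\<close> as
  \<open>U k * quot j k\<close>.\<close>

definition quot :: "nat \<Rightarrow> nat \<Rightarrow> int" where
  "quot j k = (\<Sum>i\<in>{1..j}. of_nat (j choose i) * (U k) ^ (i - 1) * (- Q * U (k - 1)) ^ (j - i) * U i)"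

lemma U_mult: assumes "k \<ge> 1" shows "U (j * k) = U k * quot j k"
proof -
  obtain k' where k: "k = Suc k'" using assms by (metis Suc_le_D One_nat_def)
  have s: "{..j} = insert 0 {1..j}" by auto
  show ?thesis unfolding quot_def k U_mult_Suc s sum_distrib_left
    by (simp, intro sum.cong refl) (auto simp: power_eq_if algebra_simps)
qed

text \<open>Isolates the term i = 1 of \<open>quot\<close>. All later terms contain
  \<open>U k\<close>; modulo p^2 the term i = 2 needs the help of its binomial coefficient, while
  those with i >= 3 contain the square of \<open>U k\<close>.\<close>

lemma quot_cong:
  assumes "k \<ge> 1" "j \<ge> 1"
  shows "U k dvd quot j k - of_nat j * (- Q * U (k - 1)) ^ (j - 1)"
    and "p dvd U k \<Longrightarrow> p dvd of_nat (j choose 2) \<Longrightarrow>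
          p\<^sup>2 dvd quot j k - of_nat j * (- Q * U (k - 1)) ^ (j - 1)"
proof -
  let ?f = "\<lambda>i. of_nat (j choose i) * (U k) ^ (i - 1) * (- Q * U (k - 1)) ^ (j - i) * U i"
  have s: "{1..j} = insert 1 {2..j}" using assms by auto
  have eq: "quot j k - of_nat j * (- Q * U (k - 1)) ^ (j - 1) = (\<Sum>i\<in>{2..j}. ?f i)"
    unfolding quot_def s by simp
  show "U k dvd quot j k - of_nat j * (- Q * U (k - 1)) ^ (j - 1)"
    unfolding eq by (intro dvd_sum dvd_mult2 dvd_mult) (auto intro!: dvd_power)
  show "p\<^sup>2 dvd quot j k - of_nat j * (- Q * U (k - 1)) ^ (j - 1)"
    if p: "p dvd U k" "p dvd of_nat (j choose 2)"
    unfolding eq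
  proof (intro dvd_sum)
    fix i assume "i \<in> {2..j}"
    then consider "i = 2" | "i \<ge> 3" by fastforce
    then have "p\<^sup>2 dvd of_nat (j choose i) * (U k) ^ (i - 1)"
    proof cases
      case 1
      then show ?thesis using p by (simp add: power2_eq_square mult_dvd_mono)
    next
      case 2
      have "p\<^sup>2 dvd (U k)\<^sup>2" using p by (simp add: dvd_power_same)
      also have "(U k)\<^sup>2 dvd (U k) ^ (i - 1)" using 2 by (intro le_imp_power_dvd) auto
      finally show ?thesis by (rule dvd_mult)
    qed
    then show "p\<^sup>2 dvd ?f i" by (metis dvd_mult2)
  qed
qed

lemma prime_not_dvd_coeff:
  assumes "prime p" "p dvd U k" "k \<ge> 1" shows "\<not> p dvd - Q * U (k - 1)"
proof -
  obtain k' where k: "k = Suc k'" using assms by (metis Suc_le_D One_nat_def)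
  show ?thesis unfolding k diff_Suc_1
    using prime_dvd_U_not_dvd_Q[of p k'] prime_dvd_U_not_dvd_pred[of p k'] assms
    by (simp add: k prime_dvd_mult_iff del: lucas_int.simps)
qed

lemma quot_pos: assumes "k \<ge> 1" "j \<ge> 1" shows "quot j k > 0"
  using U_mult[OF assms(1), of j] U_pos[of k] U_pos[of "j * k"] assms
  by (simp add: zero_less_mult_iff)

lemma v_mult: "k \<ge> 1 \<Longrightarrow> v (j * k) = v k * nat (quot j k)"
  using U_mult[of k j] by (metis int_v nat_int nat_mult_distrib of_nat_0_le_iff)

lemma v_dvd: "k dvd n \<Longrightarrow> n \<ge> 1 \<Longrightarrow> v k dvd v n"
  using v_mult[of k] by (auto elim!: dvdE simp: mult.commute Suc_le_eq)

lemma multiplicity_v_mult: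
  assumes "prime p" "k \<ge> 1" "j \<ge> 1"
  shows "multiplicity p (v (j * k)) = multiplicity p (v k) + multiplicity p (nat (quot j k))"
  unfolding v_mult[OF assms(2)] using assms v_pos[of k] quot_pos[of k j]
  by (subst prime_elem_multiplicity_mult_distrib) auto

text \<open>By \<open>quot_cong\<close> the cofactor \<open>quot j k\<close> is congruent modulo
  \<open>p\<close> to j times a unit.\<close>

lemma multiplicity_v_mult_coprime:
  assumes "prime p" "k \<ge> 1" "j \<ge> 1" "p dvd v k" "\<not> p dvd j"
  shows "multiplicity p (v (j * k)) = multiplicity p (v k)"
proof -
  have pU: "int p dvd U k" using assms(4) by (metis int_v int_dvd_int_iff)
  have pp: "prime (int p)" using assms(1) by simp
  have "\<not> int p dvd quot j k"
  proof
    assume "int p dvd quot j k"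
    then have "int p dvd of_nat j * (- Q * U (k - 1)) ^ (j - 1)"
      using dvd_trans[OF pU quot_cong(1)[OF assms(2,3)]] by (simp only: dvd_diff_right_iff)
    then have "int p dvd int j \<or> int p dvd - Q * U (k - 1)"
      using pp by (metis prime_dvd_mult_iff prime_dvd_power)
    then show False using assms(5) prime_not_dvd_coeff[OF pp pU assms(2)]
      unfolding int_dvd_int_iff by blast
  qed
  then have "\<not> p dvd nat (quot j k)" using quot_pos[OF assms(2,3)] by (metis int_dvd_int_iff nat_0_le less_imp_le)
  then show ?thesis using multiplicity_v_mult[OF assms(1-3)] by (simp add: not_dvd_imp_multiplicity_0)
qed

text \<open>Lifting the exponent: modulo p^2 the cofactor is p times a unit. For odd
  \<open>p\<close> the binomial coefficient p choose 2 is a multiple of p; for p = 2 it is 1, and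
  divisibility of \<open>v k\<close> by 4 makes up for it.\<close>

lemma multiplicity_v_mult_prime:
  assumes "prime p" "k \<ge> 1" "p dvd v k" "p = 2 \<Longrightarrow> 4 dvd v k"
  shows "multiplicity p (v (p * k)) \<le> multiplicity p (v k) + 1"
proof -
  have p1: "p \<ge> 1" using assms(1) prime_ge_1_nat by blast
  have pU: "int p dvd U k" using assms(3) by (metis int_v int_dvd_int_iff)
  have pp: "prime (int p)" using assms(1) by simp
  have "(int p)\<^sup>2 dvd quot p k - of_nat p * (- Q * U (k - 1)) ^ (p - 1)"
  proof (cases "p = 2")
    case True
    then have "int 4 dvd int (v k)" using assms(4) by (simp only: int_dvd_int_iff)
    then have "(int p)\<^sup>2 dvd U k" using True by simp
    then show ?thesis using quot_cong(1)[OF assms(2) p1] dvd_trans by blast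
  next
    case False
    then have "p > 2" using assms(1) prime_ge_2_nat[of p] by auto
    then have "p dvd (p choose 2)" using assms(1) by (intro dvd_choose_prime) auto
    then have "int p dvd of_nat (p choose 2)" by simp
    then show ?thesis using quot_cong(2)[OF assms(2) p1 pU] by blast
  qed
  moreover have "\<not> (int p)\<^sup>2 dvd of_nat p * (- Q * U (k - 1)) ^ (p - 1)"
  proof
    assume "(int p)\<^sup>2 dvd of_nat p * (- Q * U (k - 1)) ^ (p - 1)"
    then have "int p dvd (- Q * U (k - 1)) ^ (p - 1)"
      using p1 unfolding power2_eq_square by (subst (asm) dvd_mult_cancel_left) auto
    then show False using prime_not_dvd_coeff[OF pp pU assms(2)] pp prime_dvd_power by blast
  qed
  ultimately have "\<not> (int p)\<^sup>2 dvd quot p k" using dvd_diff_right_iff by blast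
  then have "\<not> p ^ 2 dvd nat (quot p k)"
    using quot_pos[OF assms(2) p1] by (metis int_dvd_int_iff nat_0_le less_imp_le of_nat_power)
  then have "multiplicity p (nat (quot p k)) < 2"
    by (meson multiplicity_dvd' not_less)
  then show ?thesis using multiplicity_v_mult[OF assms(1,2) p1] by simp
qed

text \<open>The rank of apparition of \<open>p\<close>; meaningful for primes that divide some
  term.\<close>

definition rank :: "nat \<Rightarrow> nat" where "rank p = (LEAST r. r \<ge> 1 \<and> p dvd v r)"

text \<open>Subtracting a multiple of the rank from the index preserves divisibility by
  \<open>p\<close>, by \<open>lucas_int_add\<close> at a term divisible by \<open>p\<close>. A
  nonzero remainder would contradict minimality.\<close>

lemma dvd_v_iff_rank:
  assumes p: "prime p" "p dvd v m" "m \<ge> 1" and n: "n \<ge> 1"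
  shows "p dvd v n \<longleftrightarrow> rank p dvd n" and "rank p \<ge> 1" and "p dvd v (rank p)"
proof -
  have r: "rank p \<ge> 1 \<and> p dvd v (rank p)"
    unfolding rank_def by (rule LeastI[of _ m]) (use p in auto)
  then show "rank p \<ge> 1" "p dvd v (rank p)" by auto
  have least: "rank p \<le> i" if "i \<ge> 1" "p dvd v i" for i
    unfolding rank_def using that by (intro Least_le) auto
  have pp: "prime (int p)" using p by simp
  have iff: "p dvd v i \<longleftrightarrow> int p dvd U i" for i by (metis int_v int_dvd_int_iff)
  show "p dvd v n \<longleftrightarrow> rank p dvd n"
  proof
    assume "rank p dvd n"
    then show "p dvd v n" using r v_dvd n dvd_trans by blast
  next
    assume pn: "p dvd v n"
    define i where "i = n mod rank p"
    show "rank p dvd n"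
    proof (rule ccontr)
      assume nd: "\<not> rank p dvd n"
      then have i: "i \<ge> 1" "i < rank p"
        using r by (auto simp: i_def dvd_eq_mod_eq_0 Suc_le_eq)
      have "n div rank p \<ge> 1"
        using least[OF n pn] r by (simp add: div_greater_zero_iff Suc_le_eq)
      then have "(n div rank p) * rank p \<ge> 1" using r by (metis mult_le_mono nat_mult_1)
      then obtain l where l: "(n div rank p) * rank p = Suc l" by (metis Suc_le_D One_nat_def)
      have n_eq: "n = i + Suc l" unfolding i_def using l by (metis mod_div_mult_eq)
      have "rank p dvd Suc l" using l by (metis dvd_triv_right)
      then have pl: "int p dvd U (Suc l)" using r v_dvd[of "rank p" "Suc l"] dvd_trans unfolding iff[symmetric] by auto
      have "int p dvd U n" using pn by (simp only: iff)
      then have "int p dvd Q * U i * U l"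
        using dvd_mult[OF pl] unfolding n_eq lucas_int_add by (simp only: dvd_diff_right_iff)
      then have "int p dvd U i"
        using pp prime_dvd_U_not_dvd_Q[OF pp pl] prime_dvd_U_not_dvd_pred[OF pp pl]
        by (simp add: prime_dvd_mult_iff)
      then have "p dvd v i" by (simp only: iff)
      then show False using least[of i] i by auto
    qed
  qed
qed

text \<open>U 2 = P and U 3 = P^2 - Q cannot both be odd when Q is odd. The bound n > 6 = 2 * 3
  below originates here.\<close>

lemma rank_2_le: assumes "2 dvd v m" "m \<ge> 1" shows "rank 2 \<le> 3"
proof -
  obtain m' where m: "m = Suc m'" using assms by (metis Suc_le_D One_nat_def)
  have iff: "2 dvd v i \<longleftrightarrow> 2 dvd U i" for i by (metis int_v int_dvd_int_iff of_nat_numeral)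
  have "2 dvd U m" using assms by (simp only: iff)
  then have "odd Q" using prime_dvd_U_not_dvd_Q[of 2 m'] m by simp
  then have "2 dvd U 2 \<or> 2 dvd U 3" by (auto simp: numeral_2_eq_2 numeral_3_eq_3)
  then have "2 dvd v 2 \<or> 2 dvd v 3" by (simp only: iff)
  then show ?thesis unfolding rank_def
    using Least_le[of "\<lambda>r. r \<ge> 1 \<and> 2 dvd v r" 2] Least_le[of "\<lambda>r. r \<ge> 1 \<and> 2 dvd v r" 3] by auto
qed

text \<open>The logarithm of the homogeneous cyclotomic value \<open>\<Phi>\<^sub>n(\<phi>, \<psi>)\<close>, by Moebius inversion over the
  squarefree divisors of \<open>n\<close>.\<close>

definition prim_log :: "nat \<Rightarrow> real" where
  "prim_log n = (\<Sum>S\<in>Pow (prime_factors n). (-1) ^ card S * ln (real (v (n div \<Prod>S))))"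

text \<open>Pairing \<open>S\<close> with \<open>S \<union> {q}\<close> for a prime \<open>q\<close> dividing \<open>n / rank p\<close> makes the sum vanish unless
  \<open>n / rank p\<close> is a power of \<open>p\<close>, in which case two terms survive. The bound on \<open>n\<close> excludes the
  irregular behaviour of \<open>p = 2\<close> at \<open>n = 2 * rank 2\<close>.\<close>

lemma multiplicity_alternating_sum_le:
  assumes p: "prime p" "p dvd v n" and n: "n > 6" and r: "rank p < n"
  shows "(\<Sum>S\<in>Pow (prime_factors n). (-1) ^ card S * real (multiplicity p (v (n div \<Prod>S))))
           \<le> (if p dvd n then 1 else 0)"
proof -
  define r where "r = rank p"
  have n1: "n \<ge> 1" using n by simp
  note rk = dvd_v_iff_rank[OF p n1]
  have r1: "r \<ge> 1" and pr: "p dvd v r" using rk(2,3)[OF n1] by (auto simp: r_def)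
  have r_dvd: "p dvd v k \<longleftrightarrow> r dvd k" if "k \<ge> 1" for k
    using rk(1)[OF that] by (simp add: r_def)
  define m where "m = n div r"
  have n_eq: "n = r * m" using r_dvd[OF n1] p by (simp add: m_def)
  have "m > 1" using n_eq r n1 by (cases m) (auto simp: r_def)
  define g where "g d = real (multiplicity p (v (n div d)))" for d
  have PF: "finite (prime_factors n)" by simp
  have dn: "d * e = n \<Longrightarrow> r dvd n div d \<longleftrightarrow> d dvd m" for d e
  proof -
    assume "d * e = n"
    then have "n div d = e" "d > 0" using n1 by (cases "d = 0", auto)+
    moreover have "r dvd e \<longleftrightarrow> d dvd m"
    proof
      assume "r dvd e"
      then obtain f where "e = r * f" by auto
      then have "m = d * f" using \<open>d * e = n\<close> n_eq r1 by auto
      then show "d dvd m" by simp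
    next
      assume "d dvd m"
      then obtain f where "m = d * f" by auto
      then have "e = r * f" using \<open>d * e = n\<close> n_eq \<open>d > 0\<close> by auto
      then show "r dvd e" by simp
    qed
    ultimately show ?thesis by simp
  qed
  have g0: "g d = 0" if "d dvd n" "\<not> d dvd m" for d
  proof -
    obtain e where e: "n = d * e" using \<open>d dvd n\<close> by auto
    then have "n div d \<ge> 1" using n1 by (cases "d = 0") auto
    then show ?thesis using dn[of d e] e that r_dvd[of "n div d"]
      by (simp add: g_def not_dvd_imp_multiplicity_0)
  qed
  have main: "(\<Sum>S\<in>Pow (prime_factors n). (-1) ^ card S * g (\<Prod>S)) =
      (\<Sum>S\<in>Pow (prime_factors n - {q}). (-1) ^ card S * (g (\<Prod>S) - g (q * \<Prod>S)))"
    if "prime q" "q dvd m" for q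
    using that n1 n_eq by (intro sum_Pow_signed PF) (auto simp: in_prime_factors_iff)
  have ProdS: "\<Prod>S dvd n" "q * \<Prod>S dvd n" "coprime q (\<Prod>S)"
    if S: "S \<subseteq> prime_factors n - {q}" and q: "prime q" "q dvd m" for S q
  proof -
    have fS: "finite S" using S PF by (meson finite_Diff finite_subset)
    have cop: "coprime q s" if "s \<in> S" for s
      using S that q by (intro primes_coprime) (auto simp: in_prime_factors_iff)
    then show c: "coprime q (\<Prod>S)" using fS by (intro prod_coprime_right) auto
    show Sn: "\<Prod>S dvd n" using S by (intro Prod_prime_factors_dvd) auto
    have "q dvd n" using q n_eq by auto
    then show "q * \<Prod>S dvd n" using Sn c by (rule divides_mult)
  qed
  show ?thesis unfolding g_def[symmetric]
  proof (cases "\<exists>q. prime q \<and> q dvd m \<and> q \<noteq> p")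
    case True
    then obtain q where q: "prime q" "q dvd m" "q \<noteq> p" by auto
    have "g (\<Prod>S) = g (q * \<Prod>S)" if S: "S \<subseteq> prime_factors n - {q}" for S
    proof (cases "\<Prod>S dvd m")
      case False
      then show ?thesis using g0 ProdS[OF S q(1,2)] by (metis dvd_mult_right)
    next
      case dm: True
      obtain e where e: "n = q * \<Prod>S * e" using ProdS[OF S q(1,2)] by auto
      have q0: "q \<ge> 1" using q prime_ge_1_nat by blast
      have e1: "e \<ge> 1" using e n1 by (cases e) auto
      have S0: "\<Prod>S > 0" using e n1 by (cases "\<Prod>S = 0") auto
      have "q * \<Prod>S dvd m" using q dm ProdS[OF S q(1,2)] by (intro divides_mult) auto
      then have "r dvd n div (q * \<Prod>S)" using dn[of "q * \<Prod>S" e] e by simp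
      moreover have d1: "n div (q * \<Prod>S) = e" "n div \<Prod>S = q * e" using e q0 S0 by auto
      ultimately have "p dvd v e" using r_dvd[OF e1] by simp
      moreover have "\<not> p dvd q" using p q primes_dvd_imp_eq by blast
      ultimately show ?thesis unfolding g_def d1
        using multiplicity_v_mult_coprime[OF p(1) e1 q0] by simp
    qed
    then show "(\<Sum>S\<in>Pow (prime_factors n). (-1) ^ card S * g (\<Prod>S)) \<le> (if p dvd n then 1 else 0)"
      unfolding main[OF q(1,2)] by simp
  next
    case False
    obtain q where "prime q" "q dvd m" using \<open>m > 1\<close> prime_factor_nat[of m] by auto
    with False have pm: "p dvd m" by auto
    \<comment> \<open>Here \<open>m\<close> is a power of \<open>p\<close>. A nonempty S avoiding
      \<open>p\<close> contains a prime not dividing \<open>m\<close>, so \<open>rank p\<close>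
      divides neither of the two indices and both terms vanish.\<close>
    have "(\<Sum>S\<in>Pow (prime_factors n - {p}). (-1) ^ card S * (g (\<Prod>S) - g (p * \<Prod>S))) =
          (\<Sum>S\<in>{{}}. (-1) ^ card S * (g (\<Prod>S) - g (p * \<Prod>S)))"
    proof (rule sum.mono_neutral_right)
      show "\<forall>S\<in>Pow (prime_factors n - {p}) - {{}}. (-1) ^ card S * (g (\<Prod>S) - g (p * \<Prod>S)) = 0"
      proof
        fix S assume S: "S \<in> Pow (prime_factors n - {p}) - {{}}"
        then have S': "S \<subseteq> prime_factors n - {p}" by auto
        obtain s where s: "s \<in> S" using S by auto
        have fS: "finite S" using S' PF by (meson finite_Diff finite_subset)
        have "s dvd \<Prod>S" using fS s dvd_prodI[of S s "\<lambda>x. x"] by simp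
        moreover have "\<not> s dvd m" using False s S' by (auto simp: in_prime_factors_iff)
        ultimately have nd: "\<not> \<Prod>S dvd m" using dvd_trans by blast
        then have "\<not> p * \<Prod>S dvd m" by (metis dvd_mult_right)
        then have "g (\<Prod>S) = 0" "g (p * \<Prod>S) = 0"
          using nd g0 ProdS[OF S' p(1) pm] by auto
        then show "(-1) ^ card S * (g (\<Prod>S) - g (p * \<Prod>S)) = 0" by simp
      qed
    qed auto
    then have eq: "(\<Sum>S\<in>Pow (prime_factors n). (-1) ^ card S * g (\<Prod>S)) = g 1 - g p"
      unfolding main[OF p(1) pm] by simp
    obtain m' where m': "m = p * m'" using pm by auto
    have p1: "p \<ge> 1" using p prime_ge_1_nat by blast
    have m'1: "m' \<ge> 1" using m' \<open>m > 1\<close> by (cases m') auto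
    define k where "k = r * m'"
    have k: "n = p * k" "k \<ge> 1" using n_eq m' m'1 r1 by (auto simp: k_def)
    have pk: "p dvd v k" using r_dvd[OF k(2)] by (simp add: k_def)
    \<comment> \<open>Since the rank is at most 3 and n > 6, the quotient \<open>m'\<close> is even.
      So \<open>k = 2 * l\<close> with \<open>v l\<close> already even, and the cofactor
      \<open>quot 2 l\<close> supplies the second factor 2.\<close>
    have four: "4 dvd v k" if p2: "p = 2"
    proof -
      have "r \<le> 3" using rank_2_le[of n] p n1 p2 by (simp add: r_def)
      then have "m' \<noteq> 1" using n n_eq m' p2 by auto
      then obtain q where q: "prime q" "q dvd m'" using prime_factor_nat by blast
      have "q = 2" using False q m' p2 by auto
      then obtain m'' where m'': "m' = 2 * m''" using q by auto
      have m''1: "m'' \<ge> 1" using m'' m'1 by (cases m'') auto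
      define l where "l = r * m''"
      have l: "k = 2 * l" "l \<ge> 1" using m'' m''1 r1 by (auto simp: k_def l_def)
      have pl: "2 dvd v l" using r_dvd[OF l(2)] p2 by (simp add: l_def)
      have "2 dvd U l" using pl by (metis int_v int_dvd_int_iff of_nat_numeral)
      moreover have "U l dvd quot 2 l - of_nat 2 * (- Q * U (l - 1)) ^ (2 - 1)"
        by (rule quot_cong(1)) (use l in auto)
      ultimately have "2 dvd quot 2 l - of_nat 2 * (- Q * U (l - 1)) ^ (2 - 1)"
        using dvd_trans by blast
      then have "2 dvd quot 2 l" by simp
      then have "2 dvd nat (quot 2 l)"
        using quot_pos[OF l(2), of 2] by (simp add: even_nat_iff)
      then have "2 * 2 dvd v l * nat (quot 2 l)" using pl by (rule mult_dvd_mono[rotated])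
      then show ?thesis unfolding l(1) v_mult[OF l(2)] by simp
    qed
    have "g 1 - g p \<le> 1"
      using multiplicity_v_mult_prime[OF p(1) k(2) pk four] k p1 by (simp add: g_def)
    moreover have "p dvd n" using k by simp
    ultimately show "(\<Sum>S\<in>Pow (prime_factors n). (-1) ^ card S * g (\<Prod>S)) \<le> (if p dvd n then 1 else 0)"
      unfolding eq by simp
  qed
qed

text \<open>Without a primitive divisor every prime dividing \<open>v n\<close> divides an earlier
  term, hence has rank below n. By \<open>multiplicity_alternating_sum_le\<close> it contributes at
  most its logarithm, and only if it divides n; these primes multiply to at most n.\<close>

lemma prim_log_le:
  assumes n: "n > 6" and no: "\<nexists>p. primitive_divisor \<phi> \<psi> p n"
  shows "prim_log n \<le> ln (real n)"
proof -
  define A where "A = prime_factors (v n)"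
  have n1: "n \<ge> 1" using n by simp
  have PS: "n div \<Prod>S \<ge> 1 \<and> n div \<Prod>S dvd n" if S: "S \<subseteq> prime_factors n" for S
  proof -
    have "\<Prod>S dvd n" using Prod_prime_factors_dvd[OF S] .
    moreover from this have "\<Prod>S > 0" using n1 by (intro Nat.gr0I) simp
    moreover have "\<Prod>S \<le> n" using calculation n1 by (intro dvd_imp_le) auto
    ultimately show ?thesis by (simp add: Suc_le_eq div_greater_zero_iff div_dvd_iff_mult)
  qed
  have ln_v: "ln (real (v (n div \<Prod>S))) = (\<Sum>p\<in>A. real (multiplicity p (v (n div \<Prod>S))) * ln (real p))"
    if "S \<subseteq> prime_factors n" for S
  proof (rule ln_eq_sum_multiplicity)
    have "v (n div \<Prod>S) dvd v n" using v_dvd PS[OF that] n1 by blast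
    then show "prime_factors (v (n div \<Prod>S)) \<subseteq> A"
      unfolding A_def using v_pos[OF n1] by (intro dvd_prime_factors) auto
  qed (use v_pos PS[OF that] in \<open>auto simp: A_def in_prime_factors_iff\<close>)
  have "prim_log n = (\<Sum>S\<in>Pow (prime_factors n). \<Sum>p\<in>A.
           ln (real p) * ((-1) ^ card S * real (multiplicity p (v (n div \<Prod>S)))))"
    unfolding prim_log_def by (intro sum.cong refl) (simp add: ln_v sum_distrib_left mult_ac)
  also have "\<dots> = (\<Sum>p\<in>A. ln (real p) * (\<Sum>S\<in>Pow (prime_factors n).
           (-1) ^ card S * real (multiplicity p (v (n div \<Prod>S)))))"
    by (subst sum.swap) (simp add: sum_distrib_left)
  also have "\<dots> \<le> (\<Sum>p\<in>A. ln (real p) * (if p dvd n then 1 else 0))"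
  proof (intro sum_mono mult_left_mono)
    fix p assume "p \<in> A"
    then have p: "prime p" "p dvd v n" by (auto simp: A_def in_prime_factors_iff)
    then show "ln (real p) \<ge> 0" using prime_ge_1_nat by simp
    have "p dvd (\<Prod>k\<in>{1..<n}. v k)" using no p by (auto simp: primitive_divisor_def)
    then obtain k where "k \<in> {1..<n}" "p dvd v k" using prime_dvd_prod_iff[of "{1..<n}" p v] p by auto
    then have "rank p \<le> k" unfolding rank_def by (intro Least_le) auto
    then have "rank p < n" using \<open>k \<in> {1..<n}\<close> by auto
    then show "(\<Sum>S\<in>Pow (prime_factors n). (-1) ^ card S * real (multiplicity p (v (n div \<Prod>S))))
           \<le> (if p dvd n then 1 else 0)"
      using multiplicity_alternating_sum_le[OF p n] by blast
  qed
  also have "\<dots> = (\<Sum>p\<in>{p\<in>A. p dvd n}. ln (real p))"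
    by (subst sum.inter_filter) (auto simp: A_def intro!: sum.cong)
  also have "\<dots> \<le> (\<Sum>p\<in>prime_factors n. ln (real p))"
  proof (intro sum_mono2)
    show "ln (real p) \<ge> 0" if "p \<in> prime_factors n - {p \<in> A. p dvd n}" for p
      using that prime_ge_1_nat[of p] by (simp add: in_prime_factors_iff)
  qed (use n1 in \<open>auto simp: A_def in_prime_factors_iff\<close>)
  also have "\<dots> \<le> (\<Sum>p\<in>prime_factors n. real (multiplicity p n) * ln (real p))"
  proof (intro sum_mono)
    fix p assume "p \<in> prime_factors n"
    then have p: "prime p" "p dvd n" by (auto simp: in_prime_factors_iff)
    have "multiplicity p n > 0" using p n1 by (subst prime_multiplicity_gt_zero_iff) auto
    then have "1 * ln (real p) \<le> real (multiplicity p n) * ln (real p)"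
      using prime_ge_1_nat[OF p(1)] by (intro mult_right_mono) auto
    then show "ln (real p) \<le> real (multiplicity p n) * ln (real p)" by simp
  qed
  also have "\<dots> = ln (real n)"
    by (rule ln_eq_sum_multiplicity[symmetric]) (use n1 in \<open>auto simp: in_prime_factors_iff\<close>)
  finally show ?thesis .
qed

section \<open>Growth of the terms and existence of primitive divisors\<close>

lemma \<phi>_gt_1: "\<phi> > 1"
proof (rule ccontr)
  assume "\<not> \<phi> > 1"
  then have "\<bar>\<phi> * \<psi>\<bar> < 1"
    using dominant mult_right_mono[of \<phi> 1 "\<bar>\<psi>\<bar>"] by (simp add: abs_mult)
  then show False using Q_nz unfolding prod_eq by linarith
qed

lemma ratio_lt_1: "\<bar>\<psi> / \<phi>\<bar> < 1"
  using dominant \<phi>_gt_1 by (simp add: abs_divide)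

text \<open>The error has to be geometric in n, not merely bounded, since \<open>prim_log_ge\<close>
  adds up one error for each squarefree divisor of n.\<close>

lemma ln_v:
  assumes "n \<ge> 1"
  shows "ln (real (v n)) = real n * ln \<phi> - ln (\<phi> - \<psi>) + ln (1 - (\<psi> / \<phi>) ^ n)"
    and "\<bar>ln (1 - (\<psi> / \<phi>) ^ n)\<bar> \<le> \<bar>\<psi> / \<phi>\<bar> ^ n / (1 - \<bar>\<psi> / \<phi>\<bar>)"
proof -
  define t where "t = \<psi> / \<phi>"
  have t: "\<bar>t\<bar> < 1" using ratio_lt_1 by (simp add: t_def)
  have tn: "\<bar>t ^ n\<bar> \<le> \<bar>t\<bar>" using t assms power_decreasing[of 1 n "\<bar>t\<bar>"] by (simp add: power_abs)
  then have pos: "1 - t ^ n > 0" using t by linarith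
  have "real (v n) = \<phi> ^ n * (1 - t ^ n) / (\<phi> - \<psi>)"
    unfolding real_v t_def using \<phi>_gt_1 by (simp add: power_divide right_diff_distrib)
  moreover have "\<phi> - \<psi> > 0" "\<phi> ^ n > 0" using dominant \<phi>_gt_1 by auto
  ultimately show "ln (real (v n)) = real n * ln \<phi> - ln (\<phi> - \<psi>) + ln (1 - (\<psi> / \<phi>) ^ n)"
    using pos \<phi>_gt_1 unfolding t_def[symmetric] by (simp add: ln_div ln_mult ln_realpow)
  have "ln (1 - t ^ n) \<le> - (t ^ n)" using ln_le_minus_one[OF pos] by simp
  moreover have "inverse (1 - t ^ n) - 1 = t ^ n / (1 - t ^ n)"
    using pos by (simp add: field_simps)
  then have "- ln (1 - t ^ n) \<le> t ^ n / (1 - t ^ n)"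
    using ln_le_minus_one[of "inverse (1 - t ^ n)"] pos by (simp add: ln_inverse)
  ultimately have "\<bar>ln (1 - t ^ n)\<bar> \<le> max \<bar>t ^ n\<bar> (\<bar>t ^ n\<bar> / (1 - t ^ n))"
    using pos abs_ge_self[of "t ^ n"] divide_right_mono[OF abs_ge_self[of "t ^ n"], of "1 - t ^ n"]
    by linarith
  also have "\<dots> \<le> \<bar>t ^ n\<bar> / (1 - \<bar>t\<bar>)"
  proof (rule max.boundedI)
    show "\<bar>t ^ n\<bar> \<le> \<bar>t ^ n\<bar> / (1 - \<bar>t\<bar>)"
      using t by (simp add: pos_le_divide_eq mult_left_le)
    show "\<bar>t ^ n\<bar> / (1 - t ^ n) \<le> \<bar>t ^ n\<bar> / (1 - \<bar>t\<bar>)"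
      using t tn by (intro divide_left_mono mult_pos_pos) auto
  qed
  finally show "\<bar>ln (1 - (\<psi> / \<phi>) ^ n)\<bar> \<le> \<bar>\<psi> / \<phi>\<bar> ^ n / (1 - \<bar>\<psi> / \<phi>\<bar>)"
    by (simp add: t_def power_abs)
qed

lemma ln_v_approx: "\<exists>C. \<forall>n\<ge>1. \<bar>ln (real (v n)) - real n * ln \<phi>\<bar> \<le> C"
proof (intro exI allI impI)
  fix n :: nat assume n: "n \<ge> 1"
  have "\<bar>\<psi> / \<phi>\<bar> ^ n \<le> 1" using ratio_lt_1 by (intro power_le_one) auto
  then have "\<bar>\<psi> / \<phi>\<bar> ^ n / (1 - \<bar>\<psi> / \<phi>\<bar>) \<le> 1 / (1 - \<bar>\<psi> / \<phi>\<bar>)"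
    using ratio_lt_1 by (intro divide_right_mono) auto
  then show "\<bar>ln (real (v n)) - real n * ln \<phi>\<bar> \<le> \<bar>ln (\<phi> - \<psi>)\<bar> + 1 / (1 - \<bar>\<psi> / \<phi>\<bar>)"
    using ln_v[OF n] by linarith
qed

text \<open>The linear main terms add up to log \<phi> times the totient of n, written as its Euler
  product. The constant \<open>ln (\<phi> - \<psi>)\<close> cancels because n >= 2 has a prime
  factor, and the errors form part of a geometric series, with a second factor 1 / (1 - t) from
  \<open>ln_v\<close>.\<close>

lemma prim_log_ge:
  assumes "n \<ge> 2"
  shows "prim_log n \<ge> ln \<phi> * (real n * (\<Prod>p\<in>prime_factors n. 1 - 1 / real p)) - 1 / (1 - \<bar>\<psi> / \<phi>\<bar>)\<^sup>2"
proof -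
  define t where "t = \<bar>\<psi> / \<phi>\<bar>"
  have t: "0 \<le> t" "t < 1" using ratio_lt_1 by (auto simp: t_def)
  let ?A = "prime_factors n"
  define \<epsilon> where "\<epsilon> k = ln (1 - (\<psi> / \<phi>) ^ k)" for k
  have eps: "\<bar>\<epsilon> k\<bar> \<le> t ^ k / (1 - t)" if "k \<ge> 1" for k
    using ln_v(2)[OF that] by (simp add: \<epsilon>_def t_def)
  have div: "real (n div \<Prod>S) = real n * (\<Prod>p\<in>S. 1 / real p)" "n div \<Prod>S \<ge> 1" "n div \<Prod>S \<le> n"
       "n = (n div \<Prod>S) * \<Prod>S"
    if "S \<in> Pow ?A" for S
  proof -
    have S: "S \<subseteq> ?A" using that by simp
    obtain e where e: "n = \<Prod>S * e" using Prod_prime_factors_dvd[OF S] by auto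
    have S0: "\<Prod>S > 0" using e assms by (cases "\<Prod>S = 0") auto
    have nd: "n div \<Prod>S = e" using e S0 by simp
    have "real n = real (\<Prod>S) * real e" using e by (metis of_nat_mult)
    then show "real (n div \<Prod>S) = real n * (\<Prod>p\<in>S. 1 / real p)"
      using S0 unfolding nd by (simp add: prod_dividef field_simps flip: of_nat_prod)
    show "n div \<Prod>S \<ge> 1" using nd e assms by (cases e) auto
    show "n div \<Prod>S \<le> n" by simp
    show "n = (n div \<Prod>S) * \<Prod>S" using e nd by simp
  qed
  have expand: "(\<Sum>S\<in>Pow A. (-1) ^ card S * (\<Prod>p\<in>S. f p)) = (\<Prod>p\<in>A. 1 - f p)"
    if "finite A" for A and f :: "nat \<Rightarrow> real"
    using that
  proof (induction A)
    case (insert a A)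
    have "(\<Sum>S\<in>Pow (insert a A). (-1) ^ card S * (\<Prod>p\<in>S. f p)) =
       (\<Sum>S\<in>Pow A. (-1) ^ card S * (\<Prod>p\<in>S. f p)) + (\<Sum>S\<in>insert a ` Pow A. (-1) ^ card S * (\<Prod>p\<in>S. f p))"
      unfolding Pow_insert using insert by (intro sum.union_disjoint) auto
    also have "(\<Sum>S\<in>insert a ` Pow A. (-1) ^ card S * (\<Prod>p\<in>S. f p)) =
       (\<Sum>S\<in>Pow A. (-1) ^ card (insert a S) * (\<Prod>p\<in>insert a S. f p))"
      by (rule sum.reindex_cong[of "insert a"]) (use insert in \<open>auto simp: inj_on_def\<close>)
    also have "\<dots> = (\<Sum>S\<in>Pow A. - f a * ((-1) ^ card S * (\<Prod>p\<in>S. f p)))"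
    proof (intro sum.cong refl)
      fix S assume S: "S \<in> Pow A"
      then have "finite S" "a \<notin> S" using insert finite_subset by auto
      then show "(-1) ^ card (insert a S) * (\<Prod>p\<in>insert a S. f p) = - f a * ((-1) ^ card S * (\<Prod>p\<in>S. f p))"
        by simp
    qed
    also have "\<dots> = - f a * (\<Sum>S\<in>Pow A. (-1) ^ card S * (\<Prod>p\<in>S. f p))"
      by (rule sum_distrib_left[symmetric])
    finally show ?case using insert by (simp add: algebra_simps)
  qed simp
  obtain q where q: "q \<in> ?A" using prime_factor_nat[of n] assms by (auto simp: in_prime_factors_iff)
  have "prim_log n = (\<Sum>S\<in>Pow ?A. (-1) ^ card S *
      (real (n div \<Prod>S) * ln \<phi> - ln (\<phi> - \<psi>) + \<epsilon> (n div \<Prod>S)))"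
    unfolding prim_log_def \<epsilon>_def by (intro sum.cong refl arg_cong2[of _ _ _ _ "(*)"] ln_v(1) div(2))
  also have "\<dots> = (\<Sum>S\<in>Pow ?A. ln \<phi> * real n * ((-1) ^ card S * (\<Prod>p\<in>S. 1 / real p))
       - (-1) ^ card S * ln (\<phi> - \<psi>) + (-1) ^ card S * \<epsilon> (n div \<Prod>S))"
    by (intro sum.cong refl) (simp add: div(1) algebra_simps)
  also have "\<dots> = ln \<phi> * real n * (\<Prod>p\<in>?A. 1 - 1 / real p) + (\<Sum>S\<in>Pow ?A. (-1) ^ card S * \<epsilon> (n div \<Prod>S))"
  proof -
    have "(\<Sum>S\<in>Pow ?A. (-1) ^ card S * ln (\<phi> - \<psi>)) = 0"
      using sum_Pow_signed[of ?A q "\<lambda>_. ln (\<phi> - \<psi>)"] q by simp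
    then show ?thesis
      unfolding sum.distrib sum_subtractf sum_distrib_left[symmetric] by (subst expand) auto
  qed
  finally have eq: "prim_log n = ln \<phi> * real n * (\<Prod>p\<in>?A. 1 - 1 / real p) + (\<Sum>S\<in>Pow ?A. (-1) ^ card S * \<epsilon> (n div \<Prod>S))" .
  have "\<bar>\<Sum>S\<in>Pow ?A. (-1) ^ card S * \<epsilon> (n div \<Prod>S)\<bar> \<le> (\<Sum>S\<in>Pow ?A. t ^ (n div \<Prod>S) / (1 - t))"
    by (rule order_trans[OF sum_abs]) (auto intro!: sum_mono eps div(2) simp: abs_mult power_abs)
  also have "\<dots> = (\<Sum>S\<in>Pow ?A. t ^ (n div \<Prod>S)) / (1 - t)" by (simp add: sum_divide_distrib)
  also have "(\<Sum>S\<in>Pow ?A. t ^ (n div \<Prod>S)) = (\<Sum>k\<in>(\<lambda>S. n div \<Prod>S) ` Pow ?A. t ^ k)"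
  proof (rule sum.reindex_cong[symmetric, OF _ refl refl])
    show "inj_on (\<lambda>S. n div \<Prod>S) (Pow ?A)"
    proof (rule inj_onI)
      fix S T assume ST: "S \<in> Pow ?A" "T \<in> Pow ?A" "n div \<Prod>S = n div \<Prod>T"
      then have "(n div \<Prod>T) * \<Prod>S = (n div \<Prod>T) * \<Prod>T" using div(4)[of S] div(4)[of T] by metis
      then have "\<Prod>S = \<Prod>T" using div(2)[of T] ST by simp
      then show "S = T"
        using inj_onD[OF inj_on_Prod_primes[of ?A] _ ST(1,2)] in_prime_factors_iff by blast
    qed
  qed
  also have "\<dots> \<le> (\<Sum>k\<in>{..<Suc n}. t ^ k)"
    by (rule sum_mono2) (use t div(3) in \<open>auto simp: less_Suc_eq_le\<close>)
  also have "\<dots> \<le> 1 / (1 - t)"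
    unfolding sum_gp_strict using t by (auto simp: divide_right_mono)
  finally have "\<bar>\<Sum>S\<in>Pow ?A. (-1) ^ card S * \<epsilon> (n div \<Prod>S)\<bar> \<le> 1 / (1 - t)\<^sup>2"
    using t by (simp add: divide_right_mono power2_eq_square)
  then show ?thesis using eq unfolding t_def by (simp add: mult_ac)
qed

text \<open>Primes are at least 2, so n has at most log n / log 2 distinct prime factors. With
  \<open>prod_one_minus_inverse_ge\<close> the totient is then at least n / (log n / log 2 + 1), far
  above log n.\<close>

lemma finite_no_primitive_divisor: "finite {n. \<nexists>p. primitive_divisor \<phi> \<psi> p n}"
proof -
  define C where "C = 1 / (1 - \<bar>\<psi> / \<phi>\<bar>)\<^sup>2"
  have a: "ln \<phi> > 0" using \<phi>_gt_1 by simp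
  have "eventually (\<lambda>n. ln \<phi> * (real n * (1 / (ln (real n) / ln 2 + 1))) - C > ln (real n)) at_top"
    using a by real_asymp
  then obtain N where N: "\<And>n. n \<ge> N \<Longrightarrow> ln \<phi> * (real n * (1 / (ln (real n) / ln 2 + 1))) - C > ln (real n)"
    by (auto simp: eventually_at_top_linorder)
  have "{n. \<nexists>p. primitive_divisor \<phi> \<psi> p n} \<subseteq> {..max N 6}"
  proof safe
    fix n assume no: "\<nexists>p. primitive_divisor \<phi> \<psi> p n"
    show "n \<le> max N 6"
    proof (rule ccontr)
      assume "\<not> n \<le> max N 6"
      then have n: "n > 6" "n \<ge> N" by auto
      let ?A = "prime_factors n"
      have "2 ^ card ?A \<le> \<Prod>?A"
        using prod_mono[of ?A "\<lambda>_. 2" "\<lambda>p. p"] by (auto simp: in_prime_factors_iff prime_ge_2_nat)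
      also have "\<Prod>?A \<le> n" using Prod_prime_factors_dvd[of ?A n] n by (intro dvd_imp_le) auto
      finally have "(2::real) ^ card ?A \<le> real n" by (metis of_nat_le_iff of_nat_numeral of_nat_power)
      then have "ln ((2::real) ^ card ?A) \<le> ln (real n)" using n by (subst ln_le_cancel_iff) auto
      then have card: "real (card ?A) \<le> ln (real n) / ln 2" by (simp add: ln_realpow field_simps)
      have "ln \<phi> * (real n * (1 / (ln (real n) / ln 2 + 1))) - C \<le>
            ln \<phi> * (real n * (1 / (real (card ?A) + 1))) - C"
        using card a n by (intro diff_right_mono mult_left_mono divide_left_mono mult_pos_pos) (auto intro!: add_nonneg_pos)
      also have "\<dots> \<le> ln \<phi> * (real n * (\<Prod>p\<in>?A. 1 - 1 / real p)) - C"
        using a by (intro diff_right_mono mult_left_mono prod_one_minus_inverse_ge)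
          (auto simp: in_prime_factors_iff prime_ge_2_nat)
      also have "\<dots> \<le> prim_log n" unfolding C_def using n by (intro prim_log_ge) auto
      also have "\<dots> \<le> ln (real n)" using prim_log_le[OF n(1) no] .
      finally show False using N[OF n(2)] by simp
    qed
  qed
  then show ?thesis using finite_subset by blast
qed

end

section \<open>A local limit theorem\<close>

lemma cosh_of_real': "cosh (complex_of_real x) = of_real (cosh x)"
  by (simp add: cosh_def scaleR_conv_of_real exp_of_real flip: of_real_minus)

lemma sinh_of_real': "sinh (complex_of_real x) = of_real (sinh x)"
  by (simp add: sinh_def scaleR_conv_of_real exp_of_real flip: of_real_minus)

text \<open>\<open>kern\<close> is the Fourier transform of \<open>tent\<close>. The compact support of \<open>tent\<close> restricts attention to
  bounded frequencies, and since \<open>kern\<close> is strictly positive and decays only quadratically, one-sided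
  exponential weights are bounded multiples of it.\<close>

definition tent :: "real \<Rightarrow> real" where
  "tent t = (if \<bar>t\<bar> \<le> 1 then sinh (1 - \<bar>t\<bar>) else 0)"

definition kern :: "real \<Rightarrow> real" where
  "kern w = 2 * (cosh 1 - cos w) / (1 + w\<^sup>2)"

lemma tent_nonneg: "tent t \<ge> 0" and tent_le: "tent t \<le> sinh 1" and tent_minus [simp]: "tent (- t) = tent t"
  and tent_0: "tent 0 > 0"
  by (auto simp: tent_def)

lemma continuous_on_tent: "continuous_on UNIV tent"
proof -
  have "tent = (\<lambda>t. sinh (max 0 (1 - \<bar>t\<bar>)))" by (auto simp: tent_def max_def fun_eq_iff)
  moreover have "continuous_on UNIV (\<lambda>t::real. sinh (max 0 (1 - \<bar>t\<bar>)))" by (intro continuous_intros)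
  ultimately show ?thesis by metis
qed

lemma isCont_tent: "isCont tent t"
  using continuous_on_tent by (simp add: continuous_on_eq_continuous_at)

lemma borel_measurable_tent [measurable]: "tent \<in> borel_measurable borel"
  using continuous_on_tent by (rule borel_measurable_continuous_onI)

lemma integrable_tent: "integrable lborel tent"
proof -
  have "integrable lborel (\<lambda>t. indicator {-1..1::real} t *\<^sub>R tent t)"
    by (intro borel_integrable_compact compact_Icc continuous_on_subset[OF continuous_on_tent]) auto
  also have "(\<lambda>t. indicator {-1..1::real} t *\<^sub>R tent t) = tent"
    by (auto simp: tent_def indicator_def fun_eq_iff)
  finally show ?thesis .
qed

lemma cosh_1_gt_1: "cosh (1::real) > 1"
  using cosh_real_ge_1[of 1] cosh_real_one_iff[of 1] by linarith

text \<open>The choice of sinh in \<open>tent\<close> pays off here. A piecewise linear function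
  would have transform proportional to (1 - cos w) / w^2, which vanishes at nonzero multiples of 2
  pi; the hyperbolic one has cosh 1 > 1 in place of 1 in the numerator.\<close>

lemma kern_pos: "kern w > 0"
proof -
  have "cosh 1 - cos w > 0" using cosh_1_gt_1 cos_le_one[of w] by linarith
  moreover have "1 + w\<^sup>2 > 0" by (intro add_pos_nonneg) auto
  ultimately show ?thesis unfolding kern_def by simp
qed

lemma kern_ge: "kern w \<ge> 2 * (cosh 1 - 1) / (1 + w\<^sup>2)"
  unfolding kern_def by (intro divide_right_mono mult_left_mono) auto

lemma kern_le: "kern w \<le> 2 * (cosh 1 + 1) * inverse (1 + w\<^sup>2)"
  unfolding kern_def divide_inverse using cos_ge_minus_one[of w] by (intro mult_right_mono mult_left_mono) auto

lemma kern_bounded: "kern w \<le> 2 * (cosh 1 + 1)"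
proof -
  have "inverse (1 + w\<^sup>2) \<le> 1" by (simp add: inverse_le_1_iff)
  then have "2 * (cosh 1 + 1) * inverse (1 + w\<^sup>2) \<le> 2 * (cosh 1 + 1) * 1"
    using cosh_1_gt_1 by (intro mult_left_mono) auto
  then show ?thesis using kern_le[of w] by simp
qed

lemma isCont_kern: "isCont kern w"
proof -
  have "1 + w\<^sup>2 \<noteq> 0" by (smt (verit) zero_le_power2)
  then show ?thesis unfolding kern_def by (intro continuous_intros) auto
qed

lemma borel_measurable_kern [measurable]: "kern \<in> borel_measurable borel"
  unfolding kern_def by measurable

lemma integrable_kern: "integrable lborel kern"
proof (rule Bochner_Integration.integrable_bound)
  show "integrable lborel (\<lambda>w::real. 2 * (cosh 1 + 1) * inverse (1 + w\<^sup>2))"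
    using integrable_inverse_1_plus_square unfolding set_integrable_def
    by (intro integrable_mult_right) (simp add: einterval_eq)
  show "AE w in lborel. norm (kern w) \<le> norm (2 * (cosh 1 + 1) * inverse (1 + w\<^sup>2))"
    using kern_le kern_pos by (intro AE_I2) (metis abs_ge_self abs_of_pos order_trans real_norm_def)
qed simp

lemma fourier_tent: "(\<integral>t. complex_of_real (tent t) * iexp (t * w) \<partial>lborel) = complex_of_real (kern w)"
proof -
  let ?f = "\<lambda>t. complex_of_real (sinh (1 - t)) * iexp (t * w)"
  let ?g = "\<lambda>t. complex_of_real (sinh (1 + t)) * iexp (t * w)"
  have "1 + w\<^sup>2 \<noteq> 0" by (smt (verit) zero_le_power2)
  then have w: "1 + (complex_of_real w)\<^sup>2 \<noteq> 0"
    by (metis of_real_0 of_real_1 of_real_add of_real_eq_iff of_real_power)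
  \<comment> \<open>Antiderivatives of the two halves of the integrand, obtained by integrating by
    parts twice and solving for the integral, which produces the denominator 1 + w^2.\<close>
  let ?F = "\<lambda>z::complex. exp (\<i> * (z * w)) * (- cosh (1 - z) - \<i> * w * sinh (1 - z)) / (1 + (complex_of_real w)\<^sup>2)"
  let ?G = "\<lambda>z::complex. exp (\<i> * (z * w)) * (cosh (1 + z) - \<i> * w * sinh (1 + z)) / (1 + (complex_of_real w)\<^sup>2)"
  have i2: "\<i> * (\<i> * z) = - z" for z by (simp flip: mult.assoc)
  have dF: "(?F has_field_derivative sinh (1 - z) * exp (\<i> * (z * w))) (at z)" for z
    using w by (auto intro!: derivative_eq_intros simp: divide_simps) (simp add: algebra_simps power2_eq_square i2)
  have dG: "(?G has_field_derivative sinh (1 + z) * exp (\<i> * (z * w))) (at z)" for z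
    using w by (auto intro!: derivative_eq_intros simp: divide_simps) (simp add: algebra_simps power2_eq_square i2)
  have F: "has_bochner_integral lborel (\<lambda>t. indicator {0..1} t *\<^sub>R ?f t) (?F (of_real 1) - ?F (of_real 0))"
  proof (rule has_bochner_integral_FTC_Icc)
    show "((\<lambda>t. ?F (of_real t)) has_vector_derivative ?f t) (at t within {0..1})" for t
      using has_vector_derivative_real_field[OF dF[of "of_real t"]] by (simp flip: sinh_of_real')
    show "continuous_on {0..1} ?f" by (intro continuous_intros)
  qed simp
  have G: "has_bochner_integral lborel (\<lambda>t. indicator {-1..0} t *\<^sub>R ?g t) (?G (of_real 0) - ?G (of_real (-1)))"
  proof (rule has_bochner_integral_FTC_Icc)
    show "((\<lambda>t. ?G (of_real t)) has_vector_derivative ?g t) (at t within {-1..0})" for t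
      using has_vector_derivative_real_field[OF dG[of "of_real t"]] by (simp flip: sinh_of_real')
    show "continuous_on {-1..0} ?g" by (intro continuous_intros)
  qed simp
  \<comment> \<open>Both halves are counted at t = 0, so the identity holds only almost
    everywhere.\<close>
  have "AE t in lborel. indicator {0..1} t *\<^sub>R ?f t + indicator {-1..0} t *\<^sub>R ?g t =
      complex_of_real (tent t) * iexp (t * w)"
    using AE_lborel_singleton[of 0]
    by eventually_elim (auto simp: tent_def indicator_def)
  then have "(\<integral>t. complex_of_real (tent t) * iexp (t * w) \<partial>lborel) =
      (\<integral>t. indicator {0..1} t *\<^sub>R ?f t + indicator {-1..0} t *\<^sub>R ?g t \<partial>lborel)"
    using borel_measurable_has_bochner_integral[OF has_bochner_integral_add[OF F G]]
    by (intro integral_cong_AE) (auto elim: eventually_mono)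
  also have "\<dots> = (?F (of_real 1) - ?F (of_real 0)) + (?G (of_real 0) - ?G (of_real (-1)))"
    using has_bochner_integral_add[OF F G] by (rule has_bochner_integral_integral_eq)
  also have "\<dots> = (2 * cosh 1 - (iexp w + iexp (- w))) / (1 + (complex_of_real w)\<^sup>2)"
    by (simp add: add_divide_distrib[symmetric] diff_divide_distrib[symmetric] algebra_simps)
  also have "iexp w + iexp (- w) = 2 * cos (complex_of_real w)"
    by (simp add: cos_exp_eq)
  also have "(2 * cosh 1 - 2 * cos (complex_of_real w)) / (1 + (complex_of_real w)\<^sup>2) = of_real (kern w)"
    using cosh_of_real'[of 1] by (simp add: kern_def right_diff_distrib flip: cos_of_real)
  finally show ?thesis .
qed

section \<open>The smoothed local limit theorem and Fourier inversion\<close>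

lemma norm_iexp: "norm (iexp x) = 1"
  by simp

text \<open>Inserting \<open>fourier_tent\<close> for \<open>kern\<close> and exchanging integrals
  expresses the weighted expectation by values of \<open>h\<close> within distance 1 of
  \<open>v\<close>. The substitution by \<open>s\<close> moves to the frequencies \<theta> / s, the
  scale on which \<open>h\<close> will have a limit.\<close>

lemma integral_kern_iexp:
  fixes M :: "'a measure" and h :: "real \<Rightarrow> complex"
  assumes "prob_space M" and [measurable]: "X \<in> borel_measurable M" "c \<in> borel_measurable M"
    and B: "\<And>x. norm (c x :: complex) \<le> B" and s: "s > 0"
  defines "h \<equiv> (\<lambda>t. \<integral>x. c x * iexp (t * X x) \<partial>M)"
  shows "s * (\<integral>x. c x * (kern (X x) * iexp (v * X x)) \<partial>M) =
           (\<integral>\<theta>. tent (\<theta> / s - v) * h (\<theta> / s) \<partial>lborel)"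
    and "h \<in> borel_measurable borel"
proof -
  interpret M: prob_space M by fact
  interpret P: pair_sigma_finite lborel M ..
  show "h \<in> borel_measurable borel"
    unfolding h_def by measurable
  let ?k = "\<lambda>t x. tent (t - v) * (c x * iexp (t * X x))"
  have int_t: "integrable lborel (\<lambda>t. tent (t - v))"
    using lborel_integrable_real_affine[OF integrable_tent, of 1 "- v"] by simp
  have "integrable (lborel \<Otimes>\<^sub>M M) (\<lambda>(t, x). ?k t x)"
  proof (rule P.Fubini_integrable)
    show "integrable lborel (\<lambda>t. \<integral>x. norm (case (t, x) of (t, x) \<Rightarrow> ?k t x) \<partial>M)"
    proof (rule Bochner_Integration.integrable_bound)
      show "integrable lborel (\<lambda>t. B * tent (t - v))" using int_t by simp
      have "\<bar>\<integral>x. norm (?k t x) \<partial>M\<bar> \<le> \<bar>B * tent (t - v)\<bar>" for t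
      proof -
        have "(\<integral>x. norm (?k t x) \<partial>M) \<le> (\<integral>x. B * tent (t - v) \<partial>M)"
        proof (rule integral_mono')
          show "norm (?k t x) \<le> B * tent (t - v)" for x
            using mult_right_mono[OF B[of x] tent_nonneg[of "t - v"]] tent_nonneg[of "t - v"]
            by (simp add: norm_mult mult.commute)
          show "0 \<le> B * tent (t - v)" for x :: 'a
            using order_trans[OF norm_ge_zero B] tent_nonneg by (intro mult_nonneg_nonneg) auto
        qed auto
        then show ?thesis by (simp add: M.prob_space abs_of_nonneg)
      qed
      then show "AE t in lborel. norm (\<integral>x. norm (case (t, x) of (t, x) \<Rightarrow> ?k t x) \<partial>M) \<le> norm (B * tent (t - v))"
        by simp
    qed measurable
    show "AE t in lborel. integrable M (\<lambda>x. case (t, x) of (t, x) \<Rightarrow> ?k t x)"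
      by (auto intro!: integrable_mult_right M.integrable_const_bound[of _ B] simp: norm_mult B)
  qed measurable
  from P.Fubini_integral[OF this] have
    "(\<integral>x. (\<integral>t. ?k t x \<partial>lborel) \<partial>M) = (\<integral>t. tent (t - v) * h t \<partial>lborel)"
    unfolding h_def by simp
  moreover have "(\<integral>t. ?k t x \<partial>lborel) = c x * (kern (X x) * iexp (v * X x))" for x
  proof -
    have "(\<integral>t. ?k t x \<partial>lborel) = (\<integral>t. ?k (v + 1 * t) x \<partial>lborel)"
      by (subst lborel_integral_real_affine[of 1 _ v]) auto
    also have "\<dots> = (\<integral>t. (c x * iexp (v * X x)) * (tent t * iexp (t * X x)) \<partial>lborel)"
      by (intro Bochner_Integration.integral_cong refl) (simp add: algebra_simps exp_add)
    also have "\<dots> = c x * iexp (v * X x) * kern (X x)"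
      by (simp only: integral_mult_right_zero fourier_tent)
    finally show ?thesis by (simp add: mult_ac)
  qed
  ultimately have "s * (\<integral>x. c x * (kern (X x) * iexp (v * X x)) \<partial>M) = s * (\<integral>t. tent (t - v) * h t \<partial>lborel)"
    by simp
  also have "(\<integral>t. tent (t - v) * h t \<partial>lborel) = (1 / s) *\<^sub>R (\<integral>\<theta>. tent (\<theta> / s - v) * h (\<theta> / s) \<partial>lborel)"
    using s by (subst lborel_integral_real_affine[of "1 / s" _ 0]) auto
  finally show "s * (\<integral>x. c x * (kern (X x) * iexp (v * X x)) \<partial>M) =
           (\<integral>\<theta>. tent (\<theta> / s - v) * h (\<theta> / s) \<partial>lborel)"
    using s by (simp add: scaleR_conv_of_real)
qed

lemma
  assumes "a > 0"
  shows integrable_exp_minus_square: "integrable lborel (\<lambda>x::real. exp (- a * x\<^sup>2))"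
    and integral_exp_minus_square: "(\<integral>x. exp (- a * x\<^sup>2) \<partial>lborel) = sqrt (pi / a)"
proof -
  have density: "normal_density 0 (1 / sqrt (2 * a)) = (\<lambda>x. sqrt (a / pi) * exp (- a * x\<^sup>2))"
    using assms by (auto simp: normal_density_def fun_eq_iff power_divide real_sqrt_divide field_simps)
  have "integrable lborel (normal_density 0 (1 / sqrt (2 * a)))"
    using assms by simp
  then show "integrable lborel (\<lambda>x::real. exp (- a * x\<^sup>2))" using assms unfolding density by simp
  have "(\<integral>x. normal_density 0 (1 / sqrt (2 * a)) x \<partial>lborel) = 1"
    using assms by simp
  then have "sqrt (a / pi) * (\<integral>x. exp (- a * x\<^sup>2) \<partial>lborel) = 1" unfolding density by simp
  then have "(\<integral>x. exp (- a * x\<^sup>2) \<partial>lborel) = 1 / sqrt (a / pi)" using assms by (simp add: field_simps)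
  then show "(\<integral>x. exp (- a * x\<^sup>2) \<partial>lborel) = sqrt (pi / a)" using assms by (simp add: real_sqrt_divide)
qed

text \<open>Dominated convergence in \<open>integral_kern_iexp\<close>. The factor
  \<open>tent (\<theta> / s j - v)\<close> tends to \<open>tent v\<close> and vanishes once \<theta>
  / s j exceeds |v| + 1 in absolute value, so a Gaussian bound on bounded frequencies suffices. It
  holds from some \<open>N\<close> on, hence the shift.\<close>

lemma local_limit:
  fixes M :: "nat \<Rightarrow> 'a measure" and c :: "nat \<Rightarrow> 'a \<Rightarrow> complex" and \<Gamma> :: "real \<Rightarrow> complex" and h :: "nat \<Rightarrow> real \<Rightarrow> complex"
  assumes prob: "\<And>j. prob_space (M j)" and X: "\<And>j. X j \<in> borel_measurable (M j)"
    and c: "\<And>j. c j \<in> borel_measurable (M j)"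
    and B: "\<And>j x. norm (c j x) \<le> B" and s: "\<And>j. s j > 0" "filterlim s at_top sequentially"
  defines "h \<equiv> (\<lambda>j t. \<integral>x. c j x * iexp (t * X j x) \<partial>M j)"
  assumes lim: "\<And>\<theta>. (\<lambda>j. h j (\<theta> / s j)) \<longlonglongrightarrow> \<Gamma> \<theta>" and G: "\<Gamma> \<in> borel_measurable borel"
    and bnd: "\<And>K. \<exists>a>0. \<exists>C. \<forall>\<^sub>F j in sequentially. \<forall>t. \<bar>t\<bar> \<le> K \<longrightarrow> norm (h j t) \<le> C * exp (- a * (s j * t)\<^sup>2)"
  shows "(\<lambda>j. s j * (\<integral>x. c j x * (kern (X j x) * iexp (v * X j x)) \<partial>M j))
           \<longlonglongrightarrow> tent v * (\<integral>\<theta>. \<Gamma> \<theta> \<partial>lborel)"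
proof -
  obtain a C N where a: "a > 0" and N: "\<And>j t. j \<ge> N \<Longrightarrow> \<bar>t\<bar> \<le> \<bar>v\<bar> + 1 \<Longrightarrow> norm (h j t) \<le> C * exp (- a * (s j * t)\<^sup>2)"
    using bnd[of "\<bar>v\<bar> + 1"] unfolding eventually_sequentially by blast
  have C: "C \<ge> 0" using order_trans[OF norm_ge_zero N[of N 0]] by simp
  have eq: "s j * (\<integral>x. c j x * (kern (X j x) * iexp (v * X j x)) \<partial>M j) =
      (\<integral>\<theta>. tent (\<theta> / s j - v) * h j (\<theta> / s j) \<partial>lborel)" for j
    using integral_kern_iexp(1)[OF prob X c B s(1)] unfolding h_def .
  have meas [measurable]: "h j \<in> borel_measurable borel" for j
    using integral_kern_iexp(2)[OF prob X c B s(1)] unfolding h_def .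
  have "(\<lambda>j. \<integral>\<theta>. tent (\<theta> / s (j + N) - v) * h (j + N) (\<theta> / s (j + N)) \<partial>lborel)
      \<longlonglongrightarrow> (\<integral>\<theta>. tent v * \<Gamma> \<theta> \<partial>lborel)"
  proof (rule integral_dominated_convergence)
    show "integrable lborel (\<lambda>\<theta>. sinh 1 * (C * exp (- a * \<theta>\<^sup>2)))"
      using integrable_exp_minus_square[OF a] by (intro integrable_mult_right)
    show "(\<lambda>\<theta>. tent v * \<Gamma> \<theta>) \<in> borel_measurable lborel" using G by measurable
    show "AE \<theta> in lborel. (\<lambda>j. tent (\<theta> / s (j + N) - v) * h (j + N) (\<theta> / s (j + N))) \<longlonglongrightarrow> tent v * \<Gamma> \<theta>"
    proof (intro AE_I2)
      fix \<theta>
      have "(\<lambda>j. \<theta> / s j) \<longlonglongrightarrow> 0" by (rule real_tendsto_divide_at_top[OF tendsto_const s(2)])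
      then have "(\<lambda>j. \<theta> / s j - v) \<longlonglongrightarrow> 0 - v" by (intro tendsto_intros)
      then have "(\<lambda>j. tent (\<theta> / s j - v)) \<longlonglongrightarrow> tent v"
        using isCont_tendsto_compose[OF isCont_tent] by fastforce
      then have "(\<lambda>j. tent (\<theta> / s j - v) * h j (\<theta> / s j)) \<longlonglongrightarrow> tent v * \<Gamma> \<theta>"
        by (intro tendsto_mult tendsto_of_real lim)
      then show "(\<lambda>j. tent (\<theta> / s (j + N) - v) * h (j + N) (\<theta> / s (j + N))) \<longlonglongrightarrow> tent v * \<Gamma> \<theta>"
        by (rule LIMSEQ_ignore_initial_segment)
    qed
    show "AE \<theta> in lborel. norm (tent (\<theta> / s (j + N) - v) * h (j + N) (\<theta> / s (j + N))) \<le> sinh 1 * (C * exp (- a * \<theta>\<^sup>2))" for j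
    proof (intro AE_I2)
      fix \<theta>
      let ?t = "\<theta> / s (j + N)"
      show "norm (tent (?t - v) * h (j + N) ?t) \<le> sinh 1 * (C * exp (- a * \<theta>\<^sup>2))"
      proof (cases "\<bar>?t\<bar> \<le> \<bar>v\<bar> + 1")
        case True
        have "norm (h (j + N) ?t) \<le> C * exp (- a * (s (j + N) * ?t)\<^sup>2)" using N[of "j + N" ?t] True by simp
        also have "s (j + N) * ?t = \<theta>" using s(1)[of "j + N"] by simp
        finally show ?thesis unfolding norm_mult norm_of_real
          using tent_nonneg[of "?t - v"] tent_le[of "?t - v"] by (intro mult_mono) auto
      next
        case False
        then have "tent (?t - v) = 0" by (auto simp: tent_def)
        then show ?thesis using C by simp
      qed
    qed
  qed measurable
  then have "(\<lambda>j. s (j + N) * (\<integral>x. c (j + N) x * (kern (X (j + N) x) * iexp (v * X (j + N) x)) \<partial>M (j + N)))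
      \<longlonglongrightarrow> (\<integral>\<theta>. tent v * \<Gamma> \<theta> \<partial>lborel)"
    unfolding eq .
  from LIMSEQ_offset[where k = N and f = "\<lambda>j. s j * (\<integral>x. c j x * (kern (X j x) * iexp (v * X j x)) \<partial>M j)", OF this]
  show ?thesis by simp
qed

text \<open>Fourier inversion, obtained from the local limit theorem for normal variables of growing variance.\<close>

lemma fourier_kern: "(\<integral>y. kern y * iexp (v * y) \<partial>lborel) = 2 * pi * tent v"
proof -
  define s where "s j = real (Suc j)" for j
  have s: "s j > 0" for j by (simp add: s_def)
  have s_lim: "filterlim s at_top sequentially"
    unfolding s_def by (intro filterlim_compose[OF filterlim_real_sequentially filterlim_Suc])
  interpret S: real_distribution std_normal_distribution by (rule real_dist_normal_dist)
  have cf: "(\<integral>x. 1 * iexp (t * (s j * x)) \<partial>std_normal_distribution) = exp (- (s j * t)\<^sup>2 / 2)" for t j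
    using fun_cong[OF char_std_normal_distribution, of "t * s j"] unfolding char_def by (simp add: mult_ac)
  have "(\<lambda>j. s j * (\<integral>x. 1 * (kern (s j * x) * iexp (v * (s j * x))) \<partial>std_normal_distribution))
           \<longlonglongrightarrow> tent v * (\<integral>\<theta>. complex_of_real (exp (- \<theta>\<^sup>2 / 2)) \<partial>lborel)"
  proof (rule local_limit[where B = 1])
    show "prob_space std_normal_distribution" by (rule S.prob_space_axioms)
    show "(\<lambda>j. \<integral>x. 1 * iexp (\<theta> / s j * (s j * x)) \<partial>std_normal_distribution) \<longlonglongrightarrow> complex_of_real (exp (- \<theta>\<^sup>2 / 2))" for \<theta>
      unfolding cf using s by (simp add: less_imp_neq[symmetric])
    show "\<exists>a>0. \<exists>C. \<forall>\<^sub>F j in sequentially. \<forall>t. \<bar>t\<bar> \<le> K \<longrightarrow>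
        norm (\<integral>x. 1 * iexp (t * (s j * x)) \<partial>std_normal_distribution) \<le> C * exp (- a * (s j * t)\<^sup>2)" for K
      unfolding cf by (intro exI[of _ "1/2"] exI[of _ 1] conjI always_eventually) auto
  qed (use s s_lim in auto)
  moreover have "(\<integral>\<theta>. complex_of_real (exp (- \<theta>\<^sup>2 / 2)) \<partial>lborel) = sqrt (2 * pi)"
  proof -
    have "(\<integral>\<theta>. exp (- \<theta>\<^sup>2 / 2) \<partial>lborel) = (\<integral>\<theta>. sqrt (2 * pi) * std_normal_density \<theta> \<partial>lborel)"
      by (simp add: std_normal_density_def)
    then show ?thesis by simp
  qed
  \<comment> \<open>Second evaluation: after substituting y = s j * x the normal density flattens to
    its value at 0, leaving the integral of \<open>kern\<close> times the character. Equating both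
    limits gives the inversion formula.\<close>
  moreover have "s j * (\<integral>x. 1 * (kern (s j * x) * iexp (v * (s j * x))) \<partial>std_normal_distribution) =
       (\<integral>y. std_normal_density (y / s j) *\<^sub>R (kern y * iexp (v * y)) \<partial>lborel)" for j
  proof -
    have "(\<integral>y. std_normal_density (y / s j) *\<^sub>R (kern y * iexp (v * y)) \<partial>lborel) =
       s j *\<^sub>R (\<integral>x. std_normal_density x *\<^sub>R (kern (s j * x) * iexp (v * (s j * x))) \<partial>lborel)"
      using s[of j] by (subst lborel_integral_real_affine[of "s j" _ 0]) auto
    also have "(\<integral>x. std_normal_density x *\<^sub>R (kern (s j * x) * iexp (v * (s j * x))) \<partial>lborel) =
       (\<integral>x. kern (s j * x) * iexp (v * (s j * x)) \<partial>std_normal_distribution)"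
      by (subst integral_density) auto
    finally show ?thesis by (simp add: scaleR_conv_of_real)
  qed
  moreover have "(\<lambda>j. \<integral>y. std_normal_density (y / s j) *\<^sub>R (kern y * iexp (v * y)) \<partial>lborel)
      \<longlonglongrightarrow> (\<integral>y. std_normal_density 0 *\<^sub>R (kern y * iexp (v * y)) \<partial>lborel)"
  proof (rule integral_dominated_convergence)
    show "integrable lborel (\<lambda>y. (1 / sqrt (2 * pi)) * kern y)"
      using integrable_kern by simp
    show "AE y in lborel. (\<lambda>j. std_normal_density (y / s j) *\<^sub>R (kern y * iexp (v * y)))
             \<longlonglongrightarrow> std_normal_density 0 *\<^sub>R (kern y * iexp (v * y))"
    proof (intro AE_I2 tendsto_scaleR tendsto_const)
      fix y
      have "(\<lambda>j. y / s j) \<longlonglongrightarrow> 0" by (rule real_tendsto_divide_at_top[OF tendsto_const s_lim])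
      then have "(\<lambda>j. 1 / sqrt (2 * pi) * exp (- (y / s j)\<^sup>2 / 2)) \<longlonglongrightarrow> 1 / sqrt (2 * pi) * exp (- 0\<^sup>2 / 2)"
        by (intro tendsto_intros) auto
      then show "(\<lambda>j. std_normal_density (y / s j)) \<longlonglongrightarrow> std_normal_density 0"
        unfolding std_normal_density_def .
    qed
    show "AE y in lborel. norm (std_normal_density (y / s j) *\<^sub>R (kern y * iexp (v * y))) \<le> (1 / sqrt (2 * pi)) * kern y" for j
    proof (intro AE_I2)
      fix y
      have "std_normal_density (y / s j) \<le> 1 / sqrt (2 * pi)"
        unfolding std_normal_density_def by (intro mult_left_le) auto
      then show "norm (std_normal_density (y / s j) *\<^sub>R (kern y * iexp (v * y))) \<le> (1 / sqrt (2 * pi)) * kern y"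
        using mult_right_mono[of "std_normal_density (y / s j)" "1 / sqrt (2 * pi)" "kern y"] less_imp_le[OF kern_pos[of y]]
        by (simp add: norm_mult)
    qed
  qed measurable
  ultimately have "(\<integral>y. std_normal_density 0 *\<^sub>R (kern y * iexp (v * y)) \<partial>lborel) = tent v * sqrt (2 * pi)"
    by (auto intro: LIMSEQ_unique)
  then have "complex_of_real (1 / sqrt (2 * pi)) * (\<integral>y. kern y * iexp (v * y) \<partial>lborel) = tent v * sqrt (2 * pi)"
    by (simp add: std_normal_density_def scaleR_conv_of_real)
  then have "sqrt (2 * pi) * (complex_of_real (1 / sqrt (2 * pi)) * (\<integral>y. kern y * iexp (v * y) \<partial>lborel)) =
      complex_of_real (sqrt (2 * pi) * sqrt (2 * pi)) * tent v" by (simp only: of_real_mult mult_ac)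
  moreover have "sqrt (2 * pi) * (complex_of_real (1 / sqrt (2 * pi)) * z) = z" for z
    unfolding mult.assoc[symmetric] of_real_mult[symmetric] by simp
  moreover have "sqrt (2 * pi) * sqrt (2 * pi) = 2 * pi" by simp
  ultimately show ?thesis by (simp only: of_real_mult)
qed

section \<open>The one-sided exponential weight and weak convergence\<close>

definition etail :: "real \<Rightarrow> real" where
  "etail w = (if w \<ge> 0 then exp (- w) else 0)"

lemma borel_measurable_etail [measurable]: "etail \<in> borel_measurable borel"
  unfolding etail_def by measurable

text \<open>On w >= 0, exp w >= 1 + w + w^2/2 >= (1 + w^2)/3, while \<open>kern\<close> is bounded
  below by a constant over 1 + w^2.\<close>

lemma etail_le_kern: "\<exists>B. \<forall>w. \<bar>etail w / kern w\<bar> \<le> B"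
proof (intro exI allI)
  fix w
  define c :: real where "c = 2 * (cosh 1 - 1)"
  have c: "c > 0" using cosh_1_gt_1 by (simp add: c_def)
  have "etail w * (1 + w\<^sup>2) \<le> 3"
  proof (cases "w \<ge> 0")
    case True
    have "1 + w\<^sup>2 \<le> 3 * (1 + w + w\<^sup>2 / 2)" using True by (simp add: field_simps)
    also have "\<dots> \<le> 3 * exp w" using exp_lower_Taylor_quadratic[OF True] by simp
    finally have "exp (- w) * (1 + w\<^sup>2) \<le> exp (- w) * (3 * exp w)" by (intro mult_left_mono) auto
    also have "\<dots> = 3" by (simp add: exp_minus)
    finally show ?thesis using True by (simp add: etail_def)
  qed (simp add: etail_def)
  moreover have "1 + w\<^sup>2 > 0" by (intro add_pos_nonneg) auto
  ultimately have "etail w \<le> 3 / (1 + w\<^sup>2)" by (simp add: field_simps)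
  also have "\<dots> = 3 / c * (c / (1 + w\<^sup>2))" using c by simp
  also have "\<dots> \<le> 3 / c * kern w" using kern_ge[of w] c unfolding c_def by (intro mult_left_mono) auto
  finally show "\<bar>etail w / kern w\<bar> \<le> 3 / c"
    using kern_pos[of w] by (simp add: etail_def pos_divide_le_eq)
qed

lemma isCont_etail_kern: "w \<noteq> 0 \<Longrightarrow> isCont (\<lambda>w. etail w / kern w) w"
proof -
  assume w: "w \<noteq> 0"
  have "isCont etail w"
  proof (cases "w > 0")
    case True
    have "\<forall>\<^sub>F x in nhds w. etail x = exp (- x)"
      using eventually_nhds_in_open[of "{0<..}" w] True by (auto elim!: eventually_mono simp: etail_def)
    then show ?thesis by (subst isCont_cong[of _ "\<lambda>x. exp (- x)"]) auto
  next
    case False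
    have "\<forall>\<^sub>F x in nhds w. etail x = 0"
      using eventually_nhds_in_open[of "{..<0}" w] False w by (auto elim!: eventually_mono simp: etail_def)
    then show ?thesis by (subst isCont_cong[of _ "\<lambda>x. 0"]) auto
  qed
  then show ?thesis using isCont_kern[of w] kern_pos[of w] by (intro continuous_intros) auto
qed

lemma integral_etail: "integrable lborel etail" "(\<integral>w. etail w \<partial>lborel) = 1"
proof -
  have "(\<integral>\<^sup>+w. ennreal (etail w) \<partial>lborel) = (\<integral>\<^sup>+w. ennreal (w ^ 0 * exp (- w)) * indicator {0..} w \<partial>lborel)"
    by (intro nn_integral_cong) (auto simp: etail_def indicator_def)
  then have nn: "(\<integral>\<^sup>+w. ennreal (etail w) \<partial>lborel) = ennreal 1"
    unfolding nn_intergal_power_times_exp_Ici by simp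
  have "has_bochner_integral lborel etail 1"
    by (rule has_bochner_integral_nn_integral[OF _ _ _ nn]) (auto simp: etail_def)
  then show "integrable lborel etail" "(\<integral>w. etail w \<partial>lborel) = 1"
    by (auto simp: has_bochner_integral_iff)
qed

text \<open>The normalising constant is the total mass of \<open>kern\<close>, that is
  \<open>fourier_kern\<close> at 0.\<close>

definition kern_distribution :: "real measure" where
  "kern_distribution = density lborel (\<lambda>w. kern w / (2 * pi * tent 0))"

lemma kern_distribution: "real_distribution kern_distribution"
  and char_kern_distribution: "char kern_distribution v = tent v / tent 0"
  and integral_kern_distribution: "f \<in> borel_measurable borel \<Longrightarrow>
     (\<integral>w. f w \<partial>kern_distribution) = (\<integral>w. kern w * f w \<partial>lborel) / (2 * pi * tent 0)"
proof -
  have pos: "2 * pi * tent 0 > 0" using tent_0 by simp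
  have "complex_of_real (\<integral>w. kern w \<partial>lborel) = complex_of_real (2 * pi * tent 0)"
    using fourier_kern[of 0] by simp
  then have "(\<integral>w. kern w \<partial>lborel) = 2 * pi * tent 0" by (simp only: of_real_eq_iff)
  then have "(\<integral>w. kern w / (2 * pi * tent 0) \<partial>lborel) = 1" using tent_0 by simp
  then have "(\<integral>\<^sup>+w. ennreal (kern w / (2 * pi * tent 0)) \<partial>lborel) = 1"
    using integrable_kern pos less_imp_le[OF kern_pos] by (subst nn_integral_eq_integral) auto
  then have "prob_space kern_distribution"
    unfolding kern_distribution_def by (intro prob_spaceI) (simp add: emeasure_density)
  then show "real_distribution kern_distribution"
    unfolding real_distribution_def real_distribution_axioms_def by (simp add: kern_distribution_def)
  have nonneg: "AE w in lborel. 0 \<le> kern w / (2 * pi * tent 0)"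
    using pos less_imp_le[OF kern_pos] by (auto intro!: divide_nonneg_pos)
  have "char kern_distribution v = (\<integral>w. (kern w / (2 * pi * tent 0)) *\<^sub>R iexp (v * w) \<partial>lborel)"
    unfolding char_def kern_distribution_def using nonneg by (subst integral_density) auto
  also have "\<dots> = (\<integral>w. (kern w * iexp (v * w)) / complex_of_real (2 * pi * tent 0) \<partial>lborel)"
    by (intro Bochner_Integration.integral_cong refl) (simp add: scaleR_conv_of_real)
  also have "\<dots> = (2 * pi * tent v) / complex_of_real (2 * pi * tent 0)"
    by (subst integral_divide_zero) (simp only: fourier_kern)
  finally show "char kern_distribution v = tent v / tent 0" using pos by simp
  show "(\<integral>w. f w \<partial>kern_distribution) = (\<integral>w. kern w * f w \<partial>lborel) / (2 * pi * tent 0)"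
    if [measurable]: "f \<in> borel_measurable borel" for f :: "real \<Rightarrow> real"
    unfolding kern_distribution_def using nonneg by (subst integral_density) auto
qed

text \<open>By Levy's continuity theorem the laws of \<open>X j\<close> reweighted by \<open>b j * kern (X j)\<close> converge weakly to
  \<open>kern_distribution\<close>; the claim is this convergence tested on \<open>etail / kern\<close>, which is bounded and
  continuous off \<open>0\<close>.\<close>

lemma weighted_etail_limit:
  fixes M :: "nat \<Rightarrow> 'a measure" and b :: "nat \<Rightarrow> 'a \<Rightarrow> real"
  assumes prob: "\<And>j. prob_space (M j)" and X[measurable]: "\<And>j. X j \<in> borel_measurable (M j)"
    and b[measurable]: "\<And>j. b j \<in> borel_measurable (M j)"
    and B: "\<And>j x. 0 \<le> b j x" "\<And>j x. b j x \<le> B" and s: "\<And>j. s j > 0" and G: "G > 0"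
    and lim: "\<And>v. (\<lambda>j. s j * (\<integral>x. complex_of_real (b j x) * (kern (X j x) * iexp (v * X j x)) \<partial>M j))
           \<longlonglongrightarrow> complex_of_real (tent v * G)"
  shows "(\<lambda>j. s j * (\<integral>x. b j x * etail (X j x) \<partial>M j)) \<longlonglongrightarrow> G / (2 * pi)"
proof -
  define n where "n j = (\<integral>x. b j x * kern (X j x) \<partial>M j)" for j
  have "(\<lambda>j. complex_of_real (s j * n j)) \<longlonglongrightarrow> complex_of_real (tent 0 * G)"
  proof -
    have "complex_of_real (s j * n j) = s j * (\<integral>x. complex_of_real (b j x) * (kern (X j x) * iexp (0 * X j x)) \<partial>M j)" for j
      unfolding n_def of_real_mult integral_complex_of_real[symmetric] by simp
    then show ?thesis using lim[of 0] by (simp only:)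
  qed
  then have sn: "(\<lambda>j. s j * n j) \<longlonglongrightarrow> tent 0 * G" by (simp only: tendsto_of_real_iff)
  have "\<forall>\<^sub>F j in sequentially. s j * n j > 0"
    using order_tendstoD(1)[OF sn, of 0] tent_0 G by simp
  then obtain N where "\<And>j. j \<ge> N \<Longrightarrow> s j * n j > 0" by (auto simp: eventually_sequentially)
  then have n_pos: "n (j + N) > 0" for j using s[of "j + N"] by (metis le_add2 zero_less_mult_pos)
  \<comment> \<open>The total mass \<open>n\<close> is positive from \<open>N\<close> on because its
    rescaled limit \<open>tent 0 * G\<close> is; only then can the reweighted laws be
    normalised.\<close>
  define \<mu> where "\<mu> j = distr (density (M (j + N)) (\<lambda>x. b (j + N) x * kern (X (j + N) x) / n (j + N))) borel (X (j + N))" for j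
  have nonneg: "AE x in M (j + N). 0 \<le> b (j + N) x * kern (X (j + N) x) / n (j + N)" for j
    using B(1) less_imp_le[OF kern_pos] n_pos[of j] by auto
  have int: "integrable (M j) (\<lambda>x. b j x * kern (X j x))" for j
  proof -
    interpret prob_space "M j" by (rule prob)
    have "norm (b j x * kern (X j x)) \<le> B * (2 * (cosh 1 + 1))" for x
      using B(1)[of j x] B(2)[of j x] kern_bounded[of "X j x"] kern_pos[of "X j x"]
      by (simp add: abs_mult) (intro mult_mono, auto)
    then show ?thesis by (intro integrable_const_bound[of _ "B * (2 * (cosh 1 + 1))"] AE_I2) auto
  qed
  have "prob_space (density (M (j + N)) (\<lambda>x. b (j + N) x * kern (X (j + N) x) / n (j + N)))" for j
  proof (rule prob_spaceI)
    have "(\<integral>\<^sup>+x. ennreal (b (j + N) x * kern (X (j + N) x) / n (j + N)) \<partial>M (j + N)) =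
       ennreal (\<integral>x. b (j + N) x * kern (X (j + N) x) / n (j + N) \<partial>M (j + N))"
      using int nonneg by (intro nn_integral_eq_integral) auto
    also have "\<dots> = 1" using n_pos[of j] by (simp add: n_def)
    finally show "emeasure (density (M (j + N)) (\<lambda>x. b (j + N) x * kern (X (j + N) x) / n (j + N)))
        (space (density (M (j + N)) (\<lambda>x. b (j + N) x * kern (X (j + N) x) / n (j + N)))) = 1"
      by (subst emeasure_density) (auto cong: nn_integral_cong)
  qed
  then have rd: "real_distribution (\<mu> j)" for j
    unfolding \<mu>_def by (intro prob_space.real_distribution_distr) auto
  have int_\<mu>: "(\<integral>w. f w \<partial>\<mu> j) = (\<integral>x. (b (j + N) x * kern (X (j + N) x) / n (j + N)) *\<^sub>R f (X (j + N) x) \<partial>M (j + N))"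
    if [measurable]: "f \<in> borel_measurable borel" for j and f :: "real \<Rightarrow> 'b::{banach, second_countable_topology}"
    unfolding \<mu>_def using nonneg by (subst integral_distr) (auto simp: integral_density)
  have "weak_conv_m \<mu> kern_distribution"
  proof (rule levy_continuity[OF rd kern_distribution])
    fix v
    let ?E = "\<lambda>j. s j * (\<integral>x. complex_of_real (b j x) * (kern (X j x) * iexp (v * X j x)) \<partial>M j)"
    have frac: "(complex_of_real r * y) / complex_of_real (r * r') = y / complex_of_real r'" if "r > 0" for r r' y
      using that by simp
    have "char (\<mu> j) v = ?E (j + N) / complex_of_real (s (j + N) * n (j + N))" for j
    proof -
      have "char (\<mu> j) v = (\<integral>x. (complex_of_real (b (j + N) x) * (kern (X (j + N) x) * iexp (v * X (j + N) x))) / complex_of_real (n (j + N)) \<partial>M (j + N))"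
        unfolding char_def by (subst int_\<mu>) (auto simp: scaleR_conv_of_real mult.assoc)
      also have "\<dots> = (\<integral>x. (complex_of_real (b (j + N) x) * (kern (X (j + N) x) * iexp (v * X (j + N) x))) \<partial>M (j + N)) / complex_of_real (n (j + N))"
        by (rule integral_divide_zero)
      finally show ?thesis by (simp only: frac[OF s])
    qed
    moreover have "(\<lambda>j. ?E (j + N) / complex_of_real (s (j + N) * n (j + N))) \<longlonglongrightarrow> complex_of_real (tent v * G) / complex_of_real (tent 0 * G)"
      using G tent_0 by (intro LIMSEQ_ignore_initial_segment[of "\<lambda>j. ?E j / complex_of_real (s j * n j)"] tendsto_divide lim tendsto_of_real sn) auto
    ultimately show "(\<lambda>j. char (\<mu> j) v) \<longlonglongrightarrow> char kern_distribution v"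
      using G by (simp add: char_kern_distribution)
  qed
  then have "(\<lambda>j. \<integral>w. etail w / kern w \<partial>\<mu> j) \<longlonglongrightarrow> (\<integral>w. etail w / kern w \<partial>kern_distribution)"
  proof -
    assume wc: "weak_conv_m \<mu> kern_distribution"
    obtain B' where B': "\<And>w. \<bar>etail w / kern w\<bar> \<le> B'" using etail_le_kern by blast
    have sub: "{w. \<not> isCont (\<lambda>w. etail w / kern w) w} \<subseteq> {0}" using isCont_etail_kern by blast
    have "emeasure kern_distribution {0} = 0"
      unfolding kern_distribution_def by (subst emeasure_density) (auto simp: nn_integral_0_iff_AE intro: AE_mp[OF AE_lborel_singleton[of 0]])
    then have "emeasure kern_distribution {w. \<not> isCont (\<lambda>w. etail w / kern w) w} = 0"
      using emeasure_mono[OF sub, of kern_distribution] by (simp add: kern_distribution_def)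
    then show ?thesis
      by (intro weak_conv_imp_bdd_ae_continuous_conv[OF rd kern_distribution wc, of _ B']) (use B' in auto)
  qed
  also have "(\<integral>w. etail w / kern w \<partial>kern_distribution) = 1 / (2 * pi * tent 0)"
    using kern_pos by (subst integral_kern_distribution) (auto simp: less_imp_neq[symmetric] integral_etail)
  \<comment> \<open>Multiplying by the total mass undoes the normalisation and cancels
    \<open>tent 0\<close>.\<close>
  finally have "(\<lambda>j. (\<integral>w. etail w / kern w \<partial>\<mu> j) * (s (j + N) * n (j + N))) \<longlonglongrightarrow> 1 / (2 * pi * tent 0) * (tent 0 * G)"
    by (rule tendsto_mult[OF _ LIMSEQ_ignore_initial_segment[OF sn]])
  moreover have "(\<integral>w. etail w / kern w \<partial>\<mu> j) * (s (j + N) * n (j + N)) =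
        s (j + N) * (\<integral>x. b (j + N) x * etail (X (j + N) x) \<partial>M (j + N))" for j
  proof -
    have "(\<integral>w. etail w / kern w \<partial>\<mu> j) = (\<integral>x. b (j + N) x * etail (X (j + N) x) / n (j + N) \<partial>M (j + N))"
      using kern_pos by (subst int_\<mu>) (auto simp: less_imp_neq[symmetric] intro!: Bochner_Integration.integral_cong)
    then show ?thesis using n_pos[of j] by simp
  qed
  ultimately have "(\<lambda>j. s (j + N) * (\<integral>x. b (j + N) x * etail (X (j + N) x) \<partial>M (j + N))) \<longlonglongrightarrow> G / (2 * pi)"
    using tent_0 by simp
  from LIMSEQ_offset[where k = N and f = "\<lambda>j. s j * (\<integral>x. b j x * etail (X j x) \<partial>M j)", OF this]
  show ?thesis .
qed

section \<open>Geometric multiplicities\<close>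

text \<open>With u = s log (v n) the ratio exp (- u) is \<open>v n powr (- s)\<close>.\<close>

abbreviation geo :: "real \<Rightarrow> nat pmf" where "geo u \<equiv> geometric_pmf (1 - exp (- u))"

lemma geo_param:
  assumes "u > 0" shows "1 - exp (- u :: real) \<in> {0<..1}" "1 - exp (- u) \<in> {0..1}"
proof -
  have "exp (- u) < 1" using assms by simp
  then show "1 - exp (- u :: real) \<in> {0<..1}" "1 - exp (- u) \<in> {0..1}"
    using assms by (auto simp del: exp_less_one_iff)
qed

lemma geo_expectation:
  fixes h :: "nat \<Rightarrow> 'a::{banach, second_countable_topology}"
  assumes u: "u > 0" and "summable (\<lambda>m. norm (exp (- u) ^ m *\<^sub>R h m))"
  shows "integrable (geo u) h"
    and "measure_pmf.expectation (geo u) h = (1 - exp (- u)) *\<^sub>R (\<Sum>m. exp (- u) ^ m *\<^sub>R h m)"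
proof -
  let ?q = "exp (- u)"
  have pmf: "pmf (geo u) m = ?q ^ m * (1 - ?q)" for m
    using geo_param(1)[OF u] by simp
  have int: "integrable (count_space UNIV) (\<lambda>m. pmf (geo u) m *\<^sub>R h m)"
    unfolding integrable_count_space_nat_iff pmf
    using summable_mult[OF assms(2), of "\<bar>1 - ?q\<bar>"] by (simp add: mult_ac abs_mult)
  then show "integrable (geo u) h"
    unfolding measure_pmf_eq_density by (subst integrable_density) auto
  have "measure_pmf.expectation (geo u) h = (\<integral>m. pmf (geo u) m *\<^sub>R h m \<partial>count_space UNIV)"
    unfolding measure_pmf_eq_density by (subst integral_density) auto
  also have "\<dots> = (\<Sum>m. pmf (geo u) m *\<^sub>R h m)"
    using int by (rule integral_count_space_nat)
  also have "\<dots> = (\<Sum>m. (1 - ?q) *\<^sub>R (?q ^ m *\<^sub>R h m))"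
    unfolding pmf by (simp add: mult.commute)
  also have "\<dots> = (1 - ?q) *\<^sub>R (\<Sum>m. ?q ^ m *\<^sub>R h m)"
    by (rule suminf_scaleR_right[symmetric]) (rule summable_norm_cancel[OF assms(2)])
  finally show "measure_pmf.expectation (geo u) h = (1 - ?q) *\<^sub>R (\<Sum>m. ?q ^ m *\<^sub>R h m)" .
qed

text \<open>A common integrable majorant for all powers of \<open>u * m\<close> on \<open>m > 0\<close>.\<close>

definition expw :: "real \<Rightarrow> nat \<Rightarrow> real" where
  "expw u m = (if m = 0 then 0 else exp (u * m / 2))"

lemma expw_nonneg: "expw u m \<ge> 0"
  by (simp add: expw_def)

text \<open>The weight exp (u m / 2) turns the ratio into its square root exp (- u / 2). The
  resulting bound stays finite as u tends to 0 and is summable over the parts, so moment bounds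
  derived from it have sums of order 1 / s.\<close>

lemma geo_expw:
  assumes u: "u > 0"
  shows "integrable (geo u) (expw u)"
    and "measure_pmf.expectation (geo u) (expw u) \<le> 2 * exp (- u / 2)"
proof -
  let ?r = "exp (- u / 2)"
  have r: "0 < ?r" "?r < 1" using u by auto
  have rr: "exp (- u) = ?r * ?r" by (simp flip: exp_add)
  have "exp (- u) ^ m *\<^sub>R expw u m = (if m = 0 then 0 else ?r ^ m)" for m
    unfolding expw_def by (auto simp flip: exp_of_nat_mult exp_add)
  then have eq: "(\<lambda>m. exp (- u) ^ m *\<^sub>R expw u m) = (\<lambda>m. ?r ^ m - (if m = 0 then 1 else 0))"
    by auto
  have "(\<lambda>m. ?r ^ m - (if m = 0 then 1 else 0)) sums (1 / (1 - ?r) - 1)"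
    using r by (intro sums_diff geometric_sums sums_single[of 0 "\<lambda>_. 1"]) auto
  then have s: "(\<lambda>m. exp (- u) ^ m *\<^sub>R expw u m) sums (1 / (1 - ?r) - 1)"
    unfolding eq .
  have n: "(\<lambda>m. norm (exp (- u) ^ m *\<^sub>R expw u m)) = (\<lambda>m. exp (- u) ^ m *\<^sub>R expw u m)"
    using expw_nonneg by (auto simp: abs_mult)
  note * = geo_expectation[OF u, of "expw u"]
  show "integrable (geo u) (expw u)" using s by (intro *) (simp only: n sums_iff)
  have "measure_pmf.expectation (geo u) (expw u) = (1 - exp (- u)) * (1 / (1 - ?r) - 1)"
    using s by (subst *) (simp only: n sums_iff, simp add: sums_iff)
  also have "\<dots> = (1 + ?r) * ?r" using r unfolding rr by (simp add: field_simps)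
  also have "\<dots> \<le> 2 * ?r" using r by (intro mult_right_mono) auto
  finally show "measure_pmf.expectation (geo u) (expw u) \<le> 2 * exp (- u / 2)" .
qed

section \<open>Moments of a geometric variable and of its positivity indicator\<close>

lemma power_le_exp:
  fixes y :: real assumes "y \<ge> 0" shows "y ^ k \<le> fact k * exp y"
proof -
  have "y ^ k / fact k \<le> exp y"
    using sum_le_suminf[of "\<lambda>n. y ^ n /\<^sub>R fact n" "{k}"] summable_exp_generic[of y] assms
    by (simp add: exp_def divide_inverse mult.commute)
  then show ?thesis by (simp add: field_simps)
qed

lemma power_le_expw:
  assumes "u > 0" "m > 0"
  shows "(u * real m) ^ k \<le> 2 ^ k * fact k * expw u m"
proof -
  have "(u * real m / 2) ^ k \<le> fact k * exp (u * real m / 2)"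
    using assms by (intro power_le_exp) auto
  then show ?thesis using assms by (simp add: expw_def power_divide field_simps)
qed

lemma geo_moments:
  assumes u: "u > 0"
  defines "q \<equiv> exp (- u)"
  shows "measure_pmf.expectation (geo u) real = q / (1 - q)"
    and "measure_pmf.expectation (geo u) (\<lambda>m. (real m)\<^sup>2) = q * (1 + q) / (1 - q)\<^sup>2"
    and "measure_pmf.expectation (geo u) (\<lambda>m. if m > 0 then 1 else 0) = q"
    and "integrable (geo u) real" "integrable (geo u) (\<lambda>m. (real m)\<^sup>2)"
    and "integrable (geo u) (\<lambda>m. if m > 0 then 1 else 0 :: real)"
proof -
  have q: "0 < q" "q < 1" using u by (auto simp: q_def)
  show "measure_pmf.expectation (geo u) real = q / (1 - q)"
    using expectation_geometric_pmf[OF geo_param(1)[OF u]] by (simp add: q_def)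
  show "integrable (geo u) real"
    using integrable_real_geometric_pmf[OF geo_param(1)[OF u]] .
  show int2: "integrable (geo u) (\<lambda>m. (real m)\<^sup>2)"
  proof (rule Bochner_Integration.integrable_bound)
    show "integrable (geo u) (\<lambda>m. 8 / u\<^sup>2 * expw u m)" using geo_expw[OF u] by simp
    have "(real m)\<^sup>2 \<le> 8 / u\<^sup>2 * expw u m" for m
      using power_le_expw[OF u, of m 2] u expw_nonneg[of u m]
      by (cases "m = 0") (simp_all add: power_mult_distrib field_simps fact_2)
    then show "AE m in geo u. norm ((real m)\<^sup>2) \<le> norm (8 / u\<^sup>2 * expw u m)"
      using expw_nonneg[of u] by (intro AE_I2) (simp add: order_trans[OF _ abs_ge_self])
  qed auto
  show "integrable (geo u) (\<lambda>m. if m > 0 then 1 else 0 :: real)"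
    by (intro measure_pmf.integrable_const_bound[of _ 1]) auto
  have "measure_pmf.expectation (geo u) (\<lambda>m. if m > 0 then 1 else 0 :: real) =
      measure_pmf.expectation (geo u) (\<lambda>m. 1 - indicator {0} m)"
    by (intro integral_cong_AE) (auto simp: indicator_def)
  also have "\<dots> = 1 - pmf (geo u) 0"
    by (subst Bochner_Integration.integral_diff) (auto simp: measure_pmf.prob_space pmf.rep_eq intro!: measure_pmf.integrable_const_bound[of _ 1])
  also have "\<dots> = q" using geo_param(1)[OF u] by (simp add: q_def)
  finally show "measure_pmf.expectation (geo u) (\<lambda>m. if m > 0 then 1 else 0) = q" .
  have S0: "(\<lambda>m. q ^ m) sums (1 / (1 - q))" using q by (intro geometric_sums) auto
  have S1: "(\<lambda>m. q ^ m * real m) sums (q / (1 - q)\<^sup>2)"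
    using geometric_sums_times_n[of q] q by (simp add: norm_mult)
  have sm: "summable (\<lambda>m. q ^ m * (real m)\<^sup>2)"
  proof -
    have "integrable (count_space UNIV) (\<lambda>m. pmf (geo u) m *\<^sub>R (real m)\<^sup>2)"
      using int2 unfolding measure_pmf_eq_density by (subst (asm) integrable_density) auto
    then have "summable (\<lambda>m. norm (pmf (geo u) m *\<^sub>R (real m)\<^sup>2))"
      unfolding integrable_count_space_nat_iff .
    then have "summable (\<lambda>m. (1 - q) * (q ^ m * (real m)\<^sup>2))"
      using q u by (simp add: q_def abs_mult mult_ac geo_param)
    then show ?thesis using q by (subst (asm) summable_cmult_iff) auto
  qed
  define S where "S = (\<Sum>m. q ^ m * (real m)\<^sup>2)"
  have "(\<lambda>m. q ^ m * (real m)\<^sup>2) sums S" using sm by (simp add: S_def summable_sums)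
  \<comment> \<open>The expansion of (m + 1)^2 and an index shift give a linear equation for
    \<open>S\<close>.\<close>
  then have "(\<lambda>m. q * (q ^ m * (real m)\<^sup>2 + 2 * (q ^ m * real m) + q ^ m)) sums (q * (S + 2 * (q / (1 - q)\<^sup>2) + 1 / (1 - q)))"
    by (intro sums_mult sums_add S0 S1)
  moreover have "(\<lambda>m. q * (q ^ m * (real m)\<^sup>2 + 2 * (q ^ m * real m) + q ^ m)) = (\<lambda>m. q ^ Suc m * (real (Suc m))\<^sup>2)"
    by (auto simp: algebra_simps power2_eq_square)
  moreover have "(\<lambda>m. q ^ Suc m * (real (Suc m))\<^sup>2) sums S"
    using \<open>(\<lambda>m. q ^ m * (real m)\<^sup>2) sums S\<close> by (subst sums_Suc_iff) simp
  ultimately have "S = q * (S + 2 * (q / (1 - q)\<^sup>2) + 1 / (1 - q))" by (simp add: sums_unique2)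
  then have "S * (1 - q) = q * (2 * (q / (1 - q)\<^sup>2) + 1 / (1 - q))" by (simp add: algebra_simps)
  moreover have "(2 * q + (1 - q)) / (1 - q)\<^sup>2 = 2 * (q / (1 - q)\<^sup>2) + 1 / (1 - q)"
    using q by (subst add_divide_distrib) (simp add: power2_eq_square)
  moreover have "(2 * q + (1 - q)) = 1 + q" by simp
  ultimately have S: "(1 - q) * S = q * (1 + q) / (1 - q)\<^sup>2"
    by (metis mult.commute times_divide_eq_right)
  have "measure_pmf.expectation (geo u) (\<lambda>m. (real m)\<^sup>2) = (1 - q) *\<^sub>R S"
    unfolding S_def q_def using geo_expectation(2)[OF u, of "\<lambda>m. (real m)\<^sup>2"] sm by (simp add: q_def abs_mult)
  then show "measure_pmf.expectation (geo u) (\<lambda>m. (real m)\<^sup>2) = q * (1 + q) / (1 - q)\<^sup>2"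
    using S by simp
qed

definition geo_svar :: "real \<Rightarrow> real" where
  "geo_svar u = u\<^sup>2 * exp (- u) / (1 - exp (- u))\<^sup>2"

text \<open>For m with law \<open>geo u\<close>, the coefficients are the variance of u m, its
  covariance u exp (- u) with the indicator of m > 0, and the variance of that indicator.\<close>

definition geo_var :: "real \<Rightarrow> real \<Rightarrow> real \<Rightarrow> real" where
  "geo_var \<theta> \<tau> u = \<theta>\<^sup>2 * geo_svar u + 2 * \<theta> * \<tau> * (u * exp (- u)) + \<tau>\<^sup>2 * (exp (- u) - exp (- 2 * u))"

definition geo_mean :: "real \<Rightarrow> real \<Rightarrow> real \<Rightarrow> real" where
  "geo_mean \<theta> \<tau> u = \<theta> * (u * exp (- u) / (1 - exp (- u))) + \<tau> * exp (- u)"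

text \<open>The share of one part in a linear combination of the total and the number of distinct
  parts; the joint law is studied through all such combinations.\<close>

definition geo_rv :: "real \<Rightarrow> real \<Rightarrow> real \<Rightarrow> nat \<Rightarrow> real" where
  "geo_rv \<theta> \<tau> u m = \<theta> * (u * m) + \<tau> * (if m > 0 then 1 else 0)"

lemma cube_add_le:
  fixes a b :: real assumes "a \<ge> 0" "b \<ge> 0" shows "(a + b) ^ 3 \<le> 4 * (a ^ 3 + b ^ 3)"
proof -
  have "4 * (a ^ 3 + b ^ 3) - (a + b) ^ 3 = 3 * ((a + b) * (a - b)\<^sup>2)"
    by (simp add: algebra_simps power2_eq_square power3_eq_cube)
  moreover have "(a + b) * (a - b)\<^sup>2 \<ge> 0" using assms by simp
  ultimately show ?thesis by linarith
qed

lemma square_add_le: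
  fixes a b :: real shows "(a + b)\<^sup>2 \<le> 2 * (a\<^sup>2 + b\<^sup>2)"
  using sum_squares_bound[of a b] by (simp add: power2_sum)

text \<open>For m = 0 everything vanishes; for m > 0 \<open>expw\<close> is at least 1 and so also
  absorbs the term \<open>\<tau>\<close>. The constants stem from 2^k k! in
  \<open>power_le_expw\<close>: 2, 8 and 48.\<close>

lemma geo_rv_bounds:
  assumes u: "u > 0"
  shows "\<bar>geo_rv \<theta> \<tau> u m\<bar> \<le> (2 * \<bar>\<theta>\<bar> + \<bar>\<tau>\<bar>) * expw u m"
    and "(geo_rv \<theta> \<tau> u m)\<^sup>2 \<le> 16 * (\<theta>\<^sup>2 + \<tau>\<^sup>2) * expw u m"
    and "\<bar>geo_rv \<theta> \<tau> u m\<bar> ^ 3 \<le> 192 * (\<bar>\<theta>\<bar> ^ 3 + \<bar>\<tau>\<bar> ^ 3) * expw u m"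
proof -
  let ?w = "expw u m" and ?y = "u * real m"
  consider "m = 0" | "m > 0" by auto
  then have "\<bar>geo_rv \<theta> \<tau> u m\<bar> \<le> (2 * \<bar>\<theta>\<bar> + \<bar>\<tau>\<bar>) * ?w \<and> (geo_rv \<theta> \<tau> u m)\<^sup>2 \<le> 16 * (\<theta>\<^sup>2 + \<tau>\<^sup>2) * ?w \<and>
     \<bar>geo_rv \<theta> \<tau> u m\<bar> ^ 3 \<le> 192 * (\<bar>\<theta>\<bar> ^ 3 + \<bar>\<tau>\<bar> ^ 3) * ?w"
  proof cases
    case 2
    have w1: "?w \<ge> 1" using 2 u by (simp add: expw_def)
    have y: "?y \<ge> 0" using u by simp
    have p: "?y ^ 1 \<le> 2 * ?w" "?y ^ 2 \<le> 8 * ?w" "?y ^ 3 \<le> 48 * ?w"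
      using power_le_expw[OF u 2, of 1] power_le_expw[OF u 2, of 2] power_le_expw[OF u 2, of 3]
      by (simp_all add: fact_numeral)
    have rv: "geo_rv \<theta> \<tau> u m = \<theta> * ?y + \<tau>" using 2 by (simp add: geo_rv_def)
    have abs: "\<bar>\<theta> * ?y + \<tau>\<bar> \<le> \<bar>\<theta>\<bar> * ?y + \<bar>\<tau>\<bar>"
      using y u by (intro order_trans[OF abs_triangle_ineq]) (simp add: abs_mult)
    have "\<bar>\<theta>\<bar> * ?y \<le> \<bar>\<theta>\<bar> * (2 * ?w)" using p(1) by (intro mult_left_mono) auto
    moreover have "\<bar>\<tau>\<bar> * 1 \<le> \<bar>\<tau>\<bar> * ?w" using w1 by (intro mult_left_mono) auto
    ultimately have 1: "\<bar>geo_rv \<theta> \<tau> u m\<bar> \<le> (2 * \<bar>\<theta>\<bar> + \<bar>\<tau>\<bar>) * ?w"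
      using abs unfolding rv by (simp add: algebra_simps)
    have "(\<theta> * ?y + \<tau>)\<^sup>2 \<le> 2 * ((\<theta> * ?y)\<^sup>2 + \<tau>\<^sup>2)" by (rule square_add_le)
    also have "\<dots> = 2 * (\<theta>\<^sup>2 * ?y ^ 2) + 2 * (\<tau>\<^sup>2 * 1)" by (simp add: power_mult_distrib)
    also have "\<dots> \<le> 2 * (\<theta>\<^sup>2 * (8 * ?w)) + 2 * (\<tau>\<^sup>2 * (8 * ?w))"
      using p(2) w1 by (intro add_mono mult_left_mono) auto
    finally have 2: "(geo_rv \<theta> \<tau> u m)\<^sup>2 \<le> 16 * (\<theta>\<^sup>2 + \<tau>\<^sup>2) * ?w"
      unfolding rv by (simp add: algebra_simps)
    have "\<bar>\<theta> * ?y + \<tau>\<bar> ^ 3 \<le> (\<bar>\<theta>\<bar> * ?y + \<bar>\<tau>\<bar>) ^ 3" using abs by (intro power_mono) auto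
    also have "\<dots> \<le> 4 * ((\<bar>\<theta>\<bar> * ?y) ^ 3 + \<bar>\<tau>\<bar> ^ 3)" using y by (intro cube_add_le) auto
    also have "\<dots> = 4 * (\<bar>\<theta>\<bar> ^ 3 * ?y ^ 3) + 4 * (\<bar>\<tau>\<bar> ^ 3 * 1)" by (simp add: power_mult_distrib)
    also have "\<dots> \<le> 4 * (\<bar>\<theta>\<bar> ^ 3 * (48 * ?w)) + 4 * (\<bar>\<tau>\<bar> ^ 3 * (48 * ?w))"
      using p(3) w1 by (intro add_mono mult_left_mono) auto
    finally have 3: "\<bar>geo_rv \<theta> \<tau> u m\<bar> ^ 3 \<le> 192 * (\<bar>\<theta>\<bar> ^ 3 + \<bar>\<tau>\<bar> ^ 3) * ?w"
      unfolding rv by (simp add: algebra_simps)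
    show ?thesis using 1 2 3 by blast
  qed (simp add: geo_rv_def expw_def)
  then show "\<bar>geo_rv \<theta> \<tau> u m\<bar> \<le> (2 * \<bar>\<theta>\<bar> + \<bar>\<tau>\<bar>) * expw u m"
    and "(geo_rv \<theta> \<tau> u m)\<^sup>2 \<le> 16 * (\<theta>\<^sup>2 + \<tau>\<^sup>2) * expw u m"
    and "\<bar>geo_rv \<theta> \<tau> u m\<bar> ^ 3 \<le> 192 * (\<bar>\<theta>\<bar> ^ 3 + \<bar>\<tau>\<bar> ^ 3) * expw u m" by auto
qed

lemma geo_rv_moments:
  assumes u: "u > 0"
  shows "integrable (geo u) (geo_rv \<theta> \<tau> u)"
    and "measure_pmf.expectation (geo u) (geo_rv \<theta> \<tau> u) = geo_mean \<theta> \<tau> u"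
    and "integrable (geo u) (\<lambda>m. (geo_rv \<theta> \<tau> u m)\<^sup>2)"
    and "measure_pmf.expectation (geo u) (\<lambda>m. (geo_rv \<theta> \<tau> u m)\<^sup>2) = geo_var \<theta> \<tau> u + (geo_mean \<theta> \<tau> u)\<^sup>2"
proof -
  define q where "q = exp (- u)"
  have q: "0 < q" "q < 1" using u by (auto simp: q_def)
  note m = geo_moments[OF u, folded q_def]
  have rv: "geo_rv \<theta> \<tau> u = (\<lambda>m. \<theta> * u * real m + \<tau> * (if m > 0 then 1 else 0))"
    by (auto simp: geo_rv_def)
  have rv2: "(\<lambda>m. (geo_rv \<theta> \<tau> u m)\<^sup>2) = (\<lambda>m. \<theta>\<^sup>2 * u\<^sup>2 * (real m)\<^sup>2 + 2 * \<theta> * \<tau> * u * real m + \<tau>\<^sup>2 * (if m > 0 then 1 else 0))"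
    by (auto simp: geo_rv_def power2_eq_square algebra_simps)
  show "integrable (geo u) (geo_rv \<theta> \<tau> u)"
    unfolding rv using m(4,6) by (intro Bochner_Integration.integrable_add integrable_mult_right) (auto simp: q_def)
  show "integrable (geo u) (\<lambda>m. (geo_rv \<theta> \<tau> u m)\<^sup>2)"
    unfolding rv2 using m(4,5,6) by (intro Bochner_Integration.integrable_add integrable_mult_right) (auto simp: q_def)
  have "measure_pmf.expectation (geo u) (geo_rv \<theta> \<tau> u) = \<theta> * u * (q / (1 - q)) + \<tau> * q"
    unfolding rv using m by (subst Bochner_Integration.integral_add) (auto simp: q_def)
  then show "measure_pmf.expectation (geo u) (geo_rv \<theta> \<tau> u) = geo_mean \<theta> \<tau> u"
    by (simp add: geo_mean_def q_def)
  have "measure_pmf.expectation (geo u) (\<lambda>m. (geo_rv \<theta> \<tau> u m)\<^sup>2) =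
      \<theta>\<^sup>2 * u\<^sup>2 * (q * (1 + q) / (1 - q)\<^sup>2) + 2 * \<theta> * \<tau> * u * (q / (1 - q)) + \<tau>\<^sup>2 * q"
  proof -
    have "integrable (geo u) (\<lambda>m. \<theta>\<^sup>2 * u\<^sup>2 * (real m)\<^sup>2)" "integrable (geo u) (\<lambda>m. 2 * \<theta> * \<tau> * u * real m)"
      "integrable (geo u) (\<lambda>m. \<tau>\<^sup>2 * (if m > 0 then 1 else 0))"
      using m(4,5,6) unfolding q_def by (intro integrable_mult_right; simp)+
    then show ?thesis unfolding rv2 using m(1,2,3)
      by (simp only: q_def Bochner_Integration.integral_add Bochner_Integration.integrable_add integral_mult_right_zero)
  qed
  also have "\<dots> = geo_var \<theta> \<tau> u + (geo_mean \<theta> \<tau> u)\<^sup>2"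
  proof -
    have e2: "exp (- 2 * u) = q * q" unfolding q_def by (simp flip: exp_add)
    define d where "d = 1 - q"
    have d: "d \<noteq> 0" "q = 1 - d" using q by (auto simp: d_def)
    show ?thesis
      unfolding geo_var_def geo_mean_def geo_svar_def e2 q_def[symmetric] d_def[symmetric]
      using d(1) unfolding d(2) by (simp add: field_simps power2_eq_square)
  qed
  finally show "measure_pmf.expectation (geo u) (\<lambda>m. (geo_rv \<theta> \<tau> u m)\<^sup>2) = geo_var \<theta> \<tau> u + (geo_mean \<theta> \<tau> u)\<^sup>2" .
qed

lemma geo_mean_var_bounds:
  assumes u: "u > 0"
  shows "\<bar>geo_mean \<theta> \<tau> u\<bar> \<le> (4 * \<bar>\<theta>\<bar> + 2 * \<bar>\<tau>\<bar>) * exp (- u / 2)"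
    and "0 \<le> geo_var \<theta> \<tau> u" and "geo_var \<theta> \<tau> u \<le> 32 * (\<theta>\<^sup>2 + \<tau>\<^sup>2) * exp (- u / 2)"
proof -
  note r = geo_rv_moments[OF u, of \<theta> \<tau>] and w = geo_expw[OF u] and b = geo_rv_bounds[OF u, of \<theta> \<tau>]
  have "\<bar>geo_mean \<theta> \<tau> u\<bar> \<le> measure_pmf.expectation (geo u) (\<lambda>m. \<bar>geo_rv \<theta> \<tau> u m\<bar>)"
    unfolding r(2)[symmetric] by (rule integral_abs_bound)
  also have "\<dots> \<le> measure_pmf.expectation (geo u) (\<lambda>m. (2 * \<bar>\<theta>\<bar> + \<bar>\<tau>\<bar>) * expw u m)"
    using r(1) w(1) b(1) by (intro integral_mono) auto
  also have "\<dots> \<le> (2 * \<bar>\<theta>\<bar> + \<bar>\<tau>\<bar>) * (2 * exp (- u / 2))"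
    unfolding integral_mult_right_zero using w(2) by (intro mult_left_mono) auto
  finally show "\<bar>geo_mean \<theta> \<tau> u\<bar> \<le> (4 * \<bar>\<theta>\<bar> + 2 * \<bar>\<tau>\<bar>) * exp (- u / 2)" by (simp add: algebra_simps)
  have "measure_pmf.variance (geo u) (geo_rv \<theta> \<tau> u) = geo_var \<theta> \<tau> u"
    using r by (subst measure_pmf.variance_eq) auto
  then show "0 \<le> geo_var \<theta> \<tau> u" using measure_pmf.variance_positive[of "geo u" "geo_rv \<theta> \<tau> u"] by simp
  have "geo_var \<theta> \<tau> u \<le> geo_var \<theta> \<tau> u + (geo_mean \<theta> \<tau> u)\<^sup>2" by simp
  also have "\<dots> \<le> measure_pmf.expectation (geo u) (\<lambda>m. 16 * (\<theta>\<^sup>2 + \<tau>\<^sup>2) * expw u m)"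
    unfolding r(4)[symmetric] using r(3) w(1) b(2) by (intro integral_mono) auto
  also have "\<dots> \<le> 16 * (\<theta>\<^sup>2 + \<tau>\<^sup>2) * (2 * exp (- u / 2))"
    unfolding integral_mult_right_zero using w(2) by (intro mult_left_mono) auto
  finally show "geo_var \<theta> \<tau> u \<le> 32 * (\<theta>\<^sup>2 + \<tau>\<^sup>2) * exp (- u / 2)" by (simp add: algebra_simps)
qed

text \<open>Second-order Taylor expansion of the characteristic function of the centred variable,
  whose frequency is already contained in \<open>\<theta>\<close> and \<open>\<tau>\<close>. 2560 =
  2 * 768 + 4 * 256 collects the third moment of the variable and the cube of its mean; the factor
  1/6 is given away.\<close>

lemma geo_char_approx:
  assumes u: "u > 0"
  shows "norm (measure_pmf.expectation (geo u) (\<lambda>m. iexp (geo_rv \<theta> \<tau> u m - geo_mean \<theta> \<tau> u))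
           - (1 - geo_var \<theta> \<tau> u / 2)) \<le> 2560 * (\<bar>\<theta>\<bar> ^ 3 + \<bar>\<tau>\<bar> ^ 3) * exp (- u / 2)"
proof -
  note r = geo_rv_moments[OF u, of \<theta> \<tau>] and w = geo_expw[OF u] and b = geo_rv_bounds[OF u, of \<theta> \<tau>]
  define c where "c = geo_mean \<theta> \<tau> u"
  define X where "X = (\<lambda>m. geo_rv \<theta> \<tau> u m - c)"
  let ?E = "measure_pmf.expectation (geo u)" and ?A = "\<bar>\<theta>\<bar> ^ 3 + \<bar>\<tau>\<bar> ^ 3"
  have iX: "integrable (geo u) X" using r(1) by (simp add: X_def)
  have EX: "?E X = 0" unfolding X_def using r(1,2) by (simp add: c_def)
  have iX2: "integrable (geo u) (\<lambda>m. (X m)\<^sup>2)"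
    unfolding X_def power2_diff using r(1,3) by simp
  have VX: "measure_pmf.variance (geo u) X = geo_var \<theta> \<tau> u"
  proof -
    have "measure_pmf.variance (geo u) (geo_rv \<theta> \<tau> u) = geo_var \<theta> \<tau> u"
      using r by (subst measure_pmf.variance_eq) auto
    then show ?thesis unfolding EX using r(2) by (simp add: X_def c_def)
  qed
  have approx: "norm (char (distr (geo u) borel X) 1 - (1 - 1\<^sup>2 * geo_var \<theta> \<tau> u / 2)) \<le>
      (1\<^sup>2 / 6) * ?E (\<lambda>m. min (6 * (X m)\<^sup>2) (\<bar>1\<bar> * \<bar>X m\<bar> ^ 3))"
    by (rule prob_space.char_approx3'[OF measure_pmf.prob_space_axioms _ iX iX2 EX VX refl]) simp
  have char: "char (distr (geo u) borel X) 1 = ?E (\<lambda>m. iexp (geo_rv \<theta> \<tau> u m - c))"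
    unfolding char_def by (subst integral_distr) (auto simp: X_def)
  have third_moment: "?E (\<lambda>m. min (6 * (X m)\<^sup>2) (\<bar>1\<bar> * \<bar>X m\<bar> ^ 3)) \<le> 2560 * ?A * exp (- u / 2)"
  proof -
    have c3: "\<bar>c\<bar> ^ 3 \<le> 256 * ?A * exp (- u / 2)"
    proof -
      have "\<bar>c\<bar> ^ 3 \<le> ((4 * \<bar>\<theta>\<bar> + 2 * \<bar>\<tau>\<bar>) * exp (- u / 2)) ^ 3"
        unfolding c_def using geo_mean_var_bounds(1)[OF u] by (intro power_mono) auto
      also have "\<dots> = (4 * \<bar>\<theta>\<bar> + 2 * \<bar>\<tau>\<bar>) ^ 3 * exp (- u / 2) ^ 3" by (rule power_mult_distrib)
      also have "\<dots> \<le> (4 * ((4 * \<bar>\<theta>\<bar>) ^ 3 + (2 * \<bar>\<tau>\<bar>) ^ 3)) * exp (- u / 2) ^ 1"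
        using u by (intro mult_mono cube_add_le power_decreasing) auto
      also have "\<dots> \<le> 256 * ?A * exp (- u / 2)" by (simp add: power_mult_distrib algebra_simps)
      finally show ?thesis .
    qed
    have "min (6 * (X m)\<^sup>2) (\<bar>1\<bar> * \<bar>X m\<bar> ^ 3) \<le> 768 * ?A * expw u m + 4 * \<bar>c\<bar> ^ 3" for m
    proof -
      have "\<bar>X m\<bar> ^ 3 \<le> (\<bar>geo_rv \<theta> \<tau> u m\<bar> + \<bar>c\<bar>) ^ 3" unfolding X_def by (intro power_mono) auto
      also have "\<dots> \<le> 4 * (\<bar>geo_rv \<theta> \<tau> u m\<bar> ^ 3 + \<bar>c\<bar> ^ 3)" by (intro cube_add_le) auto
      also have "\<dots> \<le> 4 * (192 * ?A * expw u m + \<bar>c\<bar> ^ 3)" using b(3)[of m] by simp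
      finally show ?thesis by (simp add: min.coboundedI2 algebra_simps)
    qed
    then have "?E (\<lambda>m. min (6 * (X m)\<^sup>2) (\<bar>1\<bar> * \<bar>X m\<bar> ^ 3)) \<le> ?E (\<lambda>m. 768 * ?A * expw u m + 4 * \<bar>c\<bar> ^ 3)"
    proof (intro integral_mono)
      show "integrable (geo u) (\<lambda>m. min (6 * (X m)\<^sup>2) (\<bar>1\<bar> * \<bar>X m\<bar> ^ 3))"
        by (rule Bochner_Integration.integrable_bound[OF integrable_mult_right[OF iX2, of 6]]) auto
      show "integrable (geo u) (\<lambda>m. 768 * ?A * expw u m + 4 * \<bar>c\<bar> ^ 3)"
        using w(1) by simp
    qed
    also have "\<dots> = 768 * ?A * ?E (expw u) + 4 * \<bar>c\<bar> ^ 3"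
      using w(1) by (subst Bochner_Integration.integral_add) (auto simp: measure_pmf.prob_space)
    also have "\<dots> \<le> 768 * ?A * (2 * exp (- u / 2)) + 4 * (256 * ?A * exp (- u / 2))"
      using w(2) c3 by (intro add_mono mult_left_mono) auto
    finally show ?thesis by (simp add: algebra_simps)
  qed
  have combine: "x \<le> z" if "x \<le> (1\<^sup>2 / 6) * y" "y \<le> z" "z \<ge> 0" for x y z :: real
    using that by simp
  have "norm (?E (\<lambda>m. iexp (geo_rv \<theta> \<tau> u m - c)) - (1 - 1\<^sup>2 * geo_var \<theta> \<tau> u / 2))
      \<le> 2560 * ?A * exp (- u / 2)"
    by (rule combine[OF approx[unfolded char] third_moment]) simp
  then show ?thesis unfolding c_def by simp
qed

text \<open>1 - x <= exp (- x) <= 1 / (1 + x + x^2/2) <= 1 - x + x^2/2, the last step because (1 - x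
  + x^2/2)(1 + x + x^2/2) = 1 + x^4/4.\<close>

lemma abs_one_minus_exp_le:
  fixes x :: real assumes "x \<ge> 0" shows "\<bar>(1 - x) - exp (- x)\<bar> \<le> x\<^sup>2 / 2"
proof -
  have p: "1 + x + x\<^sup>2 / 2 > 0" using assms by (intro add_pos_nonneg) auto
  have "(1 - x + x\<^sup>2 / 2) * (1 + x + x\<^sup>2 / 2) = 1 + x ^ 4 / 4"
    by (simp add: field_simps power2_eq_square power4_eq_xxxx)
  then have "1 \<le> (1 - x + x\<^sup>2 / 2) * (1 + x + x\<^sup>2 / 2)" by simp
  then have "1 / (1 + x + x\<^sup>2 / 2) \<le> 1 - x + x\<^sup>2 / 2" using p by (simp add: pos_divide_le_eq)
  moreover have "exp (- x) \<le> 1 / (1 + x + x\<^sup>2 / 2)"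
    using exp_lower_Taylor_quadratic[OF assms] p by (simp add: exp_minus inverse_eq_divide divide_left_mono)
  moreover have "exp (- x) \<ge> 1 - x" using exp_ge_add_one_self[of "- x"] by simp
  ultimately show ?thesis by simp
qed

section \<open>Characteristic functions of sums over independent parts\<close>

lemma expectation_prod_Pi_pmf_gen:
  fixes f :: "'i \<Rightarrow> 'b \<Rightarrow> 'c::{real_normed_field, banach, second_countable_topology}" and p :: "'i \<Rightarrow> 'b pmf"
  assumes fin: "finite J" and int: "\<And>i. i \<in> J \<Longrightarrow> integrable (p i) (f i)"
  shows "measure_pmf.expectation (Pi_pmf J d p) (\<lambda>\<omega>. \<Prod>i\<in>J. f i (\<omega> i)) = (\<Prod>i\<in>J. measure_pmf.expectation (p i) (f i))"
proof -
  have map: "map_pmf (\<lambda>\<omega>. \<omega> i) (Pi_pmf J d p) = p i" if "i \<in> J" for i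
    using that fin by (simp add: Pi_pmf_component)
  have ind: "prob_space.indep_vars (measure_pmf (Pi_pmf J d p)) (\<lambda>_. borel) (\<lambda>i \<omega>. f i (\<omega> i)) J"
    by (rule prob_space.indep_vars_compose2[OF measure_pmf.prob_space_axioms indep_vars_Pi_pmf[OF fin]]) auto
  have "measure_pmf.expectation (Pi_pmf J d p) (\<lambda>\<omega>. \<Prod>i\<in>J. f i (\<omega> i)) =
     (\<Prod>i\<in>J. measure_pmf.expectation (Pi_pmf J d p) (\<lambda>\<omega>. f i (\<omega> i)))"
  proof (rule prob_space.indep_vars_lebesgue_integral[OF measure_pmf.prob_space_axioms fin ind])
    fix i assume i: "i \<in> J"
    show "integrable (measure_pmf (Pi_pmf J d p)) (\<lambda>\<omega>. f i (\<omega> i))"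
      using int[OF i] unfolding map[OF i, symmetric] by simp
  qed
  also have "\<dots> = (\<Prod>i\<in>J. measure_pmf.expectation (p i) (f i))"
  proof (rule prod.cong[OF refl])
    fix i assume i: "i \<in> J"
    show "measure_pmf.expectation (Pi_pmf J d p) (\<lambda>\<omega>. f i (\<omega> i)) = measure_pmf.expectation (p i) (f i)"
      unfolding map[OF i, symmetric] by simp
  qed
  finally show ?thesis .
qed

lemma geo_char_le_1: "norm (measure_pmf.expectation (geo u) (\<lambda>m. iexp (g m))) \<le> 1"
proof -
  have "norm (measure_pmf.expectation (geo u) (\<lambda>m. iexp (g m))) \<le> measure_pmf.expectation (geo u) (\<lambda>m. norm (iexp (g m)))"
    by (rule integral_norm_bound)
  then show ?thesis by (simp add: measure_pmf.prob_space)
qed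

lemma integrable_geo_iexp: "integrable (measure_pmf p) (\<lambda>m. iexp (g m))"
  by (intro measure_pmf.integrable_const_bound[of _ 1]) auto

lemma iexp_sum: "finite J \<Longrightarrow> iexp (\<Sum>n\<in>J. g n) = (\<Prod>n\<in>J. iexp (g n))"
  by (simp add: exp_sum sum_distrib_left)

text \<open>Products of factors of norm at most 1 differ by at most the sum of the differences of
  the factors. Each difference has a cubic part from \<open>geo_char_approx\<close> and a part from
  replacing 1 - V/2 by exp (- V/2), where 128 = 32^2 / 8.\<close>

lemma geo_product_char_approx:
  fixes u :: "nat \<Rightarrow> real"
  assumes J: "finite J" and u: "\<And>n. n \<in> J \<Longrightarrow> u n > 0"
  shows "norm (measure_pmf.expectation (Pi_pmf J 0 (\<lambda>n. geo (u n)))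
             (\<lambda>m. iexp (\<Sum>n\<in>J. geo_rv \<theta> \<tau> (u n) (m n) - geo_mean \<theta> \<tau> (u n)))
           - exp (- (\<Sum>n\<in>J. geo_var \<theta> \<tau> (u n)) / 2))
         \<le> (2560 * (\<bar>\<theta>\<bar> ^ 3 + \<bar>\<tau>\<bar> ^ 3) + 128 * (\<theta>\<^sup>2 + \<tau>\<^sup>2)\<^sup>2) * (\<Sum>n\<in>J. exp (- u n / 2))"
proof -
  let ?z = "\<lambda>n. measure_pmf.expectation (geo (u n)) (\<lambda>m. iexp (geo_rv \<theta> \<tau> (u n) m - geo_mean \<theta> \<tau> (u n)))"
  let ?w = "\<lambda>n. complex_of_real (exp (- (geo_var \<theta> \<tau> (u n) / 2)))"
  have "measure_pmf.expectation (Pi_pmf J 0 (\<lambda>n. geo (u n)))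
             (\<lambda>m. iexp (\<Sum>n\<in>J. geo_rv \<theta> \<tau> (u n) (m n) - geo_mean \<theta> \<tau> (u n))) = (\<Prod>n\<in>J. ?z n)"
    unfolding iexp_sum[OF J] by (intro expectation_prod_Pi_pmf_gen J integrable_geo_iexp)
  moreover have "complex_of_real (exp (- (\<Sum>n\<in>J. geo_var \<theta> \<tau> (u n)) / 2)) = (\<Prod>n\<in>J. ?w n)"
  proof -
    have "- (\<Sum>n\<in>J. geo_var \<theta> \<tau> (u n)) / 2 = (\<Sum>n\<in>J. - (geo_var \<theta> \<tau> (u n) / 2))"
      by (simp add: sum_negf sum_divide_distrib)
    then show ?thesis unfolding exp_sum[OF J] of_real_prod[symmetric] by (simp only: exp_sum[OF J])
  qed
  moreover have "norm ((\<Prod>n\<in>J. ?z n) - (\<Prod>n\<in>J. ?w n)) \<le> (\<Sum>n\<in>J. norm (?z n - ?w n))"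
  proof (rule norm_prod_diff)
    show "norm (?z n) \<le> 1" for n by (rule geo_char_le_1)
    show "norm (?w n) \<le> 1" if "n \<in> J" for n using geo_mean_var_bounds(2)[OF u[OF that]] by simp
  qed
  moreover have "(\<Sum>n\<in>J. norm (?z n - ?w n)) \<le> (\<Sum>n\<in>J. (2560 * (\<bar>\<theta>\<bar> ^ 3 + \<bar>\<tau>\<bar> ^ 3) + 128 * (\<theta>\<^sup>2 + \<tau>\<^sup>2)\<^sup>2) * exp (- u n / 2))"
  proof (intro sum_mono)
    fix n assume n: "n \<in> J"
    let ?V = "geo_var \<theta> \<tau> (u n)" and ?e = "exp (- u n / 2)"
    note V = geo_mean_var_bounds(2,3)[OF u[OF n], of \<theta> \<tau>]
    have "norm (complex_of_real ((1 - ?V / 2) - exp (- (?V / 2)))) \<le> (?V / 2)\<^sup>2 / 2"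
      unfolding norm_of_real using V by (intro abs_one_minus_exp_le) auto
    also have "\<dots> = ?V\<^sup>2 / 8" by (simp add: power2_eq_square)
    also have "\<dots> \<le> (32 * (\<theta>\<^sup>2 + \<tau>\<^sup>2) * ?e)\<^sup>2 / 8" using V by (intro divide_right_mono power_mono) auto
    also have "\<dots> = 128 * (\<theta>\<^sup>2 + \<tau>\<^sup>2)\<^sup>2 * ?e ^ 2" unfolding power_mult_distrib by simp
    also have "\<dots> \<le> 128 * (\<theta>\<^sup>2 + \<tau>\<^sup>2)\<^sup>2 * ?e ^ 1"
      using u[OF n] by (intro mult_left_mono power_decreasing) auto
    finally have 1: "norm (complex_of_real ((1 - ?V / 2) - exp (- (?V / 2)))) \<le> 128 * (\<theta>\<^sup>2 + \<tau>\<^sup>2)\<^sup>2 * ?e" by simp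
    have "?z n - ?w n = (?z n - (1 - ?V / 2)) + complex_of_real ((1 - ?V / 2) - exp (- (?V / 2)))" by simp
    then have "norm (?z n - ?w n) \<le> norm (?z n - (1 - ?V / 2)) + norm (complex_of_real ((1 - ?V / 2) - exp (- (?V / 2))))"
      by (metis norm_triangle_ineq)
    then show "norm (?z n - ?w n) \<le> (2560 * (\<bar>\<theta>\<bar> ^ 3 + \<bar>\<tau>\<bar> ^ 3) + 128 * (\<theta>\<^sup>2 + \<tau>\<^sup>2)\<^sup>2) * ?e"
      using 1 geo_char_approx[OF u[OF n], of \<theta> \<tau>] by (simp add: algebra_simps)
  qed
  ultimately show ?thesis by (simp add: sum_distrib_left)
qed

section \<open>Decay of the characteristic function at bounded frequencies\<close>

lemma one_minus_cos_ge:
  fixes a :: real assumes "\<bar>a\<bar> \<le> 1" shows "1 - cos a \<ge> a\<^sup>2 / 4"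
proof -
  have "cos \<bar>a\<bar> \<le> 1 - \<bar>a\<bar>\<^sup>2 / 4"
  proof (cases "a = 0")
    case False
    define x where "x = \<bar>a\<bar>"
    have x: "0 < x" "x \<le> 1" using False assms by (auto simp: x_def)
    obtain t where t: "0 < t" "t < x" "cos x = (\<Sum>m<4. cos_coeff m * x ^ m) + (cos (t + 1/2 * real 4 * pi) / fact 4) * x ^ 4"
      using Maclaurin_cos_expansion2[of x 4] x by auto
    have "cos (t + 1/2 * real 4 * pi) = cos t" using cos_periodic[of t] by (simp add: algebra_simps)
    then have "cos x = 1 - x\<^sup>2 / 2 + cos t / 24 * x ^ 4"
    proof -
      have "{..<4} = {0, 1, 2, 3 :: nat}" by auto
      with \<open>cos (t + 1/2 * real 4 * pi) = cos t\<close> show ?thesis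
        using t(3) by (simp add: cos_coeff_def fact_numeral)
    qed
    also have "cos t / 24 * x ^ 4 \<le> 1 / 24 * x ^ 4"
      using x by (intro mult_right_mono) auto
    also have "x ^ 4 \<le> x ^ 2" using x by (intro power_decreasing) auto
    finally show ?thesis unfolding x_def[symmetric] using zero_le_power2[of x] by linarith
  qed auto
  then show ?thesis by simp
qed

text \<open>The exact square is (p1 + p2)^2 - 2 p1 p2 (1 - cos a). With d the claimed gain this is
  at most (p1 + p2)^2 - 2 d, which is at most (p1 + p2 - d)^2 because p1 + p2 <= 1.\<close>

lemma norm_two_point_le:
  assumes p: "p1 > 0" "p2 > 0" "p1 + p2 \<le> 1" and a: "\<bar>a\<bar> \<le> 1"
  shows "norm (complex_of_real p1 + complex_of_real p2 * iexp a) \<le> p1 + p2 - p1 * p2 * a\<^sup>2 / 4"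
proof (rule power2_le_imp_le)
  define d where "d = p1 * p2 * a\<^sup>2 / 4"
  have a2: "a\<^sup>2 \<le> 1" using a by (simp add: abs_square_le_1)
  have "(norm (complex_of_real p1 + complex_of_real p2 * iexp a))\<^sup>2 = (p1 + p2 * cos a)\<^sup>2 + (p2 * sin a)\<^sup>2"
    by (simp add: cmod_power2 cis_conv_exp[symmetric] Re_exp Im_exp)
  also have "\<dots> = (p1 + p2)\<^sup>2 - 2 * (p1 * p2 * (1 - cos a))"
    unfolding power_mult_distrib power2_sum cos_squared_eq by (simp add: algebra_simps)
  also have "\<dots> \<le> (p1 + p2)\<^sup>2 - 2 * (p1 * p2 * (a\<^sup>2 / 4))"
    using one_minus_cos_ge[OF a] p by (intro diff_left_mono mult_left_mono) auto
  also have "\<dots> = (p1 + p2)\<^sup>2 - 2 * d" by (simp add: d_def)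
  also have "\<dots> \<le> (p1 + p2)\<^sup>2 - 2 * ((p1 + p2) * d) + d\<^sup>2"
  proof -
    have "(p1 + p2) * d \<le> 1 * d" using p by (intro mult_right_mono) (auto simp: d_def)
    then show ?thesis by (smt (verit) zero_le_power2)
  qed
  also have "\<dots> = (p1 + p2 - d)\<^sup>2" by (simp add: power2_eq_square algebra_simps)
  finally show "(norm (complex_of_real p1 + complex_of_real p2 * iexp a))\<^sup>2 \<le> (p1 + p2 - p1 * p2 * a\<^sup>2 / 4)\<^sup>2"
    by (simp add: d_def)
  have "p1 * p2 * a\<^sup>2 \<le> p1 * 1 * 1" using p a2 by (intro mult_mono) auto
  then have "p1 * p2 * a\<^sup>2 \<le> p1" by (simp only: mult_1_right)
  then show "0 \<le> p1 + p2 - p1 * p2 * a\<^sup>2 / 4" using p by linarith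
qed

text \<open>The two atoms \<open>m = 1\<close> and \<open>m = 2\<close> alone already force the decay.\<close>

lemma geo_char_le_exp:
  assumes \<delta>: "\<delta> > 0" and u: "\<delta> \<le> u" "u \<le> 2 * \<delta>" and \<theta>: "\<bar>\<theta>\<bar> * (2 * \<delta>) \<le> 1"
  shows "norm (measure_pmf.expectation (geo u) (\<lambda>m. iexp (geo_rv \<theta> \<tau> u m)))
           \<le> exp (- ((1 - exp (- \<delta>))\<^sup>2 * exp (- 6 * \<delta>) * \<delta>\<^sup>2 / 4) * \<theta>\<^sup>2)"
proof -
  have u0: "u > 0" using u \<delta> by simp
  define q where "q = exp (- u)"
  have q: "0 < q" "q < 1" using u0 by (auto simp: q_def)
  define p1 p2 where "p1 = (1 - q) * q" and "p2 = (1 - q) * q\<^sup>2"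
  have p: "p1 > 0" "p2 > 0" using q by (auto simp: p1_def p2_def)
  have pmf: "pmf (geo u) m = q ^ m * (1 - q)" for m
    using geo_param(1)[OF u0] by (simp add: q_def)
  let ?f = "\<lambda>m. iexp (geo_rv \<theta> \<tau> u m)"
  let ?a = "\<theta> * u"
  have "\<bar>\<theta>\<bar> * u \<le> \<bar>\<theta>\<bar> * (2 * \<delta>)" using u by (intro mult_left_mono) auto
  then have a1: "\<bar>?a\<bar> \<le> 1" using \<theta> u0 by (simp add: abs_mult)
  have int: "integrable (geo u) (\<lambda>m. indicator A m *\<^sub>R ?f m)" for A
    by (intro measure_pmf.integrable_const_bound[of _ 1]) (auto simp: indicator_def)
  have "measure_pmf.expectation (geo u) ?f =
      measure_pmf.expectation (geo u) (\<lambda>m. indicator {1,2} m *\<^sub>R ?f m + indicator (- {1,2}) m *\<^sub>R ?f m)"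
    by (intro integral_cong_AE) (auto simp: indicator_def)
  also have "\<dots> = measure_pmf.expectation (geo u) (\<lambda>m. indicator {1,2} m *\<^sub>R ?f m) +
       measure_pmf.expectation (geo u) (\<lambda>m. indicator (- {1,2}) m *\<^sub>R ?f m)"
    by (intro Bochner_Integration.integral_add int)
  finally have split: "measure_pmf.expectation (geo u) ?f = \<dots>" .
  have prob12: "measure_pmf.prob (geo u) {1,2} = p1 + p2"
    by (subst measure_measure_pmf_finite) (auto simp: pmf p1_def p2_def power2_eq_square mult_ac simp del: pmf_geometric)
  then have p12: "p1 + p2 \<le> 1" by (metis measure_pmf.prob_le_1)
  have "norm (measure_pmf.expectation (geo u) (\<lambda>m. indicator (- {1,2}) m *\<^sub>R ?f m)) \<le>
      measure_pmf.expectation (geo u) (\<lambda>m. indicator (- {1,2}) m)"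
    by (rule order_trans[OF integral_norm_bound]) (auto simp: indicator_def intro!: integral_mono integrable_geo_iexp measure_pmf.integrable_const_bound[of _ 1])
  also have "\<dots> = 1 - (p1 + p2)"
    using measure_pmf.prob_compl[of "{1,2}" "geo u"] prob12 by (simp add: Compl_eq_Diff_UNIV)
  finally have rest: "norm (measure_pmf.expectation (geo u) (\<lambda>m. indicator (- {1,2}) m *\<^sub>R ?f m)) \<le> 1 - (p1 + p2)" .
  have "measure_pmf.expectation (geo u) (\<lambda>m. indicator {1,2} m *\<^sub>R ?f m) =
      (\<Sum>m\<in>{1,2}. pmf (geo u) m *\<^sub>R (indicator {1,2::nat} m *\<^sub>R ?f m))"
    by (intro integral_measure_pmf) (auto simp: indicator_def split: if_splits)
  also have "\<dots> = p1 * ?f 1 + p2 * ?f 2"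
    by (simp add: pmf p1_def p2_def power2_eq_square scaleR_conv_of_real mult_ac del: pmf_geometric)
  \<comment> \<open>Both atoms are positive, so \<open>\<tau>\<close> sits in the common phase
    \<open>?f 1\<close> and disappears from the norm. Comparing m = 0 with m = 1 would leave it in
    the relative phase.\<close>
  also have "\<dots> = ?f 1 * (p1 + p2 * iexp ?a)"
  proof -
    have "?f 2 = ?f 1 * iexp ?a"
      unfolding exp_add[symmetric] by (simp add: geo_rv_def algebra_simps)
    then show ?thesis by (simp add: algebra_simps)
  qed
  finally have "norm (measure_pmf.expectation (geo u) (\<lambda>m. indicator {1,2} m *\<^sub>R ?f m)) = norm (complex_of_real p1 + p2 * iexp ?a)"
    by (simp add: norm_mult)
  also have "\<dots> \<le> p1 + p2 - p1 * p2 * ?a\<^sup>2 / 4" by (rule norm_two_point_le[OF p p12 a1])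
  finally have "norm (measure_pmf.expectation (geo u) ?f) \<le> 1 + - (p1 * p2 * ?a\<^sup>2 / 4)"
    unfolding split using rest by (intro order_trans[OF norm_triangle_ineq]) linarith
  also have "\<dots> \<le> exp (- (p1 * p2 * ?a\<^sup>2 / 4))" by (rule exp_ge_add_one_self)
  also have "\<dots> \<le> exp (- ((1 - exp (- \<delta>))\<^sup>2 * exp (- 6 * \<delta>) * \<delta>\<^sup>2 / 4) * \<theta>\<^sup>2)"
  proof -
    have "p1 * p2 = (1 - q)\<^sup>2 * q ^ 3" by (simp add: p1_def p2_def power2_eq_square power3_eq_cube)
    moreover have "(1 - exp (- \<delta>))\<^sup>2 \<le> (1 - q)\<^sup>2" using u \<delta> by (intro power_mono) (auto simp: q_def)
    moreover have "q ^ 3 = exp (- 3 * u)" by (simp add: power3_eq_cube q_def flip: exp_add)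
    then have "exp (- 6 * \<delta>) \<le> q ^ 3" using u by simp
    ultimately have "(1 - exp (- \<delta>))\<^sup>2 * exp (- 6 * \<delta>) \<le> p1 * p2" using q by (auto intro!: mult_mono)
    moreover have "\<delta>\<^sup>2 * \<theta>\<^sup>2 \<le> u\<^sup>2 * \<theta>\<^sup>2" using u \<delta> by (intro mult_right_mono power_mono) auto
    then have "\<delta>\<^sup>2 * \<theta>\<^sup>2 \<le> ?a\<^sup>2" by (simp add: power_mult_distrib mult.commute)
    ultimately have "((1 - exp (- \<delta>))\<^sup>2 * exp (- 6 * \<delta>)) * (\<delta>\<^sup>2 * \<theta>\<^sup>2) \<le> (p1 * p2) * ?a\<^sup>2"
      by (rule mult_mono) (use p in auto)
    then show ?thesis by (simp add: mult_ac)
  qed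
  finally show ?thesis .
qed

text \<open>Only the parts in the window from \<delta> to 2 \<delta> are exploited; all other
  factors are bounded by 1. The model will have of order 1 / s parts in the window, and that number
  times \<theta>^2 is a Gaussian exponent at the right scale.\<close>

lemma geo_product_char_le_exp:
  fixes u :: "nat \<Rightarrow> real"
  assumes J: "finite J" and \<delta>: "\<delta> > 0" and \<theta>: "\<bar>\<theta>\<bar> * (2 * \<delta>) \<le> 1"
  shows "norm (measure_pmf.expectation (Pi_pmf J 0 (\<lambda>n. geo (u n)))
             (\<lambda>m. iexp (\<Sum>n\<in>J. geo_rv \<theta> \<tau> (u n) (m n))))
     \<le> exp (- ((1 - exp (- \<delta>))\<^sup>2 * exp (- 6 * \<delta>) * \<delta>\<^sup>2 / 4) * \<theta>\<^sup>2 * real (card {n \<in> J. \<delta> \<le> u n \<and> u n \<le> 2 * \<delta>}))"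
proof -
  let ?z = "\<lambda>n. measure_pmf.expectation (geo (u n)) (\<lambda>m. iexp (geo_rv \<theta> \<tau> (u n) m))"
  let ?c = "- ((1 - exp (- \<delta>))\<^sup>2 * exp (- 6 * \<delta>) * \<delta>\<^sup>2 / 4) * \<theta>\<^sup>2"
  let ?K = "{n \<in> J. \<delta> \<le> u n \<and> u n \<le> 2 * \<delta>}"
  have "measure_pmf.expectation (Pi_pmf J 0 (\<lambda>n. geo (u n)))
             (\<lambda>m. iexp (\<Sum>n\<in>J. geo_rv \<theta> \<tau> (u n) (m n))) = (\<Prod>n\<in>J. ?z n)"
    unfolding iexp_sum[OF J] by (intro expectation_prod_Pi_pmf_gen J integrable_geo_iexp)
  then have "norm (measure_pmf.expectation (Pi_pmf J 0 (\<lambda>n. geo (u n)))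
             (\<lambda>m. iexp (\<Sum>n\<in>J. geo_rv \<theta> \<tau> (u n) (m n)))) = (\<Prod>n\<in>J. norm (?z n))"
    by (simp only: prod_norm)
  also have "\<dots> \<le> (\<Prod>n\<in>J. if n \<in> ?K then exp ?c else 1)"
  proof (intro prod_mono conjI norm_ge_zero)
    fix n assume n: "n \<in> J"
    show "norm (?z n) \<le> (if n \<in> ?K then exp ?c else 1)"
    proof (cases "n \<in> ?K")
      case True
      then have "norm (?z n) \<le> exp ?c" by (intro geo_char_le_exp \<delta> \<theta>) auto
      then show ?thesis using True by simp
    next
      case False
      then show ?thesis using geo_char_le_1 by (simp only: if_False)
    qed
  qed
  also have "\<dots> = (\<Prod>n\<in>?K. exp ?c)"
    using J by (subst prod.inter_filter) (auto intro!: prod.cong)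
  also have "\<dots> = exp (?c * real (card ?K))" unfolding prod_constant by (simp only: exp_of_nat2_mult)
  finally show ?thesis .
qed

section \<open>Riemann sums over the parts\<close>

text \<open>Monotonicity keeps the difference between Riemann sum and rescaled integral below
  \<open>h 0\<close> for every mesh size, an error uniform in the scale. \<open>A\<close> is the
  improper integral.\<close>

definition profile :: "(real \<Rightarrow> real) \<Rightarrow> real \<Rightarrow> bool" where
  "profile h A \<longleftrightarrow> (\<forall>x y. 0 \<le> x \<longrightarrow> x \<le> y \<longrightarrow> h y \<le> h x) \<and> (\<forall>x\<ge>0. h x \<ge> 0) \<and> continuous_on {0..} h \<and>
     ((\<lambda>X. integral {0..X} h) \<longlongrightarrow> A) at_top"

lemma profileD:
  assumes "profile h A"
  shows "0 \<le> x \<Longrightarrow> x \<le> y \<Longrightarrow> h y \<le> h x" and "0 \<le> x \<Longrightarrow> h x \<ge> 0"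
    and "continuous_on {0..} h" and "((\<lambda>X. integral {0..X} h) \<longlongrightarrow> A) at_top"
  using assms unfolding profile_def by blast+

lemma profile_sum_integral:
  assumes "profile h A" "\<kappa> > 0"
  shows "(1 / \<kappa>) * integral {0..\<kappa> * real n} h \<le> (\<Sum>k\<le>n. h (\<kappa> * real k))"
    and "(\<Sum>k\<le>n. h (\<kappa> * real k)) \<le> (1 / \<kappa>) * integral {0..\<kappa> * real n} h + h 0"
proof -
  interpret antimono_fun_sum_integral_diff "\<lambda>t. h (\<kappa> * t)"
  proof
    show "h (\<kappa> * y) \<le> h (\<kappa> * x)" if "0 \<le> x" "x \<le> y" for x y
    proof -
      have "0 \<le> \<kappa> * x" "\<kappa> * x \<le> \<kappa> * y" using that assms(2) by (auto intro: mult_left_mono)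
      then show ?thesis by (rule profileD(1)[OF assms(1)])
    qed
    show "h (\<kappa> * x) \<ge> 0" if "0 \<le> x" for x
      using mult_nonneg_nonneg[OF less_imp_le[OF assms(2)] that] by (rule profileD(2)[OF assms(1)])
    show "continuous_on {0..} (\<lambda>t. h (\<kappa> * t))"
      by (intro continuous_on_compose2[OF profileD(3)[OF assms(1)]] continuous_intros) (use assms(2) in auto)
  qed
  have cont: "continuous_on {0..\<kappa> * real n} h"
    by (rule continuous_on_subset[OF profileD(3)[OF assms(1)]]) auto
  have "((\<lambda>t. h (\<kappa> * t + 0)) has_integral (1 / \<bar>\<kappa>\<bar>) *\<^sub>R integral {0..\<kappa> * real n} h) ((\<lambda>x. (1 / \<kappa>) *\<^sub>R x + - ((1 / \<kappa>) *\<^sub>R 0)) ` {0..\<kappa> * real n})"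
    using has_integral_affinity[of h "integral {0..\<kappa> * real n} h" 0 "\<kappa> * real n" \<kappa> 0] assms
      integrable_integral[OF integrable_continuous_real[OF cont]] by simp
  moreover have "(\<lambda>x. (1 / \<kappa>) *\<^sub>R x + - ((1 / \<kappa>) *\<^sub>R 0)) ` {0..\<kappa> * real n} = {0..real n}"
  proof (intro equalityI subsetI)
    fix y assume "y \<in> {0..real n}"
    then have "y = (1 / \<kappa>) *\<^sub>R (\<kappa> * y) + - ((1 / \<kappa>) *\<^sub>R 0)" "\<kappa> * y \<in> {0..\<kappa> * real n}"
      using assms(2) by (auto intro: mult_left_mono)
    then show "y \<in> (\<lambda>x. (1 / \<kappa>) *\<^sub>R x + - ((1 / \<kappa>) *\<^sub>R 0)) ` {0..\<kappa> * real n}" by (rule image_eqI)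
  next
    fix y assume "y \<in> (\<lambda>x. (1 / \<kappa>) *\<^sub>R x + - ((1 / \<kappa>) *\<^sub>R 0)) ` {0..\<kappa> * real n}"
    then obtain x where "x \<in> {0..\<kappa> * real n}" "y = x / \<kappa>" by auto
    then show "y \<in> {0..real n}" using assms(2) by (auto simp: pos_divide_le_eq mult.commute)
  qed
  ultimately have int: "integral {0..real n} (\<lambda>t. h (\<kappa> * t)) = (1 / \<kappa>) * integral {0..\<kappa> * real n} h"
    using assms(2) by (intro integral_unique) (simp only: add_0_right real_scaleR_def abs_of_pos)
  show "(1 / \<kappa>) * integral {0..\<kappa> * real n} h \<le> (\<Sum>k\<le>n. h (\<kappa> * real k))"
    using sum_integral_diff_series_nonneg[of n] by (simp add: sum_integral_diff_series_def int)
  show "(\<Sum>k\<le>n. h (\<kappa> * real k)) \<le> (1 / \<kappa>) * integral {0..\<kappa> * real n} h + h 0"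
    using sum_integral_diff_series_antimono[of 0 n] by (simp add: sum_integral_diff_series_def int)
qed

lemma profile_integral_le:
  assumes "profile h A" "X \<ge> 0" shows "integral {0..X} h \<le> A"
proof (rule tendsto_lowerbound)
  show "((\<lambda>X. integral {0..X} h) \<longlongrightarrow> A) at_top" by (rule profileD(4)[OF assms(1)])
  have int: "h integrable_on {0..Y}" for Y
    by (intro integrable_continuous_real continuous_on_subset[OF profileD(3)[OF assms(1)]]) auto
  show "\<forall>\<^sub>F Y in at_top. integral {0..X} h \<le> integral {0..Y} h"
    using eventually_ge_at_top[of X]
  proof eventually_elim
    case (elim Y)
    then show ?case by (intro integral_subset_le int ballI profileD(2)[OF assms(1)]) auto
  qed
qed auto

text \<open>The sum is compared with one over multiples of \<alpha>, with indices shifted by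
  \<open>n0\<close> where \<open>\<alpha> * n0 >= C\<close>: since \<open>h\<close> decreases, this
  absorbs the deviation of \<open>len\<close>. The shift costs at most \<open>n0 + 1\<close> terms
  and the missing indices at most \<open>E\<close>, each bounded by \<open>h 0\<close> whatever
  \<open>s\<close> is. The final 1 in \<open>D\<close> pays for truncating at
  \<open>M\<close>.\<close>

lemma profile_sum_approx:
  fixes I :: "nat set" and len :: "nat \<Rightarrow> real"
  assumes h: "profile h A" and \<alpha>: "\<alpha> > 0" and I: "I \<subseteq> {1..}" "finite ({1..} - I)"
    and len: "\<And>n. n \<ge> 1 \<Longrightarrow> \<bar>len n - \<alpha> * real n\<bar> \<le> C" "\<And>n. n \<in> I \<Longrightarrow> len n > 0"
  shows "\<exists>D. \<forall>s>0. \<forall>\<^sub>F M in sequentially. \<bar>(\<Sum>n\<in>{n \<in> I. n \<le> M}. h (s * len n)) - A / (\<alpha> * s)\<bar> \<le> D"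
proof -
  have dec: "h y \<le> h x" if "0 \<le> x" "x \<le> y" for x y using profileD(1)[OF h that] .
  have nonneg: "h x \<ge> 0" if "x \<ge> 0" for x using profileD(2)[OF h that] .
  define n0 where "n0 = nat \<lceil>C / \<alpha>\<rceil>"
  have n0: "\<alpha> * real n0 \<ge> C"
    using \<alpha> real_nat_ceiling_ge[of "C / \<alpha>"] by (simp add: n0_def field_simps)
  define E where "E = card ({1..} - I)"
  define D where "D = (real n0 + 1 + real E) * h 0 + 1"
  have "\<forall>\<^sub>F M in sequentially. \<bar>(\<Sum>n\<in>{n \<in> I. n \<le> M}. h (s * len n)) - A / (\<alpha> * s)\<bar> \<le> D" if s: "s > 0" for s
  proof -
    define \<kappa> where "\<kappa> = s * \<alpha>"
    have \<kappa>: "\<kappa> > 0" using s \<alpha> by (simp add: \<kappa>_def)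
    have F: "0 \<le> h (\<kappa> * real k)" "h (\<kappa> * real k) \<le> h 0" for k
      using \<kappa> by (intro nonneg dec; simp)+
    have upper: "(\<Sum>n\<in>{n \<in> I. n \<le> M}. h (s * len n)) \<le> A / (\<alpha> * s) + D" for M
    proof -
      let ?J1 = "{n \<in> I. n \<le> M \<and> n < n0}" and ?J2 = "{n \<in> I. n \<le> M \<and> n \<ge> n0}"
      have "{n \<in> I. n \<le> M} = ?J1 \<union> ?J2" by auto
      then have "(\<Sum>n\<in>{n \<in> I. n \<le> M}. h (s * len n)) = (\<Sum>n\<in>?J1 \<union> ?J2. h (s * len n))" by (rule arg_cong)
      also have "\<dots> = (\<Sum>n\<in>?J1. h (s * len n)) + (\<Sum>n\<in>?J2. h (s * len n))"
        by (intro sum.union_disjoint) auto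
      finally have split: "(\<Sum>n\<in>{n \<in> I. n \<le> M}. h (s * len n)) = \<dots>" .
      have "(\<Sum>n\<in>?J1. h (s * len n)) \<le> (\<Sum>n\<in>?J1. h 0)"
      proof (intro sum_mono dec)
        show "0 \<le> s * len n" if "n \<in> ?J1" for n using len(2)[of n] s that by simp
      qed simp
      also have "\<dots> = real (card ?J1) * h 0" by simp
      also have "\<dots> \<le> real n0 * h 0"
      proof (intro mult_right_mono nonneg)
        have "card ?J1 \<le> card {..<n0}" by (intro card_mono) auto
        then show "real (card ?J1) \<le> real n0" by simp
      qed simp
      finally have 1: "(\<Sum>n\<in>?J1. h (s * len n)) \<le> real n0 * h 0" .
      have "(\<Sum>n\<in>?J2. h (s * len n)) \<le> (\<Sum>n\<in>?J2. h (\<kappa> * real (n - n0)))"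
      proof (intro sum_mono dec)
        fix n assume n: "n \<in> ?J2"
        then have "n \<ge> 1" using I by auto
        then have "len n \<ge> \<alpha> * real n - \<alpha> * real n0" using len(1)[of n] n0 by linarith
        then have "s * (\<alpha> * real n - \<alpha> * real n0) \<le> s * len n" using s by (intro mult_left_mono) auto
        moreover have "real (n - n0) = real n - real n0" using n by (simp add: of_nat_diff)
        ultimately show "\<kappa> * real (n - n0) \<le> s * len n" by (simp add: \<kappa>_def algebra_simps)
        show "0 \<le> \<kappa> * real (n - n0)" using \<kappa> by simp
      qed
      also have "\<dots> = (\<Sum>k\<in>(\<lambda>n. n - n0) ` ?J2. h (\<kappa> * real k))"
        by (rule sum.reindex_cong[symmetric, OF _ refl refl]) (auto simp: inj_on_def)
      also have "\<dots> \<le> (\<Sum>k\<in>{..M}. h (\<kappa> * real k))"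
        by (rule sum_mono2) (auto intro: F)
      also have "\<dots> \<le> (1 / \<kappa>) * integral {0..\<kappa> * real M} h + h 0"
        by (rule profile_sum_integral(2)[OF h \<kappa>])
      also have "\<dots> \<le> (1 / \<kappa>) * A + h 0"
        by (intro add_right_mono mult_left_mono profile_integral_le[OF h]) (use \<kappa> in auto)
      also have "(1 / \<kappa>) * A = A / (\<alpha> * s)" by (simp add: \<kappa>_def mult.commute)
      finally have 2: "(\<Sum>n\<in>?J2. h (s * len n)) \<le> A / (\<alpha> * s) + h 0" .
      have "D = real n0 * h 0 + h 0 + real E * h 0 + 1" by (simp add: D_def algebra_simps)
      moreover have "real E * h 0 \<ge> 0" by (intro mult_nonneg_nonneg nonneg) auto
      ultimately show ?thesis using 1 2 unfolding split by linarith
    qed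
    have lower: "(\<Sum>n\<in>{n \<in> I. n \<le> M}. h (s * len n)) \<ge> (1 / \<kappa>) * integral {0..\<kappa> * real M} h - (D - 1)" for M
    proof -
      let ?J = "{n \<in> I. n \<le> M}" and ?F = "\<lambda>k. h (\<kappa> * real k)"
      have "(1 / \<kappa>) * integral {0..\<kappa> * real M} h \<le> (\<Sum>k\<le>M. ?F k)"
        by (rule profile_sum_integral(1)[OF h \<kappa>])
      also have "\<dots> \<le> (\<Sum>k\<in>{..n0} \<union> {n0+1..n0+M}. ?F k)"
        by (rule sum_mono2) (auto intro: F)
      also have "\<dots> = (\<Sum>k\<in>{..n0}. ?F k) + (\<Sum>k\<in>{n0+1..n0+M}. ?F k)"
        by (intro sum.union_disjoint) auto
      finally have 0: "(1 / \<kappa>) * integral {0..\<kappa> * real M} h \<le> (\<Sum>k\<in>{..n0}. ?F k) + (\<Sum>k\<in>{n0+1..n0+M}. ?F k)" .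
      have "(\<Sum>k\<in>{..n0}. ?F k) \<le> (\<Sum>k\<in>{..n0}. h 0)" by (intro sum_mono F)
      also have "\<dots> = (real n0 + 1) * h 0" by simp
      finally have 1: "(\<Sum>k\<in>{..n0}. ?F k) \<le> (real n0 + 1) * h 0" .
      have "(\<Sum>k\<in>{n0+1..n0+M}. ?F k) = (\<Sum>n\<in>{1..M}. ?F (n + n0))"
        using sum.shift_bounds_cl_nat_ivl[of ?F 1 n0 M] by (simp add: add.commute)
      also have "{1..M} = ?J \<union> ({1..M} - I)" using I by auto
      also have "(\<Sum>n\<in>?J \<union> ({1..M} - I). ?F (n + n0)) = (\<Sum>n\<in>?J. ?F (n + n0)) + (\<Sum>n\<in>{1..M} - I. ?F (n + n0))"
        by (intro sum.union_disjoint) auto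
      finally have split: "(\<Sum>k\<in>{n0+1..n0+M}. ?F k) = \<dots>" .
      have "(\<Sum>n\<in>{1..M} - I. ?F (n + n0)) \<le> (\<Sum>n\<in>{1..M} - I. h 0)" by (intro sum_mono F)
      also have "\<dots> = real (card ({1..M} - I)) * h 0" by simp
      also have "\<dots> \<le> real E * h 0"
      proof (intro mult_right_mono nonneg)
        have "card ({1..M} - I) \<le> E" unfolding E_def by (intro card_mono I(2)) auto
        then show "real (card ({1..M} - I)) \<le> real E" by simp
      qed simp
      finally have 2: "(\<Sum>n\<in>{1..M} - I. ?F (n + n0)) \<le> real E * h 0" .
      have 3: "(\<Sum>n\<in>?J. ?F (n + n0)) \<le> (\<Sum>n\<in>?J. h (s * len n))"
      proof (intro sum_mono dec)
        fix n assume n: "n \<in> ?J"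
        then have "n \<ge> 1" using I by auto
        then have "len n \<le> \<alpha> * real n + \<alpha> * real n0" using len(1)[of n] n0 by linarith
        then have "s * len n \<le> s * (\<alpha> * real n + \<alpha> * real n0)" using s by (intro mult_left_mono) auto
        then show "s * len n \<le> \<kappa> * real (n + n0)" by (simp add: \<kappa>_def algebra_simps)
        show "0 \<le> s * len n" using len(2)[of n] n s by simp
      qed
      have "D = (real n0 + 1) * h 0 + real E * h 0 + 1" by (simp add: D_def algebra_simps)
      then show ?thesis using 0 1 2 3 split by linarith
    qed
    have "filterlim (\<lambda>M. \<kappa> * real M) at_top sequentially"
      using \<kappa> by (intro filterlim_tendsto_pos_mult_at_top[OF tendsto_const _ filterlim_real_sequentially])
    then have "(\<lambda>M. (1 / \<kappa>) * integral {0..\<kappa> * real M} h) \<longlonglongrightarrow> (1 / \<kappa>) * A"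
      by (intro tendsto_mult tendsto_const filterlim_compose[OF profileD(4)[OF h]])
    then have "\<forall>\<^sub>F M in sequentially. (1 / \<kappa>) * integral {0..\<kappa> * real M} h > (1 / \<kappa>) * A - 1"
      by (rule order_tendstoD) simp
    then show ?thesis
    proof eventually_elim
      case (elim M)
      have eq: "A / (\<alpha> * s) = (1 / \<kappa>) * A" by (simp add: \<kappa>_def mult.commute)
      show ?case using elim upper[of M, unfolded eq] lower[of M] unfolding eq abs_le_iff by linarith
    qed
  qed
  then show ?thesis by blast
qed

lemma profile_antiderivative:
  assumes "\<And>x y. 0 \<le> x \<Longrightarrow> x \<le> y \<Longrightarrow> h y \<le> h x" "\<And>x. x \<ge> 0 \<Longrightarrow> h x \<ge> 0"
    and H: "\<And>x. (H has_real_derivative h x) (at x)" and c: "\<And>x. isCont h x" and "(H \<longlongrightarrow> L) at_top"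
  shows "profile h (L - H 0)"
  unfolding profile_def
proof (intro conjI allI impI)
  show "continuous_on {0..} h" using c by (simp add: continuous_at_imp_continuous_on)
  have "\<forall>\<^sub>F X in at_top. H X - H 0 = integral {0..X} h"
    using eventually_ge_at_top[of 0]
  proof eventually_elim
    case (elim X)
    have "(h has_integral H X - H 0) {0..X}"
      using elim H by (intro fundamental_theorem_of_calculus)
        (auto simp: has_real_derivative_iff_has_vector_derivative[symmetric] intro: DERIV_subset)
    then show ?case by (simp add: integral_unique)
  qed
  moreover have "((\<lambda>X. H X - H 0) \<longlongrightarrow> L - H 0) at_top" by (intro tendsto_intros assms)
  ultimately show "((\<lambda>X. integral {0..X} h) \<longlongrightarrow> L - H 0) at_top" by (rule Lim_transform_eventually[rotated])
qed (use assms in auto)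

section \<open>The profiles that occur in means, variances and error terms\<close>

lemma profile_exp: "c > 0 \<Longrightarrow> profile (\<lambda>u. exp (- c * u)) (1 / c)"
proof -
  assume c: "c > 0"
  have "profile (\<lambda>u. exp (- c * u)) (0 - (- exp (- c * 0) / c))"
  proof (rule profile_antiderivative[where H = "\<lambda>u. - exp (- c * u) / c"])
    show "((\<lambda>u. - exp (- c * u) / c) has_real_derivative exp (- c * x)) (at x)" for x
      using c by (auto intro!: derivative_eq_intros)
    show "((\<lambda>u. - exp (- c * u) / c) \<longlongrightarrow> 0) at_top" using c by real_asymp
  qed (use c in auto)
  then show ?thesis by simp
qed

text \<open>The covariance involves u exp (- u), which is not monotone. It is represented as the
  difference of this profile and exp (- u).\<close>

lemma profile_linear_exp: "profile (\<lambda>u. (1 + u) * exp (- u)) 2"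
proof -
  have "profile (\<lambda>u. (1 + u) * exp (- u)) (0 - (- (2 + 0) * exp (- 0)))"
  proof (rule profile_antiderivative[where H = "\<lambda>u. - (2 + u) * exp (- u)"])
    show "((\<lambda>u. - (2 + u) * exp (- u)) has_real_derivative (1 + x) * exp (- x)) (at x)" for x :: real
      by (auto intro!: derivative_eq_intros simp: algebra_simps)
    show "((\<lambda>u::real. - (2 + u) * exp (- u)) \<longlongrightarrow> 0) at_top" by real_asymp
    fix x y :: real assume xy: "0 \<le> x" "x \<le> y"
    show "(1 + y) * exp (- y) \<le> (1 + x) * exp (- x)"
    proof (rule DERIV_nonpos_imp_nonincreasing[OF xy(2)])
      fix u assume "x \<le> u" "u \<le> y"
      then show "\<exists>d. ((\<lambda>u. (1 + u) * exp (- u)) has_real_derivative d) (at u) \<and> d \<le> 0"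
        using xy by (intro exI[of _ "- u * exp (- u)"] conjI)
          (auto intro!: derivative_eq_intros simp: algebra_simps)
    qed
  qed auto
  then show ?thesis by simp
qed

lemma nn_integral_power_exp:
  assumes "c > 0"
  shows "(\<integral>\<^sup>+u. ennreal (u ^ p * exp (- c * u)) * indicator {0..} u \<partial>lborel) = ennreal (fact p / c ^ Suc p)"
proof -
  have "ennreal (fact p) = (\<integral>\<^sup>+x. ennreal (x ^ p * exp (- x)) * indicator {0..} x \<partial>lborel)"
    unfolding nn_intergal_power_times_exp_Ici by simp
  also have "\<dots> = ennreal c * (\<integral>\<^sup>+u. ennreal ((0 + c * u) ^ p * exp (- (0 + c * u))) * indicator {0..} (0 + c * u) \<partial>lborel)"
    using assms by (subst nn_integral_real_affine[of _ c 0]) auto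
  also have "\<dots> = ennreal c * (\<integral>\<^sup>+u. ennreal (c ^ p) * (ennreal (u ^ p * exp (- c * u)) * indicator {0..} u) \<partial>lborel)"
  proof (rule arg_cong2[of _ _ _ _ "(*)", OF refl], rule nn_integral_cong)
    fix u :: real
    have "(c * u) ^ p * exp (- (c * u)) = c ^ p * (u ^ p * exp (- c * u))" by (simp add: power_mult_distrib)
    then show "ennreal ((0 + c * u) ^ p * exp (- (0 + c * u))) * indicator {0..} (0 + c * u) =
        ennreal (c ^ p) * (ennreal (u ^ p * exp (- c * u)) * indicator {0..} u)"
      using assms by (cases "u \<ge> 0") (simp_all add: ennreal_mult zero_le_mult_iff mult.assoc)
  qed
  also have "\<dots> = ennreal (c ^ Suc p) * (\<integral>\<^sup>+u. ennreal (u ^ p * exp (- c * u)) * indicator {0..} u \<partial>lborel)"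
    using assms by (subst nn_integral_cmult) (auto simp: mult.assoc[symmetric] simp flip: ennreal_mult)
  finally have "ennreal (1 / c ^ Suc p) * ennreal (fact p) =
      ennreal (1 / c ^ Suc p) * (ennreal (c ^ Suc p) * (\<integral>\<^sup>+u. ennreal (u ^ p * exp (- c * u)) * indicator {0..} u \<partial>lborel))"
    by (rule arg_cong)
  also have "\<dots> = (\<integral>\<^sup>+u. ennreal (u ^ p * exp (- c * u)) * indicator {0..} u \<partial>lborel)"
    using assms unfolding mult.assoc[symmetric] ennreal_mult[symmetric, OF divide_nonneg_nonneg zero_le_power]
    by (subst ennreal_mult[symmetric]) auto
  finally show ?thesis using assms by (simp flip: ennreal_mult)
qed

text \<open>Termwise integration of a nonnegative series by monotone convergence; each term is a
  Gamma integral, p! / (k + 1)^(p + 1). The expansion is asked for at u > 0 only, since at 0 the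
  series may differ from the continuous extension.\<close>

lemma profile_series:
  assumes dec: "\<And>x y. 0 \<le> x \<Longrightarrow> x \<le> y \<Longrightarrow> h y \<le> h x" and nonneg: "\<And>x. x \<ge> 0 \<Longrightarrow> h x \<ge> 0"
    and cont: "continuous_on {0..} h" and a: "\<And>k. a k \<ge> 0"
    and ser: "\<And>u. u > 0 \<Longrightarrow> (\<lambda>k. a k * (u ^ p * exp (- real (Suc k) * u))) sums h u"
    and A: "(\<lambda>k. a k * (fact p / real (Suc k) ^ Suc p)) sums A"
  shows "profile h A"
proof -
  define g where "g u = h u * indicator {0..} u" for u
  have cI: "continuous_on {0..X} h" for X by (rule continuous_on_subset[OF cont]) auto
  have meas [measurable]: "g \<in> borel_measurable borel"
    using borel_measurable_continuous_on_indicator[OF _ cont] unfolding g_def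
    by (simp add: mult.commute)
  have A0: "A \<ge> 0" using A a by (intro sums_le[OF _ sums_zero A]) auto
  have "(\<integral>\<^sup>+u. ennreal (g u) \<partial>lborel) = (\<integral>\<^sup>+u. (\<Sum>k. ennreal (a k) * (ennreal (u ^ p * exp (- real (Suc k) * u)) * indicator {0..} u)) \<partial>lborel)"
  proof (rule nn_integral_cong_AE)
    show "AE u in lborel. ennreal (g u) = (\<Sum>k. ennreal (a k) * (ennreal (u ^ p * exp (- real (Suc k) * u)) * indicator {0..} u))"
      using AE_lborel_singleton[of 0]
    proof eventually_elim
      case (elim u)
      show ?case
      proof (cases "u > 0")
        case True
        have "ennreal (h u) = (\<Sum>k. ennreal (a k * (u ^ p * exp (- real (Suc k) * u))))"
          using ser[OF True] a True by (subst suminf_ennreal_eq[symmetric, OF _ ser[OF True]]) auto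
        then show ?thesis using True a by (simp add: g_def ennreal_mult)
      qed (use elim in \<open>simp add: g_def\<close>)
    qed
  qed
  also have "\<dots> = (\<Sum>k. \<integral>\<^sup>+u. ennreal (a k) * (ennreal (u ^ p * exp (- real (Suc k) * u)) * indicator {0..} u) \<partial>lborel)"
    by (rule nn_integral_suminf) measurable
  also have "\<dots> = (\<Sum>k. ennreal (a k) * ennreal (fact p / real (Suc k) ^ Suc p))"
  proof (rule arg_cong[where f = suminf], rule ext)
    fix k
    show "(\<integral>\<^sup>+u. ennreal (a k) * (ennreal (u ^ p * exp (- real (Suc k) * u)) * indicator {0..} u) \<partial>lborel) =
         ennreal (a k) * ennreal (fact p / real (Suc k) ^ Suc p)"
      by (subst nn_integral_cmult) (measurable, simp only: nn_integral_power_exp of_nat_0_less_iff zero_less_Suc)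
  qed
  also have "\<dots> = (\<Sum>k. ennreal (a k * (fact p / real (Suc k) ^ Suc p)))"
    using a by (intro suminf_cong ennreal_mult[symmetric]) auto
  also have "\<dots> = ennreal A"
    by (rule suminf_ennreal_eq[OF _ A]) (use a in auto)
  finally have nn: "(\<integral>\<^sup>+u. ennreal (g u) \<partial>lborel) = ennreal A" .
  have "has_bochner_integral lborel g A"
  proof (rule has_bochner_integral_nn_integral[OF _ _ A0 nn])
    show "AE u in lborel. 0 \<le> g u" by (auto simp: g_def indicator_def nonneg)
  qed simp
  then have int: "integrable lborel g" "(\<integral>u. g u \<partial>lborel) = A" by (auto simp: has_bochner_integral_iff)
  have "((\<lambda>X. \<integral>u. indicator {..X} u *\<^sub>R g u \<partial>lborel) \<longlongrightarrow> A) at_top"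
    using tendsto_integral_at_top[OF _ int(1)] int(2) by simp
  moreover have "(\<integral>u. indicator {..X} u *\<^sub>R g u \<partial>lborel) = integral {0..X} h" for X
  proof -
    have "(\<lambda>u. indicator {..X} u *\<^sub>R g u) = (\<lambda>u. indicator {0..X} u *\<^sub>R h u)"
      by (auto simp: g_def indicator_def)
    moreover have "set_integrable lborel {0..X} h"
      by (rule borel_integrable_atLeastAtMost'[OF cI])
    then have "(LINT u:{0..X}|lborel. h u) = integral {0..X} h"
      by (rule set_borel_integral_eq_integral(2))
    ultimately show ?thesis by (simp add: set_lebesgue_integral_def)
  qed
  ultimately have "((\<lambda>X. integral {0..X} h) \<longlongrightarrow> A) at_top" by simp
  then show ?thesis using dec nonneg cont unfolding profile_def by blast
qed

text \<open>The values at \<open>0\<close> are the continuous extensions; the quotients themselves would give \<open>0\<close>.\<close>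

definition bose :: "real \<Rightarrow> real" where
  "bose u = (if u = 0 then 1 else u * exp (- u) / (1 - exp (- u)))"

definition bose_var :: "real \<Rightarrow> real" where
  "bose_var u = (if u = 0 then 1 else geo_svar u)"

lemma continuous_on_atLeast_0I:
  fixes h g :: "real \<Rightarrow> real"
  assumes "\<And>u. u > 0 \<Longrightarrow> isCont g u" "\<And>u. u > 0 \<Longrightarrow> h u = g u" "(g \<longlongrightarrow> h 0) (at_right 0)"
  shows "continuous_on {0..} h"
  unfolding continuous_on_eq_continuous_within
proof
  fix u :: real assume "u \<in> {0..}"
  then consider "u = 0" | "u > 0" by fastforce
  then show "continuous (at u within {0..}) h"
  proof cases
    case 1
    have "(h \<longlongrightarrow> h 0) (at_right 0)"
      by (rule Lim_transform_eventually[OF assms(3)]) (auto simp: eventually_at_filter assms(2))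
    then have "(h \<longlongrightarrow> h 0) (at 0 within {0..})"
      by (simp add: at_within_Ici_at_right)
    then show ?thesis using 1 by (simp add: continuous_within)
  next
    case 2
    have "\<forall>\<^sub>F x in nhds u. g x = h x"
      using eventually_nhds_in_open[of "{0<..}" u] 2 by (auto elim!: eventually_mono simp: assms(2))
    then have "isCont h u" using assms(1)[OF 2] isCont_cong[of g h u] by simp
    then show ?thesis by (rule continuous_at_imp_continuous_at_within)
  qed
qed

lemma one_minus_exp_pos: "u > 0 \<Longrightarrow> 1 - exp (- u) > (0::real)"
  by simp

text \<open>In the form u / (exp u - 1), \<open>bose\<close> is the reciprocal slope of the chord of
  exp from 0 to u, and by convexity that slope increases.\<close>

lemma bose_antimono: assumes "0 \<le> x" "x \<le> y" shows "bose y \<le> bose x"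
proof (cases "x = 0")
  case True
  have "y * exp (- y) \<le> 1 - exp (- y)"
  proof -
    have "(y + 1) * exp (- y) \<le> exp y * exp (- y)"
      using exp_ge_add_one_self[of y] by (intro mult_right_mono) (auto simp: add.commute)
    then show ?thesis by (simp add: exp_minus algebra_simps)
  qed
  then have "y > 0 \<Longrightarrow> y * exp (- y) / (1 - exp (- y)) \<le> 1" using one_minus_exp_pos[of y] by (simp add: pos_divide_le_eq)
  then show ?thesis using True assms by (auto simp: bose_def)
next
  case False
  then have xy: "0 < x" "0 < y" using assms by auto
  have conv: "exp x \<le> (x / y) * exp y + (1 - x / y) * exp 0"
    using convex_onD[OF exp_convex, of "x / y" 0 y] xy assms by (simp add: algebra_simps)
  have ex: "bose u = u / (exp u - 1)" if "u > 0" for u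
  proof -
    have "u * exp (- u) / (1 - exp (- u)) = (u * exp (- u) * exp u) / ((1 - exp (- u)) * exp u)" by simp
    also have "\<dots> = u / (exp u - 1)" by (simp add: algebra_simps exp_minus)
    finally show ?thesis using that by (simp add: bose_def)
  qed
  have "y * (exp x - 1) \<le> x * (exp y - 1)"
  proof -
    have "y * exp x \<le> y * ((x / y) * exp y + (1 - x / y) * exp 0)" using conv xy by (intro mult_left_mono) auto
    also have "\<dots> = x * exp y + (y - x)" using xy by (simp add: field_simps)
    finally show ?thesis by (simp add: algebra_simps)
  qed
  then show ?thesis using xy unfolding ex[OF xy(1)] ex[OF xy(2)] by (simp add: frac_le_eq divide_le_cancel field_simps)
qed

lemma bose_nonneg: "u \<ge> 0 \<Longrightarrow> bose u \<ge> 0"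
  by (auto simp: bose_def intro!: divide_nonneg_nonneg)

lemma exp_minus_Suc_mult: "exp (- real (Suc k) * u) = exp (- u) * exp (- u) ^ k"
proof -
  have "exp (- u) ^ k = exp (real k * - u)" by (rule exp_of_nat_mult[symmetric])
  then show ?thesis by (simp add: algebra_simps flip: exp_add)
qed

text \<open>Expanding the geometric series gives the terms u exp (- (k + 1) u), with integrals 1 /
  (k + 1)^2.\<close>

lemma profile_bose: "profile bose (pi\<^sup>2 / 6)"
proof (rule profile_series[where a = "\<lambda>_. 1" and p = 1])
  show "continuous_on {0..} bose"
  proof (rule continuous_on_atLeast_0I[where g = "\<lambda>u. u * exp (- u) / (1 - exp (- u))"])
    show "((\<lambda>u::real. u * exp (- u) / (1 - exp (- u))) \<longlongrightarrow> bose 0) (at_right 0)"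
      unfolding bose_def by simp real_asymp
  qed (auto intro!: continuous_intros simp: bose_def)
  show "(\<lambda>k. 1 * (u ^ 1 * exp (- real (Suc k) * u))) sums bose u" if u: "u > 0" for u
  proof -
    have "(\<lambda>k. (u * exp (- u)) * exp (- u) ^ k) sums ((u * exp (- u)) * (1 / (1 - exp (- u))))"
      using u by (intro sums_mult geometric_sums) auto
    moreover have "(u * exp (- u)) * exp (- u) ^ k = 1 * (u ^ 1 * exp (- real (Suc k) * u))" for k
      unfolding exp_minus_Suc_mult by simp
    ultimately show ?thesis using u by (simp add: bose_def)
  qed
  show "(\<lambda>k. 1 * (fact 1 / real (Suc k) ^ Suc 1)) sums (pi\<^sup>2 / 6)"
  proof -
    have "1 * (fact 1 / real (Suc k) ^ Suc 1) = 1 / (real k + 1)\<^sup>2" for k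
      by (simp add: power2_eq_square add.commute)
    moreover have "real ((k + 1)\<^sup>2) = (real k + 1)\<^sup>2" for k by (simp add: add.commute)
    ultimately show ?thesis using inverse_squares_sums by (simp only:)
  qed
qed (use bose_antimono bose_nonneg in auto)

text \<open>Brings the variance into the form (x / sinh x)^2 with x = u / 2, where monotonicity
  follows from \<open>sinh_ratio_le\<close>.\<close>

lemma bose_var_eq: "u > 0 \<Longrightarrow> bose_var u = (u / (2 * sinh (u / 2)))\<^sup>2"
proof -
  assume u: "u > 0"
  have "exp (- u) = exp (- (u / 2)) ^ 2" by (simp flip: exp_of_nat_mult)
  moreover have "1 - exp (- u) = exp (- (u / 2)) * (2 * sinh (u / 2))"
    by (simp add: sinh_def algebra_simps flip: exp_add)
  ultimately have "geo_svar u = (u * exp (- (u / 2)))\<^sup>2 / (exp (- (u / 2)) * (2 * sinh (u / 2)))\<^sup>2"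
    unfolding geo_svar_def by (simp add: power_mult_distrib)
  also have "\<dots> = (u / (2 * sinh (u / 2)))\<^sup>2" by (simp flip: power_divide)
  finally show ?thesis using u by (simp add: bose_var_def)
qed

text \<open>With x = c y, the difference c sinh y - sinh (c y) vanishes at y = 0 and has derivative
  c (cosh y - cosh (c y)), which is nonnegative because c <= 1.\<close>

lemma sinh_ratio_le:
  fixes x y :: real
  assumes "0 \<le> x" "x \<le> y" shows "y * sinh x \<le> x * sinh y"
proof (cases "y = 0")
  case False
  then have y: "y > 0" using assms by simp
  define c where "c = x / y"
  have c: "0 \<le> c" "c \<le> 1" "x = c * y" using assms y by (auto simp: c_def)
  have "c * sinh 0 - sinh (c * 0) \<le> c * sinh y - sinh (c * y)"
  proof (rule DERIV_nonneg_imp_nondecreasing[where f = "\<lambda>u. c * sinh u - sinh (c * u)"])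
    fix u assume u: "0 \<le> u" "u \<le> y"
    have "\<bar>c * u\<bar> \<le> \<bar>u\<bar>" using c u by (simp add: abs_mult mult_left_le_one_le)
    then have "cosh (c * u) \<le> cosh u" using cosh_real_abs[of "c * u"] cosh_real_abs[of u] by (metis abs_ge_zero cosh_real_nonneg_le_iff)
    then have "c * cosh u - c * cosh (c * u) \<ge> 0" using c by (simp add: mult_left_mono)
    moreover have "((\<lambda>u. c * sinh u - sinh (c * u)) has_real_derivative c * cosh u - c * cosh (c * u)) (at u)"
      by (auto intro!: derivative_eq_intros)
    ultimately show "\<exists>d. ((\<lambda>u. c * sinh u - sinh (c * u)) has_real_derivative d) (at u) \<and> 0 \<le> d" by blast
  qed (use y in auto)
  then have "y * sinh x \<le> y * (c * sinh y)" using y c(3) by (intro mult_left_mono) auto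
  then show ?thesis using c(3) by (simp add: mult_ac)
qed (use assms in auto)

lemma bose_var_antimono: assumes "0 \<le> x" "x \<le> y" shows "bose_var y \<le> bose_var x"
proof -
  consider "y = 0" | "x = 0" "y > 0" | "x > 0" "y > 0" using assms by fastforce
  then show ?thesis
  proof cases
    case 2
    have s: "sinh (y / 2) > 0" using 2 by simp
    have "y / 2 \<le> sinh (y / 2)"
    proof -
      have "0 \<le> sinh (y / 2) - y / 2"
      proof -
        have "sinh 0 - 0 \<le> sinh (y / 2) - y / 2"
        proof (rule DERIV_nonneg_imp_nondecreasing[where f = "\<lambda>u. sinh u - u"])
          fix u :: real
          have "((\<lambda>u. sinh u - u) has_real_derivative cosh u - 1) (at u)" by (auto intro!: derivative_eq_intros)
          moreover have "cosh u - 1 \<ge> 0" using cosh_real_ge_1[of u] by simp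
          ultimately show "\<exists>d. ((\<lambda>u. sinh u - u) has_real_derivative d) (at u) \<and> 0 \<le> d" by blast
        qed (use 2 in auto)
        then show ?thesis by simp
      qed
      then show ?thesis by simp
    qed
    then have "(y / (2 * sinh (y / 2)))\<^sup>2 \<le> 1\<^sup>2" using s 2 by (intro power_mono) auto
    then show ?thesis using bose_var_eq[OF 2(2)] 2 by (simp add: bose_var_def)
  next
    case 3
    have s: "sinh (x / 2) > 0" "sinh (y / 2) > 0" using 3 by auto
    have "(y / 2) * sinh (x / 2) \<le> (x / 2) * sinh (y / 2)" using assms by (intro sinh_ratio_le) auto
    then have "y / (2 * sinh (y / 2)) \<le> x / (2 * sinh (x / 2))" using s 3 by (simp add: divide_simps mult_ac)
    then have "(y / (2 * sinh (y / 2)))\<^sup>2 \<le> (x / (2 * sinh (x / 2)))\<^sup>2" using s 3 by (intro power_mono) auto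
    then show ?thesis using bose_var_eq 3 by simp
  qed (use assms in auto)
qed

text \<open>The weights k + 1 come from the derivative of the geometric series. They lower the
  exponent in the Gamma integral 2 / (k + 1)^3 by one, so the total is 2 zeta(2).\<close>

lemma profile_bose_var: "profile bose_var (pi\<^sup>2 / 3)"
proof (rule profile_series[where a = "\<lambda>k. real (Suc k)" and p = 2])
  show "continuous_on {0..} bose_var"
  proof (rule continuous_on_atLeast_0I[where g = geo_svar])
    show "(geo_svar \<longlongrightarrow> bose_var 0) (at_right 0)"
      unfolding bose_var_def geo_svar_def by simp real_asymp
    show "isCont geo_svar u" if "u > 0" for u
      unfolding geo_svar_def using that by (intro continuous_intros) auto
  qed (auto simp: bose_var_def)
  show "(\<lambda>k. real (Suc k) * (u ^ 2 * exp (- real (Suc k) * u))) sums bose_var u" if u: "u > 0" for u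
  proof -
    have "(\<lambda>k. (u\<^sup>2 * exp (- u)) * (real (Suc k) * exp (- u) ^ k)) sums ((u\<^sup>2 * exp (- u)) * (1 / (1 - exp (- u))\<^sup>2))"
      using u geometric_deriv_sums[of "exp (- u)"] by (intro sums_mult) auto
    moreover have "(u\<^sup>2 * exp (- u)) * (real (Suc k) * exp (- u) ^ k) = real (Suc k) * (u ^ 2 * exp (- real (Suc k) * u))" for k
      unfolding exp_minus_Suc_mult by (simp only: mult_ac)
    ultimately have "(\<lambda>k. real (Suc k) * (u ^ 2 * exp (- real (Suc k) * u))) sums ((u\<^sup>2 * exp (- u)) * (1 / (1 - exp (- u))\<^sup>2))"
      by (simp only:)
    moreover have "bose_var u = (u\<^sup>2 * exp (- u)) * (1 / (1 - exp (- u))\<^sup>2)" using u by (simp add: bose_var_def geo_svar_def)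
    ultimately show ?thesis by (simp only:)
  qed
  have "(\<lambda>k. 2 * (1 / (real k + 1)\<^sup>2)) sums (2 * (pi\<^sup>2 / 6))"
  proof (intro sums_mult)
    have "real ((k + 1)\<^sup>2) = (real k + 1)\<^sup>2" for k by (simp add: add.commute)
    then show "(\<lambda>k. 1 / (real k + 1)\<^sup>2) sums (pi\<^sup>2 / 6)" using inverse_squares_sums by (simp only:)
  qed
  moreover have "2 * (1 / (real k + 1)\<^sup>2) = real (Suc k) * (fact 2 / real (Suc k) ^ Suc 2)" for k
  proof -
    have "y * (2 / (y * (y * y))) = 2 * (1 / (y * y))" if "y > 0" for y :: real using that by (simp add: field_simps)
    from this[of "real k + 1"] show ?thesis by (simp add: fact_2 power2_eq_square power3_eq_cube add.commute mult.assoc)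
  qed
  moreover have "2 * (pi\<^sup>2 / 6) = pi\<^sup>2 / 3" by simp
  ultimately show "(\<lambda>k. real (Suc k) * (fact 2 / real (Suc k) ^ Suc 2)) sums (pi\<^sup>2 / 3)" by (simp only:)
  show "0 \<le> bose_var u" if "u \<ge> 0" for u by (auto simp: bose_var_def geo_svar_def)
qed (use bose_var_antimono in auto)

section \<open>The Boltzmann model\<close>

lemma prod_mset_sum_replicate:
  "finite J \<Longrightarrow> prod_mset (\<Sum>n\<in>J. replicate_mset (m n) (f n)) = (\<Prod>n\<in>J. f n ^ m n)"
  for f :: "'i \<Rightarrow> 'a::comm_monoid_mult"
  by (induction J rule: finite_induct) auto

lemma set_mset_sum_replicate:
  "finite J \<Longrightarrow> set_mset (\<Sum>n\<in>J. replicate_mset (m n) (f n)) = f ` {n \<in> J. m n > 0}"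
  by (induction J rule: finite_induct) (auto split: if_splits)

lemma count_sum_replicate:
  assumes "finite J" "inj_on f J" "n \<in> J"
  shows "count (\<Sum>n\<in>J. replicate_mset (m n) (f n)) (f n) = m n"
proof -
  have "count (\<Sum>n\<in>J. replicate_mset (m n) (f n)) (f n) = (\<Sum>k\<in>J. if k = n then m n else 0)"
    unfolding count_sum using assms by (intro sum.cong) (auto simp: inj_on_def)
  then show ?thesis using assms by simp
qed

context lucas_pair
begin

definition prim_indices :: "nat set" where "prim_indices = {n. n \<ge> 1 \<and> (\<exists>p. primitive_divisor \<phi> \<psi> p n)}"
abbreviation F :: "nat set" where "F \<equiv> prim_lucas \<phi> \<psi>"
abbreviation len :: "nat \<Rightarrow> real" where "len n \<equiv> ln (real (v n))"

lemma F_eq: "F = v ` prim_indices"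
  by (auto simp: prim_lucas_def prim_indices_def)

text \<open>A primitive divisor of the later of two equal values would divide the earlier
  one.\<close>

lemma inj_on_v: "inj_on v prim_indices"
proof -
  have "v k \<noteq> v n" if kn: "k < n" "k \<ge> 1" "n \<in> prim_indices" for k n
  proof
    assume eq: "v k = v n"
    obtain p where p: "primitive_divisor \<phi> \<psi> p n" using kn by (auto simp: prim_indices_def)
    have dvd: "v k dvd (\<Prod>k\<in>{1..<n}. v k)" using kn by (intro dvd_prodI) auto
    have "p dvd v k" using p eq by (simp add: primitive_divisor_def)
    from dvd_trans[OF this dvd] show False using p by (simp add: primitive_divisor_def)
  qed
  note neq = this
  show ?thesis
  proof (rule inj_onI, rule ccontr)
    fix k n assume kn: "k \<in> prim_indices" "n \<in> prim_indices" "v k = v n" "k \<noteq> n"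
    then have "k \<ge> 1" "n \<ge> 1" by (simp_all add: prim_indices_def)
    then show False using neq[of k n] neq[of n k] kn by (cases "k < n") simp_all
  qed
qed

lemma v_ge_2: "n \<in> prim_indices \<Longrightarrow> v n \<ge> 2"
proof -
  assume n: "n \<in> prim_indices"
  then obtain p where p: "prime p" "p dvd v n" by (auto simp: primitive_divisor_def prim_indices_def)
  have "v n > 0" using v_pos n by (simp add: prim_indices_def)
  then have "p \<le> v n" using p(2) by (intro dvd_imp_le)
  then show ?thesis using prime_ge_2_nat[OF p(1)] by simp
qed

lemma len_pos: "n \<in> prim_indices \<Longrightarrow> len n > 0"
  using v_ge_2[of n] by (simp add: ln_gt_zero_iff)

lemma cofinite_I: "finite ({1..} - prim_indices)"
  by (rule finite_subset[OF _ finite_no_primitive_divisor]) (auto simp: prim_indices_def)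

definition pval :: "nat set \<Rightarrow> (nat \<Rightarrow> nat) \<Rightarrow> nat" where
  "pval J m = (\<Prod>n\<in>J. v n ^ m n)"

definition parts :: "nat set \<Rightarrow> (nat \<Rightarrow> nat) \<Rightarrow> nat" where
  "parts J m = card {n \<in> J. m n > 0}"

lemma factorisation_prod:
  assumes "set_mset B \<subseteq> F" shows "factorisation F (prod_mset B) = B"
proof -
  have "prod_mset B \<in> mult_monoid F" using assms by (auto simp: mult_monoid_def)
  from prim_lucas_unique_factorisation[OF dominant sum_eq prod_eq this]
  show ?thesis unfolding factorisation_def by (rule the1_equality) (simp add: assms)
qed

lemma factorisation_pval:
  assumes "finite J" "J \<subseteq> prim_indices"
  shows "factorisation F (pval J m) = (\<Sum>n\<in>J. replicate_mset (m n) (v n))"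
  using factorisation_prod[of "\<Sum>n\<in>J. replicate_mset (m n) (v n)"] assms
  by (auto simp: prod_mset_sum_replicate set_mset_sum_replicate pval_def F_eq)

lemma omega_pval:
  assumes "finite J" "J \<subseteq> prim_indices" shows "omega F (pval J m) = parts J m"
proof -
  have "inj_on v {n \<in> J. m n > 0}" by (rule inj_on_subset[OF inj_on_v]) (use assms in auto)
  then show ?thesis
    unfolding omega_def factorisation_pval[OF assms] parts_def
    using assms by (simp add: set_mset_sum_replicate card_image)
qed

lemma ln_pval:
  assumes "finite J" "J \<subseteq> prim_indices" shows "ln (real (pval J m)) = (\<Sum>n\<in>J. len n * m n)" "pval J m > 0"
proof -
  have pos: "v n > 0" if "n \<in> J" for n
  proof -
    have "n \<in> prim_indices" using assms that by blast
    then show ?thesis using v_ge_2[of n] by simp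
  qed
  then show "pval J m > 0" unfolding pval_def by (intro prod_pos) auto
  have "ln (real (pval J m)) = ln (\<Prod>n\<in>J. real (v n) ^ m n)" by (simp add: pval_def)
  also have "\<dots> = (\<Sum>n\<in>J. ln (real (v n) ^ m n))" using assms(1) pos by (intro ln_prod) auto
  also have "\<dots> = (\<Sum>n\<in>J. len n * m n)" using pos by (intro sum.cong refl) (simp add: ln_realpow mult.commute)
  finally show "ln (real (pval J m)) = (\<Sum>n\<in>J. len n * m n)" .
qed

abbreviation sample :: "real \<Rightarrow> nat set" where
  "sample x \<equiv> {N \<in> mult_monoid F. 1 \<le> real N \<and> real N \<le> x}"

text \<open>Injectivity is uniqueness of the factorisation, the vectors being 0 outside
  \<open>J\<close>. Surjectivity needs \<open>J\<close> to contain every index with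
  \<open>v n <= x\<close>, because each generator dividing N is at most x.\<close>

lemma bij_betw_pval:
  assumes J: "finite J" "J \<subseteq> prim_indices" and x: "\<And>n. n \<in> prim_indices \<Longrightarrow> real (v n) \<le> x \<Longrightarrow> n \<in> J"
  shows "bij_betw (pval J) {m \<in> PiE_dflt J 0 (\<lambda>_. UNIV). real (pval J m) \<le> x} (sample x)" (is "bij_betw _ ?A _")
proof (rule bij_betw_imageI)
  have inj: "inj_on v J" using inj_on_v J(2) by (rule inj_on_subset)
  show "inj_on (pval J) ?A"
  proof (rule inj_onI)
    fix m m' assume m: "m \<in> ?A" "m' \<in> ?A" "pval J m = pval J m'"
    have eq: "(\<Sum>n\<in>J. replicate_mset (m n) (v n)) = (\<Sum>n\<in>J. replicate_mset (m' n) (v n))"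
      using m(3) factorisation_pval[OF J] by metis
    show "m = m'"
    proof
      fix n show "m n = m' n"
      proof (cases "n \<in> J")
        case True
        then show ?thesis using count_sum_replicate[OF J(1) inj True] eq by metis
      qed (use m in \<open>auto simp: PiE_dflt_def\<close>)
    qed
  qed
  show "pval J ` ?A = sample x"
  proof (intro equalityI subsetI)
    fix N assume "N \<in> pval J ` ?A"
    then obtain m where m: "m \<in> ?A" "N = pval J m" by auto
    have "pval J m = prod_mset (\<Sum>n\<in>J. replicate_mset (m n) (v n))"
      using J by (simp add: pval_def prod_mset_sum_replicate)
    moreover have "set_mset (\<Sum>n\<in>J. replicate_mset (m n) (v n)) \<subseteq> F"
      using J by (auto simp: set_mset_sum_replicate F_eq)
    ultimately have "N \<in> mult_monoid F" using m by (auto simp: mult_monoid_def)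
    then show "N \<in> sample x" using m ln_pval(2)[OF J, of m] by auto
  next
    fix N assume N: "N \<in> sample x"
    then obtain B where B: "N = prod_mset B" "set_mset B \<subseteq> F" by (auto simp: mult_monoid_def)
    define m where "m n = (if n \<in> J then count B (v n) else 0)" for n
    have wJ: "\<exists>n\<in>J. w = v n" if w: "w \<in># B" for w
    proof -
      obtain n where n: "n \<in> prim_indices" "w = v n" using w B F_eq by blast
      have "w dvd N" using w B by (simp add: dvd_prod_mset)
      then have "w \<le> N" using N by (intro dvd_imp_le) auto
      then have "real (v n) \<le> x" using N n by auto
      then show ?thesis using x n by blast
    qed
    have "(\<Sum>n\<in>J. replicate_mset (m n) (v n)) = B"
    proof (rule multiset_eqI)
      fix w
      show "count (\<Sum>n\<in>J. replicate_mset (m n) (v n)) w = count B w"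
      proof (cases "\<exists>n\<in>J. w = v n")
        case True
        then obtain n where "n \<in> J" "w = v n" by auto
        then show ?thesis using count_sum_replicate[OF J(1) inj, of n m] by (simp add: m_def)
      next
        case False
        then have "w \<notin># B" using wJ by blast
        moreover have "w \<notin># (\<Sum>n\<in>J. replicate_mset (m n) (v n))"
          using False J by (auto simp: set_mset_sum_replicate)
        ultimately show ?thesis by (simp only: count_eq_zero_iff[symmetric])
      qed
    qed
    then have "pval J m = N" using prod_mset_sum_replicate[OF J(1), of m v] B by (simp add: pval_def)
    moreover have "m \<in> ?A" using calculation N by (auto simp: PiE_dflt_def m_def)
    ultimately show "N \<in> pval J ` ?A" by blast
  qed
qed

text \<open>The Boltzmann model: multiplicities are independent and geometric, so that the weight of a
  multiplicity vector is proportional to a power of the integer it represents.\<close>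

definition boltz :: "nat set \<Rightarrow> real \<Rightarrow> (nat \<Rightarrow> nat) pmf" where
  "boltz J s = Pi_pmf J 0 (\<lambda>n. geo (s * len n))"

text \<open>The probability of a vector is a constant times exp (- s log N), N being the integer it
  represents, and \<open>etail\<close> contributes exp (- s (log x - log N)) on N <= x. The product
  is a constant \<open>K\<close>, the same for all vectors and all \<open>f\<close>, so uniform
  averages are quotients in which \<open>K\<close> cancels.\<close>

lemma boltz_expectation:
  fixes f :: "nat \<Rightarrow> real"
  assumes J: "finite J" "J \<subseteq> prim_indices" and x: "x \<ge> 1" "\<And>n. n \<in> prim_indices \<Longrightarrow> real (v n) \<le> x \<Longrightarrow> n \<in> J" and s: "s > 0"
  shows "\<exists>K>0. \<forall>f. measure_pmf.expectation (boltz J s)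
           (\<lambda>m. f (parts J m) * etail (s * (ln x - (\<Sum>n\<in>J. len n * m n)))) = K * (\<Sum>N\<in>sample x. f (omega F N))"
proof (intro exI conjI allI)
  let ?A = "{m \<in> PiE_dflt J 0 (\<lambda>_. UNIV). real (pval J m) \<le> x}"
  let ?X = "\<lambda>m. \<Sum>n\<in>J. len n * real (m n)"
  define K where "K = exp (- s * ln x) * (\<Prod>n\<in>J. 1 - exp (- (s * len n)))"
  have u: "s * len n > 0" if "n \<in> J" for n using mult_pos_pos[OF s len_pos[of n]] J that by blast
  show "(exp (- s * ln x) * (\<Prod>n\<in>J. 1 - exp (- (s * len n)))) > 0"
    by (intro mult_pos_pos prod_pos) (use u in auto)
  fix f :: "nat \<Rightarrow> real"
  have bij: "bij_betw (pval J) ?A (sample x)" by (rule bij_betw_pval[OF J x(2)])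
  have finA: "finite ?A"
    using bij mult_monoid_sample_space(1)[OF x(1), of F] bij_betw_finite by blast
  have X_le: "?X m \<le> ln x \<longleftrightarrow> real (pval J m) \<le> x" for m
    using ln_pval[OF J, of m] x(1) by (simp flip: ln_pval(1)[OF J])
  have "measure_pmf.expectation (boltz J s) (\<lambda>m. f (parts J m) * etail (s * (ln x - ?X m))) =
      (\<Sum>m\<in>?A. pmf (boltz J s) m *\<^sub>R (f (parts J m) * etail (s * (ln x - ?X m))))"
  proof (rule integral_measure_pmf[OF finA])
    fix m assume m: "m \<in> set_pmf (boltz J s)" "f (parts J m) * etail (s * (ln x - ?X m)) \<noteq> 0"
    have "m \<in> PiE_dflt J 0 (\<lambda>_. UNIV)"
      using m(1) set_Pi_pmf_subset[OF J(1), of 0 "\<lambda>n. geo (s * len n)"] unfolding boltz_def PiE_dflt_def by auto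
    \<comment> \<open>Nonvanishing of \<open>etail\<close> confines the integral to the finitely
      many vectors with value at most x, the value x itself included.\<close>
    moreover have "s * (ln x - ?X m) \<ge> 0" using m(2) by (auto simp: etail_def split: if_splits)
    then have "?X m \<le> ln x" using s by (simp add: zero_le_mult_iff)
    ultimately show "m \<in> ?A" using X_le by simp
  qed
  also have "\<dots> = (\<Sum>m\<in>?A. K * f (omega F (pval J m)))"
  proof (rule sum.cong[OF refl])
    fix m assume m: "m \<in> ?A"
    have "pmf (boltz J s) m = (\<Prod>n\<in>J. pmf (geo (s * len n)) (m n))"
      unfolding boltz_def using J(1) m by (intro pmf_Pi') (auto simp: PiE_dflt_def)
    also have "\<dots> = (\<Prod>n\<in>J. exp (- (s * (len n * m n))) * (1 - exp (- (s * len n))))"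
    proof (rule prod.cong[OF refl])
      fix n assume n: "n \<in> J"
      have "exp (- (s * len n)) ^ m n = exp (real (m n) * - (s * len n))" by (rule exp_of_nat_mult[symmetric])
      also have "real (m n) * - (s * len n) = - (s * (len n * m n))" by simp
      finally have "exp (- (s * len n)) ^ m n = exp (- (s * (len n * m n)))" .
      then show "pmf (geo (s * len n)) (m n) = exp (- (s * (len n * m n))) * (1 - exp (- (s * len n)))"
        using geo_param(1)[OF u[OF n]] by simp
    qed
    also have "\<dots> = exp (- (s * ?X m)) * (\<Prod>n\<in>J. 1 - exp (- (s * len n)))"
    proof -
      have "(\<Sum>n\<in>J. - (s * (len n * m n))) = - (s * ?X m)" by (simp add: sum_negf sum_distrib_left)
      then show ?thesis unfolding prod.distrib exp_sum[OF J(1), symmetric] by simp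
    qed
    finally have "pmf (boltz J s) m * etail (s * (ln x - ?X m)) =
        exp (- (s * ?X m)) * exp (- (s * (ln x - ?X m))) * (\<Prod>n\<in>J. 1 - exp (- (s * len n)))"
      using X_le[of m] m s by (simp add: etail_def zero_le_mult_iff)
    also have "exp (- (s * ?X m)) * exp (- (s * (ln x - ?X m))) = exp (- s * ln x)"
      unfolding exp_add[symmetric] by (simp add: algebra_simps)
    finally show "pmf (boltz J s) m *\<^sub>R (f (parts J m) * etail (s * (ln x - ?X m))) = K * f (omega F (pval J m))"
      unfolding omega_pval[OF J] K_def by (simp add: mult_ac)
  qed
  also have "\<dots> = K * (\<Sum>m\<in>?A. f (omega F (pval J m)))" by (rule sum_distrib_left[symmetric])
  also have "(\<Sum>m\<in>?A. f (omega F (pval J m))) = (\<Sum>N\<in>sample x. f (omega F N))"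
    by (rule sum.reindex_bij_betw[OF bij])
  finally show "measure_pmf.expectation (boltz J s) (\<lambda>m. f (parts J m) * etail (s * (ln x - ?X m))) =
      (exp (- s * ln x) * (\<Prod>n\<in>J. 1 - exp (- (s * len n)))) * (\<Sum>N\<in>sample x. f (omega F N))"
    unfolding K_def .
qed

end

text \<open>Each entry pairs a summand with its integral. exp (- u) gives the mean number of
  distinct parts, exp (- 2 u) enters its variance, (1 + u) exp (- u) the covariance;
  \<open>bose\<close> and \<open>bose_var\<close> are the mean and variance of the total, and exp (-
  u / 2) bounds the error terms.\<close>

definition profiles :: "((real \<Rightarrow> real) \<times> real) set" where
  "profiles = {(\<lambda>u. exp (- 1 * u), 1 / 1), (\<lambda>u. exp (- 2 * u), 1 / 2), (\<lambda>u. exp (- (1/2) * u), 1 / (1/2)),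
        (\<lambda>u. (1 + u) * exp (- u), 2), (bose, pi\<^sup>2 / 6), (bose_var, pi\<^sup>2 / 3)}"

lemma profile_profiles: "p \<in> profiles \<Longrightarrow> profile (fst p) (snd p)"
  using profile_exp[of 1] profile_exp[of 2] profile_exp[of "1/2"] profile_linear_exp profile_bose profile_bose_var
  unfolding profiles_def by (elim insertE) simp_all

context lucas_pair
begin

section \<open>Simultaneous control of the sums over the parts\<close>

lemma ln_\<phi>_pos: "ln \<phi> > 0"
  using \<phi>_gt_1 by simp

lemma finite_len_le: "finite {n \<in> prim_indices. len n \<le> c}"
proof -
  obtain C where C: "\<And>n. n \<ge> 1 \<Longrightarrow> \<bar>len n - real n * ln \<phi>\<bar> \<le> C" using ln_v_approx by blast
  have "{n \<in> prim_indices. len n \<le> c} \<subseteq> {..nat \<lceil>(c + C) / ln \<phi>\<rceil>}"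
  proof
    fix n assume n: "n \<in> {n \<in> prim_indices. len n \<le> c}"
    then have "n \<ge> 1" by (simp add: prim_indices_def)
    then have "real n * ln \<phi> \<le> c + C" using C[of n] n by auto
    then have "real n \<le> (c + C) / ln \<phi>" using ln_\<phi>_pos by (simp add: pos_le_divide_eq)
    then show "n \<in> {..nat \<lceil>(c + C) / ln \<phi>\<rceil>}" by (simp add: le_nat_iff) linarith
  qed
  then show ?thesis by (rule finite_subset) simp
qed

text \<open>The order of quantifiers matters: \<open>D\<close> comes before \<open>s\<close> and
  \<open>x\<close>. It is the largest of the six bounds from \<open>profile_sum_approx\<close>, none
  of which depends on \<open>s\<close>; for given \<open>s\<close> and \<open>x\<close> a single
  cut-off \<open>M\<close> then meets finitely many eventual conditions.\<close>

lemma index_choice: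
  "\<exists>D. \<forall>s>0. \<forall>x. \<exists>J. finite J \<and> J \<subseteq> prim_indices \<and>
     (\<forall>n\<in>prim_indices. real (v n) \<le> x \<longrightarrow> n \<in> J) \<and> (\<forall>n\<in>prim_indices. s * len n \<le> 2 \<longrightarrow> n \<in> J) \<and>
     (\<forall>h A. (h, A) \<in> profiles \<longrightarrow>
       \<bar>(\<Sum>n\<in>J. h (s * len n)) - A / (ln \<phi> * s)\<bar> \<le> D)"
proof -
  let ?J = "\<lambda>M. {n \<in> prim_indices. n \<le> M}"
  obtain C where C: "\<And>n. n \<ge> 1 \<Longrightarrow> \<bar>len n - real n * ln \<phi>\<bar> \<le> C" using ln_v_approx by blast
  have "\<exists>D. \<forall>s>0. \<forall>\<^sub>F M in sequentially. \<bar>(\<Sum>n\<in>?J M. fst p (s * len n)) - snd p / (ln \<phi> * s)\<bar> \<le> D" if "p \<in> profiles" for p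
  proof (rule profile_sum_approx[OF profile_profiles[OF that] ln_\<phi>_pos])
    show "prim_indices \<subseteq> {1..}" by (auto simp: prim_indices_def)
    show "finite ({1..} - prim_indices)" by (rule cofinite_I)
    show "\<bar>len n - ln \<phi> * real n\<bar> \<le> C" if "n \<ge> 1" for n using C[OF that] by (simp add: mult.commute)
  qed (rule len_pos)
  then have "\<forall>p\<in>profiles. \<exists>D. \<forall>s>0. \<forall>\<^sub>F M in sequentially. \<bar>(\<Sum>n\<in>?J M. fst p (s * len n)) - snd p / (ln \<phi> * s)\<bar> \<le> D"
    by (intro ballI)
  from bchoice[OF this] obtain d where
    "\<forall>p\<in>profiles. \<forall>s>0. \<forall>\<^sub>F M in sequentially. \<bar>(\<Sum>n\<in>?J M. fst p (s * len n)) - snd p / (ln \<phi> * s)\<bar> \<le> d p"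
    by (elim exE)
  then have d: "\<forall>\<^sub>F M in sequentially. \<bar>(\<Sum>n\<in>?J M. fst p (s * len n)) - snd p / (ln \<phi> * s)\<bar> \<le> d p"
    if "p \<in> profiles" "s > 0" for p s using that by (elim ballE[of _ _ p]) simp_all
  have fin: "finite profiles" by (simp add: profiles_def)
  define D where "D = Max (d ` profiles)"
  have dD: "d p \<le> D" if "p \<in> profiles" for p unfolding D_def using fin that by (intro Max_ge) auto
  have "\<exists>J. finite J \<and> J \<subseteq> prim_indices \<and>
     (\<forall>n\<in>prim_indices. real (v n) \<le> x \<longrightarrow> n \<in> J) \<and> (\<forall>n\<in>prim_indices. s * len n \<le> 2 \<longrightarrow> n \<in> J) \<and>
     (\<forall>h A. (h, A) \<in> profiles \<longrightarrow> \<bar>(\<Sum>n\<in>J. h (s * len n)) - A / (ln \<phi> * s)\<bar> \<le> D)" if s: "s > 0" for s x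
  proof -
    let ?S = "{n \<in> prim_indices. len n \<le> max (ln x) (2 / s)}"
    have "\<forall>\<^sub>F M in sequentially. ?S \<subseteq> ?J M"
      using eventually_ge_at_top[of "Max ?S"]
    proof eventually_elim
      case (elim M)
      show ?case
      proof
        fix n assume n: "n \<in> ?S"
        then have "n \<le> Max ?S" by (intro Max_ge finite_len_le)
        then show "n \<in> ?J M" using n elim by simp
      qed
    qed
    moreover have "\<forall>\<^sub>F M in sequentially. \<forall>p\<in>profiles. \<bar>(\<Sum>n\<in>?J M. fst p (s * len n)) - snd p / (ln \<phi> * s)\<bar> \<le> d p"
      by (rule eventually_ball_finite[OF fin]) (intro ballI d s)
    ultimately have "\<forall>\<^sub>F M in sequentially. ?S \<subseteq> ?J M \<and> (\<forall>p\<in>profiles. \<bar>(\<Sum>n\<in>?J M. fst p (s * len n)) - snd p / (ln \<phi> * s)\<bar> \<le> d p)"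
      by (rule eventually_conj)
    from eventually_happens'[OF sequentially_bot this]
    obtain M where M0: "?S \<subseteq> ?J M \<and> (\<forall>p\<in>profiles. \<bar>(\<Sum>n\<in>?J M. fst p (s * len n)) - snd p / (ln \<phi> * s)\<bar> \<le> d p)"
      by (elim exE)
    note M = conjunct1[OF M0] bspec[OF conjunct2[OF M0]]
    show ?thesis
    proof (intro exI[of _ "?J M"] conjI ballI impI allI)
      fix n assume n: "n \<in> prim_indices" "real (v n) \<le> x"
      then have "len n \<le> ln x" using v_ge_2[OF n(1)] by (subst ln_le_cancel_iff) auto
      then show "n \<in> ?J M" using n(1) M(1) by auto
    next
      fix n assume n: "n \<in> prim_indices" "s * len n \<le> 2"
      then have "len n \<le> 2 / s" using s by (simp add: pos_le_divide_eq mult.commute)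
      then show "n \<in> ?J M" using n(1) M(1) by auto
    next
      fix h A assume "(h, A) \<in> profiles"
      from M(2)[OF this] dD[OF this] show "\<bar>(\<Sum>n\<in>?J M. h (s * len n)) - A / (ln \<phi> * s)\<bar> \<le> D" by simp
    qed auto
  qed
  then show ?thesis by (intro exI[of _ D] allI impI)
qed

text \<open>An index between (\<delta> / s + C) / ln \<phi> and (2 \<delta> / s - C) / ln \<phi>
  lies in the window unless its term has no primitive divisor.\<close>

lemma card_window_ge:
  assumes \<delta>: "\<delta> > 0"
  shows "\<exists>s0>0. \<forall>s. 0 < s \<longrightarrow> s \<le> s0 \<longrightarrow>
     \<delta> / (2 * (ln \<phi> * s)) \<le> real (card {n \<in> prim_indices. \<delta> \<le> s * len n \<and> s * len n \<le> 2 * \<delta>})"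
proof -
  obtain C where C: "\<And>n. n \<ge> 1 \<Longrightarrow> \<bar>len n - real n * ln \<phi>\<bar> \<le> C" using ln_v_approx by blast
  have C0: "C \<ge> 0" using C[of 1] by linarith
  define E where "E = card ({1..} - prim_indices)"
  let ?\<alpha> = "ln \<phi>"
  note \<alpha> = ln_\<phi>_pos
  \<comment> \<open>R / ln \<phi> is the total loss: the error C at both ends, one index for
    rounding and the \<open>E\<close> exceptional indices. For s at most \<delta> / (2 R) it is at
    most half of \<delta> / (s ln \<phi>).\<close>
  define R where "R = 2 * C + ?\<alpha> * (1 + real E)"
  have "?\<alpha> * (1 + real E) > 0" using \<alpha> by (intro mult_pos_pos) linarith+
  then have R: "R > 0" unfolding R_def using C0 by linarith
  have "\<delta> / (2 * (?\<alpha> * s)) \<le> real (card {n \<in> prim_indices. \<delta> \<le> s * len n \<and> s * len n \<le> 2 * \<delta>})"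
    if s: "0 < s" "s \<le> \<delta> / (2 * R)" for s
  proof -
    let ?K = "{n \<in> prim_indices. \<delta> \<le> s * len n \<and> s * len n \<le> 2 * \<delta>}"
    define a where "a = nat \<lceil>(\<delta> / s + C) / ?\<alpha>\<rceil>"
    define b where "b = nat \<lfloor>(2 * \<delta> / s - C) / ?\<alpha>\<rfloor>"
    have pos: "(\<delta> / s + C) / ?\<alpha> > 0" using \<delta> s C0 \<alpha> by (intro divide_pos_pos add_pos_nonneg) auto
    have a: "real a \<ge> (\<delta> / s + C) / ?\<alpha>" "real a \<le> (\<delta> / s + C) / ?\<alpha> + 1"
      unfolding a_def using pos by linarith+
    have a1: "a \<ge> 1" using a(1) pos by linarith
    have b: "real b \<ge> (2 * \<delta> / s - C) / ?\<alpha> - 1" unfolding b_def by linarith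
    have sub: "{a..b} - ({1..} - prim_indices) \<subseteq> ?K"
    proof
      fix n assume n: "n \<in> {a..b} - ({1..} - prim_indices)"
      have n1: "n \<ge> 1" using n a1 by auto
      have "real n \<ge> (\<delta> / s + C) / ?\<alpha>" using n a(1) by auto
      then have "real n * ?\<alpha> \<ge> \<delta> / s + C" using \<alpha> by (simp add: pos_divide_le_eq)
      then have 1: "len n \<ge> \<delta> / s" using C[OF n1] by linarith
      have "b > 0" using n a1 by auto
      then have "real b \<le> (2 * \<delta> / s - C) / ?\<alpha>" unfolding b_def by linarith
      then have "real n \<le> (2 * \<delta> / s - C) / ?\<alpha>" using n by auto
      then have "real n * ?\<alpha> \<le> 2 * \<delta> / s - C" using \<alpha> by (simp add: pos_le_divide_eq)
      then have 2: "len n \<le> 2 * \<delta> / s" using C[OF n1] by linarith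
      show "n \<in> ?K" using 1 2 n n1 s by (simp add: field_simps)
    qed
    have fin: "finite ?K"
      by (rule finite_subset[OF _ finite_len_le[of "2 * \<delta> / s"]]) (use s in \<open>auto simp: field_simps\<close>)
    have "real b + 1 - real a \<le> real (card {a..b})" by simp
    also have "card {a..b} \<le> card (({a..b} - ({1..} - prim_indices)) \<union> ({1..} - prim_indices))"
      by (intro card_mono finite_UnI cofinite_I) auto
    also have "\<dots> \<le> card ({a..b} - ({1..} - prim_indices)) + E" unfolding E_def by (rule card_Un_le)
    also have "\<dots> \<le> card ?K + E" using card_mono[OF fin sub] by simp
    finally have card: "real b + 1 - real a \<le> real (card ?K) + real E" by simp
    have "R \<le> \<delta> / (2 * s)" using s R by (simp add: field_simps)
    then have "R / ?\<alpha> \<le> \<delta> / (2 * s) / ?\<alpha>" using \<alpha> by (intro divide_right_mono) auto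
    moreover have "R / ?\<alpha> = 2 * C / ?\<alpha> + 1 + real E" using \<alpha> by (simp add: R_def add_divide_distrib)
    moreover have "\<delta> / (2 * s) / ?\<alpha> = \<delta> / (2 * (?\<alpha> * s))" by (simp add: mult_ac)
    moreover have "(2 * \<delta> / s - C) / ?\<alpha> - (\<delta> / s + C) / ?\<alpha> = 2 * (\<delta> / (2 * (?\<alpha> * s))) - 2 * C / ?\<alpha>"
      using \<alpha> s by (simp add: field_simps)
    ultimately show ?thesis using card a(2) b by linarith
  qed
  moreover have "\<delta> / (2 * R) > 0" using \<delta> R by simp
  ultimately show ?thesis by blast
qed

end

text \<open>\<open>J j\<close> truncates the set of parts at a point beyond which all relevant sums are negligible.\<close>

locale boltzmann_sequence = lucas_pair +
  fixes s :: "nat \<Rightarrow> real" and J :: "nat \<Rightarrow> nat set" and D :: real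
  assumes s_pos: "\<And>j. s j > 0" and s_lim: "s \<longlonglongrightarrow> 0"
    and J: "\<And>j. finite (J j)" "\<And>j. J j \<subseteq> prim_indices"
    and J_cover: "\<And>j n. n \<in> prim_indices \<Longrightarrow> s j * len n \<le> 2 \<Longrightarrow> n \<in> J j"
    and sums: "\<And>j h A. (h, A) \<in> profiles \<Longrightarrow>
       \<bar>(\<Sum>n\<in>J j. h (s j * len n)) - A / (ln \<phi> * s j)\<bar> \<le> D"
begin

text \<open>Its square is, up to O(1), the Boltzmann mean of the number of distinct parts, and it is
  the unit of all variances.\<close>

definition sg :: "nat \<Rightarrow> real" where "sg j = 1 / sqrt (ln \<phi> * s j)"

abbreviation u :: "nat \<Rightarrow> nat \<Rightarrow> real" where "u j n \<equiv> s j * len n"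

abbreviation Om :: "nat \<Rightarrow> (nat \<Rightarrow> nat) pmf" where "Om j \<equiv> boltz (J j) (s j)"

text \<open>The first term in the bracket is log x expressed through the \<open>s\<close> belonging
  to x, so that x itself stays out of the locale.\<close>

definition X :: "nat \<Rightarrow> (nat \<Rightarrow> nat) \<Rightarrow> real" where
  "X j m = s j * (pi\<^sup>2 / (6 * ln \<phi> * (s j)\<^sup>2) - (\<Sum>n\<in>J j. len n * m n))"

definition T :: "nat \<Rightarrow> (nat \<Rightarrow> nat) \<Rightarrow> real" where
  "T j m = (real (parts (J j) m) - (sg j)\<^sup>2) / sg j"

section \<open>Scaling and limits of the joint characteristic function\<close>

lemma u_pos: "n \<in> J j \<Longrightarrow> u j n > 0"
  using mult_pos_pos[OF s_pos[of j] len_pos[of n]] J(2)[of j] by blast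

lemma sg_pos: "sg j > 0" and sg_sq: "(sg j)\<^sup>2 = 1 / (ln \<phi> * s j)"
  using s_pos[of j] ln_\<phi>_pos by (simp_all add: sg_def power_divide)

lemma sg_lim: "filterlim sg at_top sequentially"
proof -
  have "(\<lambda>j. sqrt (ln \<phi> * s j)) \<longlonglongrightarrow> sqrt (ln \<phi> * 0)" by (intro tendsto_intros s_lim)
  moreover have "\<forall>\<^sub>F j in sequentially. sqrt (ln \<phi> * s j) > 0" using s_pos ln_\<phi>_pos by simp
  ultimately have "filterlim (\<lambda>j. inverse (sqrt (ln \<phi> * s j))) at_top sequentially"
    by (intro filterlim_inverse_at_top) simp_all
  then show ?thesis by (simp add: sg_def[abs_def] inverse_eq_divide)
qed

lemma sg_inverse_lim: "(\<lambda>j. c / sg j) \<longlonglongrightarrow> 0"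
  by (rule real_tendsto_divide_at_top[OF tendsto_const sg_lim])

lemma sums_sg: "\<And>j h A. (h, A) \<in> profiles \<Longrightarrow>
       \<bar>(\<Sum>n\<in>J j. h (u j n)) - A * (sg j)\<^sup>2\<bar> \<le> D"
  using sums unfolding sg_sq by simp

text \<open>The bounded error \<open>D\<close> is negligible already after division by
  \<open>sg\<close>, not only by its square; this is the precision that the centring needs.\<close>

lemma centred_lim:
  assumes "\<And>j. \<bar>S j - A * (sg j)\<^sup>2\<bar> \<le> D"
  shows "(\<lambda>j. (S j - A * (sg j)\<^sup>2) / sg j) \<longlonglongrightarrow> 0" and "(\<lambda>j. S j / (sg j)\<^sup>2) \<longlonglongrightarrow> A"
proof -
  show 1: "(\<lambda>j. (S j - A * (sg j)\<^sup>2) / sg j) \<longlonglongrightarrow> 0"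
  proof (rule Lim_null_comparison[OF _ sg_inverse_lim[of D]])
    show "\<forall>\<^sub>F j in sequentially. norm ((S j - A * (sg j)\<^sup>2) / sg j) \<le> D / sg j"
      using assms sg_pos by (intro always_eventually allI) (simp add: divide_right_mono less_imp_le)
  qed
  have "(\<lambda>j. (S j - A * (sg j)\<^sup>2) / sg j * (1 / sg j) + A) \<longlonglongrightarrow> 0 * 0 + A"
    by (intro tendsto_add tendsto_mult 1 sg_inverse_lim tendsto_const)
  moreover have "(S j - A * (sg j)\<^sup>2) / sg j * (1 / sg j) + A = S j / (sg j)\<^sup>2" for j
    using sg_pos[of j] by (simp add: field_simps power2_eq_square)
  ultimately show "(\<lambda>j. S j / (sg j)\<^sup>2) \<longlonglongrightarrow> A" by simp
qed

text \<open>\<open>X\<close> decreases with the multiplicities, hence the frequency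
  \<open>- \<theta>\<close> on the parts.\<close>

lemma linear_form:
  "\<theta> * X j m + \<tau> * T j m = (\<theta> * (pi\<^sup>2 / 6 * (sg j)\<^sup>2) - \<tau> * sg j) + (\<Sum>n\<in>J j. geo_rv (- \<theta>) (\<tau> / sg j) (u j n) (m n))"
proof -
  have "(\<Sum>n\<in>J j. geo_rv (- \<theta>) (\<tau> / sg j) (u j n) (m n)) =
      - \<theta> * s j * (\<Sum>n\<in>J j. len n * m n) + \<tau> / sg j * (\<Sum>n\<in>J j. if m n > 0 then 1 else 0)"
    unfolding sum_distrib_left sum.distrib[symmetric] by (intro sum.cong refl) (simp add: geo_rv_def)
  also have "(\<Sum>n\<in>J j. if m n > 0 then 1 else 0 :: real) = real (parts (J j) m)"
    using J(1)[of j] by (simp add: parts_def sum.If_cases Int_def)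
  finally have 1: "(\<Sum>n\<in>J j. geo_rv (- \<theta>) (\<tau> / sg j) (u j n) (m n)) =
      - \<theta> * s j * (\<Sum>n\<in>J j. len n * m n) + \<tau> / sg j * real (parts (J j) m)" .
  have 2: "X j m = pi\<^sup>2 / 6 * (sg j)\<^sup>2 - s j * (\<Sum>n\<in>J j. len n * m n)"
    unfolding X_def sg_sq using s_pos[of j] by (simp add: right_diff_distrib power2_eq_square)
  have 3: "T j m = real (parts (J j) m) / sg j - sg j"
    unfolding T_def using sg_pos[of j] by (simp add: diff_divide_distrib power2_eq_square)
  show ?thesis unfolding 1 2 3 by (simp add: algebra_simps)
qed

lemma char_dominated:
  "\<exists>a>0. \<exists>C. \<forall>\<^sub>F j in sequentially. \<forall>t. \<bar>t\<bar> \<le> K \<longrightarrow>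
     norm (measure_pmf.expectation (Om j) (\<lambda>m. iexp (\<tau> * T j m) * iexp (t * X j m))) \<le> C * exp (- a * (sg j * t)\<^sup>2)"
proof -
  define k where "k = \<bar>K\<bar> + 1"
  \<comment> \<open>Small enough that \<open>\<bar>t\<bar> * (2 * \<delta>) \<le> 1\<close> for all
    frequencies up to \<open>K\<close>, and that the window stays below 2, where
    \<open>J_cover\<close> guarantees that no index is missing from \<open>J j\<close>.\<close>
  define \<delta> where "\<delta> = 1 / (2 * k)"
  have k: "k \<ge> 1" by (simp add: k_def)
  then have \<delta>: "\<delta> > 0" "2 * \<delta> \<le> 2" by (auto simp: \<delta>_def pos_divide_le_eq)
  define c where "c = (1 - exp (- \<delta>))\<^sup>2 * exp (- 6 * \<delta>) * \<delta>\<^sup>2 / 4"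
  have c: "c > 0" using \<delta> by (simp add: c_def)
  obtain s0 where s0: "s0 > 0" "\<And>s. 0 < s \<Longrightarrow> s \<le> s0 \<Longrightarrow>
     \<delta> / (2 * (ln \<phi> * s)) \<le> real (card {n \<in> prim_indices. \<delta> \<le> s * len n \<and> s * len n \<le> 2 * \<delta>})"
    using card_window_ge[OF \<delta>(1)] by blast
  have "\<forall>\<^sub>F j in sequentially. s j < s0" using order_tendstoD(2)[OF s_lim s0(1)] .
  then have "\<forall>\<^sub>F j in sequentially. \<forall>t. \<bar>t\<bar> \<le> K \<longrightarrow>
     norm (measure_pmf.expectation (Om j) (\<lambda>m. iexp (\<tau> * T j m) * iexp (t * X j m))) \<le> 1 * exp (- (c * \<delta> / 2) * (sg j * t)\<^sup>2)"
  proof eventually_elim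
    case (elim j)
    have card: "\<delta> / 2 * (sg j)\<^sup>2 \<le> real (card {n \<in> J j. \<delta> \<le> u j n \<and> u j n \<le> 2 * \<delta>})"
    proof -
      have "{n \<in> prim_indices. \<delta> \<le> u j n \<and> u j n \<le> 2 * \<delta>} = {n \<in> J j. \<delta> \<le> u j n \<and> u j n \<le> 2 * \<delta>}"
        using J(2)[of j] J_cover[of _ j] \<delta>(2) by (auto intro: order_trans)
      then show ?thesis using s0(2)[OF s_pos[of j]] elim unfolding sg_sq by simp
    qed
    show ?case
    proof (intro allI impI)
      fix t assume t: "\<bar>t\<bar> \<le> K"
      have "norm (measure_pmf.expectation (Om j) (\<lambda>m. iexp (\<tau> * T j m) * iexp (t * X j m))) =
          norm (measure_pmf.expectation (Om j) (\<lambda>m. iexp (t * (pi\<^sup>2 / 6 * (sg j)\<^sup>2) - \<tau> * sg j) *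
            iexp (\<Sum>n\<in>J j. geo_rv (- t) (\<tau> / sg j) (u j n) (m n))))"
        unfolding exp_add[symmetric] distrib_left[symmetric] of_real_add[symmetric]
          linear_form[symmetric] by (simp add: add.commute)
      also have "\<dots> = norm (measure_pmf.expectation (Om j) (\<lambda>m. iexp (\<Sum>n\<in>J j. geo_rv (- t) (\<tau> / sg j) (u j n) (m n))))"
        unfolding integral_mult_right_zero norm_mult norm_iexp by simp
      also have "\<dots> \<le> exp (- c * (- t)\<^sup>2 * real (card {n \<in> J j. \<delta> \<le> u j n \<and> u j n \<le> 2 * \<delta>}))"
        unfolding boltz_def c_def
      proof (rule geo_product_char_le_exp[OF J(1) \<delta>(1)])
        have "\<bar>t\<bar> * (2 * \<delta>) = \<bar>t\<bar> / k" by (simp add: \<delta>_def)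
        also have "\<dots> \<le> 1" using t k by (simp add: pos_divide_le_eq) (simp add: k_def)
        finally show "\<bar>- t\<bar> * (2 * \<delta>) \<le> 1" by simp
      qed
      also have "\<dots> \<le> exp (- c * (- t)\<^sup>2 * (\<delta> / 2 * (sg j)\<^sup>2))"
        using mult_left_mono[OF card, of "c * t\<^sup>2"] c by simp
      also have "\<dots> = 1 * exp (- (c * \<delta> / 2) * (sg j * t)\<^sup>2)" by (simp add: power_mult_distrib)
      finally show "norm (measure_pmf.expectation (Om j) (\<lambda>m. iexp (\<tau> * T j m) * iexp (t * X j m)))
          \<le> 1 * exp (- (c * \<delta> / 2) * (sg j * t)\<^sup>2)" .
    qed
  qed
  moreover have "c * \<delta> / 2 > 0" using c \<delta> by simp
  ultimately show ?thesis by blast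
qed

text \<open>Centring splits off a phase \<open>p j\<close> and leaves a product covered by
  \<open>geo_product_char_approx\<close>. The phase tends to 0 because the means are known to O(1)
  and enter divided by \<open>sg\<close>. The error is at most of order sg^-3 per part, and there
  are of order sg^2 effective parts.\<close>

lemma char_limit:
  "(\<lambda>j. measure_pmf.expectation (Om j) (\<lambda>m. iexp (\<tau> * T j m) * iexp (\<theta> / sg j * X j m)))
     \<longlonglongrightarrow> exp (- (\<theta>\<^sup>2 * (pi\<^sup>2 / 3) - 2 * \<theta> * \<tau> + \<tau>\<^sup>2 / 2) / 2)"
proof -
  let ?rv = "\<lambda>j n. geo_rv (- (\<theta> / sg j)) (\<tau> / sg j) (u j n)" and ?mn = "\<lambda>j n. geo_mean (- (\<theta> / sg j)) (\<tau> / sg j) (u j n)"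
    and ?V = "\<lambda>j n. geo_var (- (\<theta> / sg j)) (\<tau> / sg j) (u j n)"
  let ?z = "\<lambda>j. measure_pmf.expectation (Om j) (\<lambda>m. iexp (\<Sum>n\<in>J j. ?rv j n (m n) - ?mn j n))"
  let ?S = "\<lambda>h j. \<Sum>n\<in>J j. h (u j n)"
  have bose_pos: "bose x = x * exp (- x) / (1 - exp (- x))" and bose_var_pos: "bose_var x = geo_svar x"
    if "x > 0" for x using that by (simp_all add: bose_def bose_var_def)
  define p where "p j = (\<theta> / sg j * (pi\<^sup>2 / 6 * (sg j)\<^sup>2) - \<tau> * sg j) + (\<Sum>n\<in>J j. ?mn j n)" for j
  have S1: "\<bar>?S (\<lambda>u. exp (- u)) j - 1 * (sg j)\<^sup>2\<bar> \<le> D" for j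
    using sums_sg[of "\<lambda>u. exp (- 1 * u)" "1/1" j] by (simp add: profiles_def)
  have S2: "\<bar>?S (\<lambda>u. exp (- 2 * u)) j - 1 / 2 * (sg j)\<^sup>2\<bar> \<le> D" for j
    by (rule sums_sg) (simp add: profiles_def)
  have Sh: "\<bar>?S (\<lambda>u. exp (- u / 2)) j - 2 * (sg j)\<^sup>2\<bar> \<le> D" for j
    using sums_sg[of "\<lambda>u. exp (- (1/2) * u)" "1/(1/2)" j] by (simp add: profiles_def)
  have S3: "\<bar>?S (\<lambda>u. (1 + u) * exp (- u)) j - 2 * (sg j)\<^sup>2\<bar> \<le> D" for j
    by (rule sums_sg) (simp add: profiles_def)
  have Sb: "\<bar>?S bose j - pi\<^sup>2 / 6 * (sg j)\<^sup>2\<bar> \<le> D" for j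
    by (rule sums_sg) (simp add: profiles_def)
  have Sv: "\<bar>?S bose_var j - pi\<^sup>2 / 3 * (sg j)\<^sup>2\<bar> \<le> D" for j
    by (rule sums_sg) (simp add: profiles_def)
  \<comment> \<open>The deterministic centrings in \<open>linear_form\<close> cancel exactly the
    main terms of the two mean sums.\<close>
  have p_eq: "p j = - \<theta> * ((?S bose j - pi\<^sup>2 / 6 * (sg j)\<^sup>2) / sg j) + \<tau> * ((?S (\<lambda>u. exp (- u)) j - 1 * (sg j)\<^sup>2) / sg j)" for j
  proof -
    have "(\<Sum>n\<in>J j. ?mn j n) = - (\<theta> / sg j) * ?S bose j + \<tau> / sg j * ?S (\<lambda>u. exp (- u)) j"
      unfolding sum_distrib_left sum.distrib[symmetric]
    proof (intro sum.cong refl)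
      fix n assume n: "n \<in> J j"
      show "?mn j n = - (\<theta> / sg j) * bose (u j n) + \<tau> / sg j * exp (- u j n)"
        unfolding geo_mean_def bose_pos[OF u_pos[OF n]] by simp
    qed
    then show ?thesis unfolding p_def using sg_pos[of j]
      by (simp add: diff_divide_distrib power2_eq_square algebra_simps)
  qed
  have "p \<longlonglongrightarrow> - \<theta> * 0 + \<tau> * 0"
    unfolding p_eq by (intro tendsto_intros centred_lim(1) Sb S1)
  then have "(\<lambda>j. iexp (p j)) \<longlonglongrightarrow> iexp 0" by (intro tendsto_intros) simp
  then have phase: "(\<lambda>j. iexp (p j)) \<longlonglongrightarrow> 1" by simp
  \<comment> \<open>2 - 1 is the integral of u exp (- u), as a difference of profiles, and 1 - 1 / 2
    that of exp (- u) - exp (- 2 u).\<close>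
  have "(\<lambda>j. \<Sum>n\<in>J j. ?V j n) \<longlonglongrightarrow> \<theta>\<^sup>2 * (pi\<^sup>2 / 3) - 2 * \<theta> * \<tau> * (2 - 1) + \<tau>\<^sup>2 * (1 - 1 / 2)"
  proof -
    have "(\<Sum>n\<in>J j. ?V j n) = \<theta>\<^sup>2 * (?S bose_var j / (sg j)\<^sup>2) - 2 * \<theta> * \<tau> * (?S (\<lambda>u. (1 + u) * exp (- u)) j / (sg j)\<^sup>2 - ?S (\<lambda>u. exp (- u)) j / (sg j)\<^sup>2)
        + \<tau>\<^sup>2 * (?S (\<lambda>u. exp (- u)) j / (sg j)\<^sup>2 - ?S (\<lambda>u. exp (- 2 * u)) j / (sg j)\<^sup>2)" for j
      unfolding sum_divide_distrib sum_subtractf[symmetric] sum_distrib_left sum.distrib[symmetric]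
    proof (intro sum.cong refl)
      fix n assume n: "n \<in> J j"
      show "?V j n = \<theta>\<^sup>2 * (bose_var (u j n) / (sg j)\<^sup>2) - 2 * \<theta> * \<tau> * ((1 + u j n) * exp (- u j n) / (sg j)\<^sup>2 - exp (- u j n) / (sg j)\<^sup>2)
        + \<tau>\<^sup>2 * (exp (- u j n) / (sg j)\<^sup>2 - exp (- 2 * u j n) / (sg j)\<^sup>2)"
        unfolding bose_var_pos[OF u_pos[OF n]] geo_var_def divide_inverse power2_eq_square
        by (simp add: inverse_mult_distrib algebra_simps)
    qed
    then show ?thesis
      by (simp only:) (intro tendsto_intros centred_lim(2) S1 S2 S3 Sv)
  qed
  then have "(\<lambda>j. complex_of_real (exp (- (\<Sum>n\<in>J j. ?V j n) / 2))) \<longlonglongrightarrow>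
      complex_of_real (exp (- (\<theta>\<^sup>2 * (pi\<^sup>2 / 3) - 2 * \<theta> * \<tau> * (2 - 1) + \<tau>\<^sup>2 * (1 - 1 / 2)) / 2))"
    by (intro tendsto_intros) simp_all
  moreover have "(\<lambda>j. ?z j - complex_of_real (exp (- (\<Sum>n\<in>J j. ?V j n) / 2))) \<longlonglongrightarrow> 0"
  proof (rule Lim_null_comparison)
    let ?B = "\<lambda>j. (2560 * (\<bar>\<theta>\<bar> ^ 3 + \<bar>\<tau>\<bar> ^ 3) * (1 / sg j) + 128 * (\<theta>\<^sup>2 + \<tau>\<^sup>2)\<^sup>2 * (1 / sg j)\<^sup>2) * (?S (\<lambda>u. exp (- u / 2)) j / (sg j)\<^sup>2)"
    have "norm (?z j - complex_of_real (exp (- (\<Sum>n\<in>J j. ?V j n) / 2))) \<le> ?B j" for j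
    proof -
      have "norm (?z j - complex_of_real (exp (- (\<Sum>n\<in>J j. ?V j n) / 2))) \<le>
        (2560 * (\<bar>- (\<theta> / sg j)\<bar> ^ 3 + \<bar>\<tau> / sg j\<bar> ^ 3) + 128 * ((- (\<theta> / sg j))\<^sup>2 + (\<tau> / sg j)\<^sup>2)\<^sup>2) * (\<Sum>n\<in>J j. exp (- u j n / 2))"
        unfolding boltz_def by (rule geo_product_char_approx[OF J(1) u_pos])
      also have "\<dots> = ?B j"
      proof -
        have "\<bar>inverse (sg j)\<bar> = inverse (sg j)" using sg_pos[of j] by simp
        then show ?thesis
          unfolding abs_minus_cancel divide_inverse abs_mult power2_eq_square power3_eq_cube
          by (simp add: inverse_mult_distrib algebra_simps)
      qed
      finally show ?thesis .
    qed
    then show "\<forall>\<^sub>F j in sequentially. norm (?z j - complex_of_real (exp (- (\<Sum>n\<in>J j. ?V j n) / 2))) \<le> ?B j" by simp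
    have "?B \<longlonglongrightarrow> (2560 * (\<bar>\<theta>\<bar> ^ 3 + \<bar>\<tau>\<bar> ^ 3) * 0 + 128 * (\<theta>\<^sup>2 + \<tau>\<^sup>2)\<^sup>2 * 0\<^sup>2) * 2"
      by (intro tendsto_intros sg_inverse_lim centred_lim(2) Sh)
    then show "?B \<longlonglongrightarrow> 0" by simp
  qed
  ultimately have "?z \<longlonglongrightarrow> complex_of_real (exp (- (\<theta>\<^sup>2 * (pi\<^sup>2 / 3) - 2 * \<theta> * \<tau> * (2 - 1) + \<tau>\<^sup>2 * (1 - 1 / 2)) / 2))"
    by (rule Lim_transform)
  then have "(\<lambda>j. iexp (p j) * ?z j) \<longlonglongrightarrow> 1 * complex_of_real (exp (- (\<theta>\<^sup>2 * (pi\<^sup>2 / 3) - 2 * \<theta> * \<tau> * (2 - 1) + \<tau>\<^sup>2 * (1 - 1 / 2)) / 2))"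
    by (intro tendsto_mult phase)
  moreover have "iexp (p j) * ?z j = measure_pmf.expectation (Om j) (\<lambda>m. iexp (\<tau> * T j m) * iexp (\<theta> / sg j * X j m))" for j
  proof -
    have "iexp (p j) * iexp (\<Sum>n\<in>J j. ?rv j n (m n) - ?mn j n) = iexp (\<tau> * T j m) * iexp (\<theta> / sg j * X j m)" for m
    proof -
      have "p j + (\<Sum>n\<in>J j. ?rv j n (m n) - ?mn j n) = \<tau> * T j m + \<theta> / sg j * X j m"
        using linear_form[of "\<theta> / sg j" j m \<tau>] by (simp add: p_def sum_subtractf)
      then show ?thesis unfolding exp_add[symmetric] distrib_left[symmetric] of_real_add[symmetric] by simp
    qed
    then show ?thesis unfolding integral_mult_right_zero[symmetric] by simp
  qed
  ultimately show ?thesis by simp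
qed

end

section \<open>Asymptotic normality\<close>

text \<open>In units of the squared scale \<open>sg\<close>, the number of distinct parts has variance \<open>1/2\<close>, the total \<open>X\<close> has
  variance \<open>\<pi>\<^sup>2/3\<close> and their covariance is \<open>-1\<close>; \<open>cvar\<close> is the conditional variance.\<close>

definition cvar :: real where "cvar = 1 / 2 - 3 / pi\<^sup>2"

lemma cvar_pos: "cvar > 0"
proof -
  have "3 ^ 2 < pi ^ 2" using pi_gt3 by (intro power_strict_mono) auto
  then show ?thesis unfolding cvar_def by (simp add: field_simps)
qed

text \<open>Integrating over the frequency dual to \<open>X\<close> corresponds to restricting to X
  = 0. Completing the square at \<theta> = 3 \<tau> / pi^2 turns the joint quadratic form into the
  conditional one.\<close>

lemma integral_gauss_section:
  "(\<integral>\<theta>. exp (- (\<theta>\<^sup>2 * (pi\<^sup>2 / 3) - 2 * \<theta> * \<tau> + \<tau>\<^sup>2 / 2) / 2) \<partial>lborel) = sqrt (6 / pi) * exp (- (\<tau>\<^sup>2 * cvar) / 2)"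
proof -
  let ?f = "\<lambda>\<theta>. exp (- (pi\<^sup>2 / 6) * \<theta>\<^sup>2)"
  have pp: "pi\<^sup>2 \<noteq> 0" by simp
  have "exp (- (\<theta>\<^sup>2 * (pi\<^sup>2 / 3) - 2 * \<theta> * \<tau> + \<tau>\<^sup>2 / 2) / 2) = exp (- (\<tau>\<^sup>2 * cvar) / 2) * ?f (- (3 * \<tau> / pi\<^sup>2) + 1 * \<theta>)" for \<theta>
  proof -
    define w where "w = pi\<^sup>2"
    have w: "w \<noteq> 0" by (simp add: w_def)
    have "- (\<theta>\<^sup>2 * (w / 3) - 2 * \<theta> * \<tau> + \<tau>\<^sup>2 / 2) / 2 = - (\<tau>\<^sup>2 * (1 / 2 - 3 / w)) / 2 + - (w / 6) * (- (3 * \<tau> / w) + 1 * \<theta>)\<^sup>2"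
      using w by (simp add: field_simps power2_eq_square)
    then show ?thesis unfolding cvar_def exp_add[symmetric] w_def[symmetric] by (rule arg_cong)
  qed
  then have "(\<integral>\<theta>. exp (- (\<theta>\<^sup>2 * (pi\<^sup>2 / 3) - 2 * \<theta> * \<tau> + \<tau>\<^sup>2 / 2) / 2) \<partial>lborel) =
      exp (- (\<tau>\<^sup>2 * cvar) / 2) * (\<integral>\<theta>. ?f (- (3 * \<tau> / pi\<^sup>2) + 1 * \<theta>) \<partial>lborel)"
    by (simp only: integral_mult_right_zero)
  also have "(\<integral>\<theta>. ?f (- (3 * \<tau> / pi\<^sup>2) + 1 * \<theta>) \<partial>lborel) = (\<integral>\<theta>. ?f \<theta> \<partial>lborel)"
    using lborel_integral_real_affine[of 1 ?f "- (3 * \<tau> / pi\<^sup>2)"] by simp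
  also have "\<dots> = sqrt (pi / (pi\<^sup>2 / 6))" by (rule integral_exp_minus_square) simp
  also have "pi / (pi\<^sup>2 / 6) = 6 / pi" by (simp add: power2_eq_square)
  finally show ?thesis by simp
qed

context boltzmann_sequence
begin

abbreviation "G0 \<equiv> sqrt (6 / pi)"

text \<open>The limit factorises in \<open>w\<close> and \<open>\<tau>\<close>: at scale 1 the law
  of \<open>X\<close> near 0 looks like a multiple of Lebesgue measure, independently of
  \<open>T\<close>.\<close>

lemma kern_limit:
  "(\<lambda>j. sg j * measure_pmf.expectation (Om j) (\<lambda>m. iexp (\<tau> * T j m) * (complex_of_real (kern (X j m)) * iexp (w * X j m))))
     \<longlonglongrightarrow> complex_of_real (tent w * (G0 * exp (- (\<tau>\<^sup>2 * cvar) / 2)))"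
proof -
  let ?\<Gamma> = "\<lambda>\<theta>. complex_of_real (exp (- (\<theta>\<^sup>2 * (pi\<^sup>2 / 3) - 2 * \<theta> * \<tau> + \<tau>\<^sup>2 / 2) / 2))"
  have "(\<lambda>j. sg j * measure_pmf.expectation (Om j) (\<lambda>m. iexp (\<tau> * T j m) * (complex_of_real (kern (X j m)) * iexp (w * X j m))))
     \<longlonglongrightarrow> tent w * (\<integral>\<theta>. ?\<Gamma> \<theta> \<partial>lborel)"
  proof (rule local_limit[where B = 1])
    show "prob_space (measure_pmf (Om j))" for j by (rule measure_pmf.prob_space_axioms)
    show "norm (iexp (\<tau> * T j m)) \<le> 1" for j m by simp
    show "sg j > 0" for j by (rule sg_pos)
    show "filterlim sg at_top sequentially" by (rule sg_lim)
    show "(\<lambda>j. measure_pmf.expectation (Om j) (\<lambda>m. iexp (\<tau> * T j m) * iexp (\<theta> / sg j * X j m))) \<longlonglongrightarrow> ?\<Gamma> \<theta>" for \<theta>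
      by (rule char_limit)
    show "\<exists>a>0. \<exists>C. \<forall>\<^sub>F j in sequentially. \<forall>t. \<bar>t\<bar> \<le> K \<longrightarrow>
      norm (measure_pmf.expectation (Om j) (\<lambda>m. iexp (\<tau> * T j m) * iexp (t * X j m))) \<le> C * exp (- a * (sg j * t)\<^sup>2)" for K
      by (rule char_dominated)
  qed measurable
  then show ?thesis
    unfolding integral_complex_of_real integral_gauss_section by simp
qed

lemma integrable_kern_iexp: "integrable (Om j) (\<lambda>m. iexp (\<tau> * T j m) * (complex_of_real (kern (X j m)) * iexp (w * X j m)))"
proof (intro measure_pmf.integrable_const_bound[of _ "2 * (cosh 1 + 1)"] AE_I2)
  fix m
  show "norm (iexp (\<tau> * T j m) * (complex_of_real (kern (X j m)) * iexp (w * X j m))) \<le> 2 * (cosh 1 + 1)"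
    unfolding norm_mult norm_iexp using kern_bounded[of "X j m"] kern_pos[of "X j m"] by simp
qed simp

text \<open>Weak convergence needs nonnegative weights, so the character \<open>iexp (\<tau> * T)\<close> is accessed through the
  weights \<open>1 + cos (\<tau> * T)\<close> and \<open>1 + sin (\<tau> * T)\<close>.\<close>

lemma etail_limit_aux:
  fixes p q :: complex
  assumes b: "\<And>t. 0 \<le> b t" "\<And>t. b t \<le> 2" and G: "G > 0"
    and eq: "\<And>t. complex_of_real (b t) = 1 + p * iexp (\<tau> * t) + q * iexp (- \<tau> * t)"
    and G_eq: "complex_of_real G = G0 * (1 + (p + q) * exp (- (\<tau>\<^sup>2 * cvar) / 2))"
  shows "(\<lambda>j. sg j * measure_pmf.expectation (Om j) (\<lambda>m. b (T j m) * etail (X j m))) \<longlonglongrightarrow> G / (2 * pi)"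
proof (rule weighted_etail_limit[where B = 2])
  fix w
  let ?k = "\<lambda>(\<tau>::real) j m. iexp (\<tau> * T j m) * (complex_of_real (kern (X j m)) * iexp (w * X j m))"
  let ?E = "\<lambda>(\<tau>::real) j. complex_of_real (sg j) * measure_pmf.expectation (Om j) (?k \<tau> j)"
  have "sg j * measure_pmf.expectation (Om j) (\<lambda>m. complex_of_real (b (T j m)) * (complex_of_real (kern (X j m)) * iexp (w * X j m))) =
      ?E 0 j + p * ?E \<tau> j + q * ?E (- \<tau>) j" for j
  proof -
    have "measure_pmf.expectation (Om j) (\<lambda>m. complex_of_real (b (T j m)) * (complex_of_real (kern (X j m)) * iexp (w * X j m))) =
        measure_pmf.expectation (Om j) (\<lambda>m. ?k 0 j m + p * ?k \<tau> j m + q * ?k (- \<tau>) j m)"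
      unfolding eq by (intro Bochner_Integration.integral_cong refl) (simp add: algebra_simps)
    also have "\<dots> = measure_pmf.expectation (Om j) (?k 0 j) + p * measure_pmf.expectation (Om j) (?k \<tau> j) + q * measure_pmf.expectation (Om j) (?k (- \<tau>) j)"
      by (simp only: Bochner_Integration.integral_add Bochner_Integration.integrable_add integrable_mult_right integrable_kern_iexp integral_mult_right_zero)
    finally show ?thesis by (simp add: algebra_simps)
  qed
  moreover have "(\<lambda>j. ?E 0 j + p * ?E \<tau> j + q * ?E (- \<tau>) j) \<longlonglongrightarrow>
      complex_of_real (tent w * (G0 * exp (- (0\<^sup>2 * cvar) / 2))) + p * complex_of_real (tent w * (G0 * exp (- (\<tau>\<^sup>2 * cvar) / 2)))
      + q * complex_of_real (tent w * (G0 * exp (- ((- \<tau>)\<^sup>2 * cvar) / 2)))"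
    by (intro tendsto_add tendsto_mult tendsto_const kern_limit)
  moreover have "complex_of_real (tent w * (G0 * exp (- (0\<^sup>2 * cvar) / 2))) + p * complex_of_real (tent w * (G0 * exp (- (\<tau>\<^sup>2 * cvar) / 2)))
      + q * complex_of_real (tent w * (G0 * exp (- ((- \<tau>)\<^sup>2 * cvar) / 2))) = complex_of_real (tent w * G)"
    unfolding of_real_mult G_eq by (simp add: algebra_simps)
  ultimately show "(\<lambda>j. sg j * measure_pmf.expectation (Om j) (\<lambda>m. complex_of_real (b (T j m)) * (complex_of_real (kern (X j m)) * iexp (w * X j m))))
      \<longlonglongrightarrow> complex_of_real (tent w * G)"
    by (simp only:)
qed (use b G sg_pos measure_pmf.prob_space_axioms in auto)

text \<open>The first limit is the normaliser. The sine weight has the same limit because the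
  limiting law of \<open>T\<close> is symmetric; in \<open>etail_limit_aux\<close> this is p + q =
  0.\<close>

lemma etail_limits:
  shows "(\<lambda>j. sg j * measure_pmf.expectation (Om j) (\<lambda>m. 1 * etail (X j m))) \<longlonglongrightarrow> G0 / (2 * pi)"
    and "(\<lambda>j. sg j * measure_pmf.expectation (Om j) (\<lambda>m. (1 + cos (\<tau> * T j m)) * etail (X j m)))
           \<longlonglongrightarrow> G0 * (1 + exp (- (\<tau>\<^sup>2 * cvar) / 2)) / (2 * pi)"
    and "(\<lambda>j. sg j * measure_pmf.expectation (Om j) (\<lambda>m. (1 + sin (\<tau> * T j m)) * etail (X j m))) \<longlonglongrightarrow> G0 / (2 * pi)"
proof -
  have G0: "G0 > 0" by simp
  show "(\<lambda>j. sg j * measure_pmf.expectation (Om j) (\<lambda>m. 1 * etail (X j m))) \<longlonglongrightarrow> G0 / (2 * pi)"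
    by (rule etail_limit_aux[where p = 0 and q = 0 and b = "\<lambda>_. 1"]) auto
  have cos_eq: "complex_of_real (1 + cos (\<tau> * t)) = 1 + (1 / 2) * iexp (\<tau> * t) + (1 / 2) * iexp (- \<tau> * t)" for t
  proof -
    have "complex_of_real (cos (\<tau> * t)) = (iexp (\<tau> * t) + iexp (- (\<tau> * t))) / 2"
      unfolding cos_of_real[symmetric] cos_exp_eq by simp
    then show ?thesis by (simp add: add_divide_distrib)
  qed
  have cos_bounds: "0 \<le> 1 + cos (\<tau> * t)" "1 + cos (\<tau> * t) \<le> 2" for t
    using cos_ge_minus_one[of "\<tau> * t"] cos_le_one[of "\<tau> * t"] by linarith+
  have G_pos: "G0 * (1 + exp (- (\<tau>\<^sup>2 * cvar) / 2)) > 0"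
    using G0 by (intro mult_pos_pos add_pos_pos) auto
  show "(\<lambda>j. sg j * measure_pmf.expectation (Om j) (\<lambda>m. (1 + cos (\<tau> * T j m)) * etail (X j m)))
           \<longlonglongrightarrow> G0 * (1 + exp (- (\<tau>\<^sup>2 * cvar) / 2)) / (2 * pi)"
    by (rule etail_limit_aux[OF cos_bounds G_pos cos_eq]) simp
  have sin_eq: "complex_of_real (1 + sin (\<tau> * t)) = 1 + (1 / (2 * \<i>)) * iexp (\<tau> * t) + (- (1 / (2 * \<i>))) * iexp (- \<tau> * t)" for t
  proof -
    have "complex_of_real (sin (\<tau> * t)) = (iexp (\<tau> * t) - iexp (- (\<tau> * t))) / (2 * \<i>)"
      unfolding sin_of_real[symmetric] sin_exp_eq by simp
    then show ?thesis by (simp add: diff_divide_distrib right_diff_distrib)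
  qed
  have sin_bounds: "0 \<le> 1 + sin (\<tau> * t)" "1 + sin (\<tau> * t) \<le> 2" for t
    using sin_ge_minus_one[of "\<tau> * t"] sin_le_one[of "\<tau> * t"] by linarith+
  show "(\<lambda>j. sg j * measure_pmf.expectation (Om j) (\<lambda>m. (1 + sin (\<tau> * T j m)) * etail (X j m))) \<longlonglongrightarrow> G0 / (2 * pi)"
    by (rule etail_limit_aux[OF sin_bounds G0 sin_eq]) simp
qed

end

section \<open>Transfer to the uniform law on the monoid\<close>

lemma iexp_eq_cos_sin: "iexp x = complex_of_real (cos x) + \<i> * complex_of_real (sin x)"
  unfolding cis_conv_exp[symmetric] by (simp add: complex_eq_iff)

lemma integral_pmf_of_set_complex:
  fixes f :: "'a \<Rightarrow> complex"
  assumes "finite S" "S \<noteq> {}"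
  shows "measure_pmf.expectation (pmf_of_set S) f = (\<Sum>x\<in>S. f x) / of_nat (card S)"
proof -
  have "measure_pmf.expectation (pmf_of_set S) f = (\<Sum>x\<in>S. pmf (pmf_of_set S) x *\<^sub>R f x)"
    using assms by (intro integral_measure_pmf) auto
  also have "\<dots> = (\<Sum>x\<in>S. f x / of_nat (card S))"
    using assms by (intro sum.cong refl) (simp add: scaleR_conv_of_real)
  finally show ?thesis by (simp add: sum_divide_distrib)
qed

context lucas_pair
begin

text \<open>A uniform average over the sample is a quotient of two Boltzmann expectations with
  weight \<open>etail\<close>, both of order 1 / sg. Hence \<open>etail_limits\<close> yields the
  limits of the cosine and sine averages, which make up the characteristic function. The bound y >=
  2 keeps log y positive, as the choice of \<open>s\<close> requires.\<close>

lemma omega_asymptotically_normal_seq: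
  assumes y: "\<And>j. y j \<ge> 2" "filterlim y at_top sequentially"
  defines "sd2 \<equiv> (\<lambda>j. sqrt (6 / ln \<phi>) / pi * sqrt (ln (y j)))"
  shows "(\<lambda>j. measure_pmf.prob (pmf_of_set (sample (y j))) {N. (real (omega F N) - sd2 j) / (sqrt cvar * sqrt (sd2 j)) \<le> z})
           \<longlonglongrightarrow> cdf std_normal_distribution z"
proof -
  have \<alpha>: "ln \<phi> > 0" by (rule ln_\<phi>_pos)
  have L: "ln (y j) > 0" for j using y(1)[of j] by simp
  define s where "s j = pi / sqrt (6 * ln \<phi> * ln (y j))" for j
  have s_pos: "s j > 0" for j using L \<alpha> by (simp add: s_def)
  have s_sq: "(s j)\<^sup>2 = pi\<^sup>2 / (6 * ln \<phi> * ln (y j))" for j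
    using L[of j] \<alpha> by (simp add: s_def power_divide)
  have s_L: "pi\<^sup>2 / (6 * ln \<phi> * (s j)\<^sup>2) = ln (y j)" for j
    unfolding s_sq using L[of j] \<alpha> by simp
  have lnlim: "filterlim (\<lambda>j. ln (y j)) at_top sequentially" by (rule filterlim_compose[OF ln_at_top y(2)])
  have "filterlim (\<lambda>j. 6 * ln \<phi> * ln (y j)) at_top sequentially"
    using \<alpha> by (intro filterlim_tendsto_pos_mult_at_top[OF tendsto_const _ lnlim]) simp
  then have "filterlim (\<lambda>j. sqrt (6 * ln \<phi> * ln (y j))) at_top sequentially"
    by (rule filterlim_compose[OF sqrt_at_top])
  then have s_lim: "s \<longlonglongrightarrow> 0" unfolding s_def[abs_def] by (rule real_tendsto_divide_at_top[OF tendsto_const])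
  obtain D where D: "\<forall>s>0. \<forall>x. \<exists>J. finite J \<and> J \<subseteq> prim_indices \<and>
     (\<forall>n\<in>prim_indices. real (v n) \<le> x \<longrightarrow> n \<in> J) \<and> (\<forall>n\<in>prim_indices. s * len n \<le> 2 \<longrightarrow> n \<in> J) \<and>
     (\<forall>h A. (h, A) \<in> profiles \<longrightarrow> \<bar>(\<Sum>n\<in>J. h (s * len n)) - A / (ln \<phi> * s)\<bar> \<le> D)"
    using index_choice by (elim exE)
  have "\<forall>j. \<exists>J. finite J \<and> J \<subseteq> prim_indices \<and>
     (\<forall>n\<in>prim_indices. real (v n) \<le> y j \<longrightarrow> n \<in> J) \<and> (\<forall>n\<in>prim_indices. s j * len n \<le> 2 \<longrightarrow> n \<in> J) \<and>
     (\<forall>h A. (h, A) \<in> profiles \<longrightarrow> \<bar>(\<Sum>n\<in>J. h (s j * len n)) - A / (ln \<phi> * s j)\<bar> \<le> D)"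
    using D s_pos by (intro allI) (elim allE impE, assumption+)
  from choice[OF this] obtain J where J: "\<forall>j. finite (J j) \<and> J j \<subseteq> prim_indices \<and>
     (\<forall>n\<in>prim_indices. real (v n) \<le> y j \<longrightarrow> n \<in> J j) \<and> (\<forall>n\<in>prim_indices. s j * len n \<le> 2 \<longrightarrow> n \<in> J j) \<and>
     (\<forall>h A. (h, A) \<in> profiles \<longrightarrow> \<bar>(\<Sum>n\<in>J j. h (s j * len n)) - A / (ln \<phi> * s j)\<bar> \<le> D)"
    by (elim exE)
  have Jfin: "finite (J j)" and Jsub: "J j \<subseteq> prim_indices"
    and Jx: "\<And>n. n \<in> prim_indices \<Longrightarrow> real (v n) \<le> y j \<Longrightarrow> n \<in> J j"
    and Js: "\<And>n. n \<in> prim_indices \<Longrightarrow> s j * len n \<le> 2 \<Longrightarrow> n \<in> J j"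
    and Jsum: "\<And>h A. (h, A) \<in> profiles \<Longrightarrow> \<bar>(\<Sum>n\<in>J j. h (s j * len n)) - A / (ln \<phi> * s j)\<bar> \<le> D" for j
    using J[rule_format, of j] by blast+
  interpret B: boltzmann_sequence \<phi> \<psi> P Q s J D
    by unfold_locales (fact s_pos s_lim Jfin Jsub Js Jsum)+
  \<comment> \<open>The centring term of the final statement, \<open>a1\<close> times the square
    root of the logarithm, is exactly the square of the scale.\<close>
  have sd2: "sd2 j = (B.sg j)\<^sup>2" for j
  proof -
    have "(B.sg j)\<^sup>2 = sqrt (6 * ln \<phi> * ln (y j)) / (ln \<phi> * pi)" unfolding B.sg_sq s_def by simp
    also have "6 * ln \<phi> * ln (y j) = (ln \<phi>)\<^sup>2 * ((6 / ln \<phi>) * ln (y j))" using \<alpha> by (simp add: power2_eq_square)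
    also have "sqrt \<dots> = ln \<phi> * (sqrt (6 / ln \<phi>) * sqrt (ln (y j)))"
      unfolding real_sqrt_mult using \<alpha> by simp
    finally show ?thesis using \<alpha> by (simp add: sd2_def)
  qed
  have sd: "sqrt (sd2 j) = B.sg j" for j unfolding sd2 using B.sg_pos[of j] by simp
  let ?S = "\<lambda>j. sample (y j)"
  have S: "finite (?S j)" "?S j \<noteq> {}" for j
    using mult_monoid_sample_space[of "y j" F] y(1)[of j] by auto
  have cS: "real (card (?S j)) > 0" for j using S[of j] by (simp add: card_gt_0_iff)
  define t where "t j N = (real (omega F N) - (B.sg j)\<^sup>2) / B.sg j" for j N
  \<comment> \<open>The factor \<open>K\<close> is common to numerator and denominator; the factors
    \<open>sg j\<close> are inserted so that both converge.\<close>
  have ratio: "(\<Sum>N\<in>?S j. f (t j N)) / real (card (?S j)) =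
      (B.sg j * measure_pmf.expectation (B.Om j) (\<lambda>m. f (B.T j m) * etail (B.X j m))) /
      (B.sg j * measure_pmf.expectation (B.Om j) (\<lambda>m. 1 * etail (B.X j m)))" for f j
  proof -
    have "1 \<le> y j" using y(1)[of j] by simp
    have "\<exists>K>0. \<forall>f. measure_pmf.expectation (boltz (J j) (s j))
           (\<lambda>m. f (parts (J j) m) * etail (s j * (ln (y j) - (\<Sum>n\<in>J j. len n * m n)))) = K * (\<Sum>N\<in>?S j. f (omega F N))"
      by (rule boltz_expectation[OF Jfin[of j] Jsub[of j] \<open>1 \<le> y j\<close> _ s_pos[of j]]) (rule Jx)
    then obtain K where K0: "K > 0 \<and> (\<forall>f. measure_pmf.expectation (boltz (J j) (s j))
           (\<lambda>m. f (parts (J j) m) * etail (s j * (ln (y j) - (\<Sum>n\<in>J j. len n * m n)))) = K * (\<Sum>N\<in>?S j. f (omega F N)))"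
      by (elim exE)
    note K = conjunct1[OF K0] spec[OF conjunct2[OF K0]]
    have "measure_pmf.expectation (B.Om j) (\<lambda>m. f (B.T j m) * etail (B.X j m)) = K * (\<Sum>N\<in>?S j. f (t j N))"
      using K(2)[of "\<lambda>k. f ((real k - (B.sg j)\<^sup>2) / B.sg j)"] by (simp add: B.T_def B.X_def s_L t_def)
    moreover have "measure_pmf.expectation (B.Om j) (\<lambda>m. 1 * etail (B.X j m)) = K * real (card (?S j))"
      using K(2)[of "\<lambda>k. 1"] by (simp add: B.X_def s_L)
    ultimately show ?thesis using K(1) B.sg_pos[of j] by simp
  qed
  define G where "G = B.G0"
  have G: "G > 0" by (simp add: G_def)
  have cos_lim: "(\<lambda>j. (\<Sum>N\<in>?S j. 1 + cos (\<tau> * t j N)) / real (card (?S j))) \<longlonglongrightarrow> 1 + exp (- (\<tau>\<^sup>2 * cvar) / 2)" for \<tau>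
  proof -
    have "(\<lambda>j. (\<Sum>N\<in>?S j. 1 + cos (\<tau> * t j N)) / real (card (?S j))) \<longlonglongrightarrow> (G * (1 + exp (- (\<tau>\<^sup>2 * cvar) / 2)) / (2 * pi)) / (G / (2 * pi))"
      unfolding ratio[of "\<lambda>t. 1 + cos (\<tau> * t)"] using G unfolding G_def by (intro tendsto_divide B.etail_limits) simp
    then show ?thesis using G by simp
  qed
  have sin_lim: "(\<lambda>j. (\<Sum>N\<in>?S j. 1 + sin (\<tau> * t j N)) / real (card (?S j))) \<longlonglongrightarrow> 1" for \<tau>
  proof -
    have "(\<lambda>j. (\<Sum>N\<in>?S j. 1 + sin (\<tau> * t j N)) / real (card (?S j))) \<longlonglongrightarrow> (G / (2 * pi)) / (G / (2 * pi))"
      unfolding ratio[of "\<lambda>t. 1 + sin (\<tau> * t)"] using G unfolding G_def by (intro tendsto_divide B.etail_limits) simp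
    then show ?thesis using G by simp
  qed
  define g where "g j N = (real (omega F N) - sd2 j) / (sqrt cvar * sqrt (sd2 j))" for j N
  have g_t: "g j N = t j N / sqrt cvar" for j N
    unfolding g_def t_def sd unfolding sd2 by simp
  define \<mu> where "\<mu> j = distr (measure_pmf (pmf_of_set (?S j))) borel (g j)" for j
  have rd: "real_distribution (\<mu> j)" for j
    unfolding \<mu>_def by (intro prob_space.real_distribution_distr measure_pmf.prob_space_axioms) simp
  have "weak_conv_m \<mu> std_normal_distribution"
  proof (rule levy_continuity[OF rd real_dist_normal_dist])
    fix r
    define \<tau> where "\<tau> = r / sqrt cvar"
    \<comment> \<open>Removes the 1 that was added to make the trigonometric weights
      nonnegative.\<close>
    have "char (\<mu> j) r = complex_of_real ((\<Sum>N\<in>?S j. 1 + cos (\<tau> * t j N)) / real (card (?S j)) - 1)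
          + \<i> * complex_of_real ((\<Sum>N\<in>?S j. 1 + sin (\<tau> * t j N)) / real (card (?S j)) - 1)" for j
    proof -
      have "char (\<mu> j) r = measure_pmf.expectation (pmf_of_set (?S j)) (\<lambda>N. iexp (r * g j N))"
        unfolding char_def \<mu>_def by (subst integral_distr) auto
      also have "\<dots> = (\<Sum>N\<in>?S j. iexp (\<tau> * t j N)) / of_nat (card (?S j))"
        unfolding integral_pmf_of_set_complex[OF S] by (simp add: g_t \<tau>_def)
      also have "(\<Sum>N\<in>?S j. iexp (\<tau> * t j N)) = complex_of_real (\<Sum>N\<in>?S j. cos (\<tau> * t j N)) + \<i> * complex_of_real (\<Sum>N\<in>?S j. sin (\<tau> * t j N))"
        unfolding of_real_sum sum_distrib_left sum.distrib[symmetric]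
        by (intro sum.cong refl iexp_eq_cos_sin)
      finally have "char (\<mu> j) r = complex_of_real ((\<Sum>N\<in>?S j. cos (\<tau> * t j N)) / real (card (?S j)))
          + \<i> * complex_of_real ((\<Sum>N\<in>?S j. sin (\<tau> * t j N)) / real (card (?S j)))"
        by (simp only: add_divide_distrib of_real_divide of_real_of_nat_eq times_divide_eq_right)
      moreover have "(\<Sum>N\<in>?S j. 1 + f N) / real (card (?S j)) - 1 = (\<Sum>N\<in>?S j. f N) / real (card (?S j))" for f :: "nat \<Rightarrow> real"
        using cS[of j] unfolding sum.distrib by (simp only: add_divide_distrib sum_constant mult_1_right) simp
      ultimately show ?thesis by (simp only:)
    qed
    moreover have "(\<lambda>j. complex_of_real ((\<Sum>N\<in>?S j. 1 + cos (\<tau> * t j N)) / real (card (?S j)) - 1)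
          + \<i> * complex_of_real ((\<Sum>N\<in>?S j. 1 + sin (\<tau> * t j N)) / real (card (?S j)) - 1))
        \<longlonglongrightarrow> complex_of_real (1 + exp (- (\<tau>\<^sup>2 * cvar) / 2) - 1) + \<i> * complex_of_real (1 - 1)"
      by (intro tendsto_intros cos_lim sin_lim)
    moreover have "\<tau>\<^sup>2 * cvar = r\<^sup>2" using cvar_pos by (simp add: \<tau>_def power_divide)
    ultimately show "(\<lambda>j. char (\<mu> j) r) \<longlonglongrightarrow> char std_normal_distribution r"
      unfolding char_std_normal_distribution by simp
  qed
  moreover have "isCont (cdf std_normal_distribution) z"
  proof -
    interpret N: real_distribution std_normal_distribution by (rule real_dist_normal_dist)
    have "emeasure std_normal_distribution {z} = 0"
      by (subst emeasure_density) (auto simp: nn_integral_0_iff_AE intro: AE_mp[OF AE_lborel_singleton[of z]])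
    then show ?thesis by (subst N.isCont_cdf) (simp add: measure_def)
  qed
  ultimately have "(\<lambda>j. cdf (\<mu> j) z) \<longlonglongrightarrow> cdf std_normal_distribution z"
    unfolding weak_conv_m_def weak_conv_def by blast
  moreover have "cdf (\<mu> j) z = measure_pmf.prob (pmf_of_set (?S j)) {N. g j N \<le> z}" for j
    unfolding cdf_def \<mu>_def by (subst measure_distr) (auto simp: vimage_def)
  ultimately show ?thesis unfolding g_def by simp
qed

end

lemma cdf_std_normal: "cdf std_normal_distribution z = 1 / sqrt (2 * pi) * (LBINT y:{..z}. exp (- (y\<^sup>2) / 2))"
proof -
  have "cdf std_normal_distribution z = (\<integral>y. indicator {..z} y \<partial>std_normal_distribution)"
    by (simp add: cdf_def)
  also have "\<dots> = (\<integral>y. std_normal_density y *\<^sub>R indicator {..z} y \<partial>lborel)"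
    by (subst integral_density) auto
  also have "\<dots> = (\<integral>y. 1 / sqrt (2 * pi) * (indicator {..z} y *\<^sub>R exp (- (y\<^sup>2) / 2)) \<partial>lborel)"
    by (intro Bochner_Integration.integral_cong refl) (simp add: std_normal_density_def)
  finally show ?thesis by (simp only: integral_mult_right_zero set_lebesgue_integral_def)
qed

theorem theorem2:
  fixes \<phi> \<psi> a1 a2 z :: real and P Q :: int
  assumes "algebraic_int \<phi>" and "algebraic_int \<psi>"
    and "\<phi> + \<psi> = of_int P" and "\<phi> * \<psi> = of_int Q"
    and "P \<noteq> 0" and "Q \<noteq> 0" and "coprime P Q"
    and "\<phi> > \<bar>\<psi>\<bar>"
    and "a1 = 1 / pi * sqrt (6 / ln \<phi>)"
    and "a2 = (pi\<^sup>2 - 6) / (2 * pi ^ 3) * sqrt (6 / ln \<phi>)"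
  shows "((\<lambda>x::real.
            measure_pmf.prob
              (pmf_of_set {N \<in> mult_monoid (prim_lucas \<phi> \<psi>). 1 \<le> real N \<and> real N \<le> x})
              {N. (real (omega (prim_lucas \<phi> \<psi>) N) - a1 * (ln x) powr (1/2))
                    / (sqrt a2 * (ln x) powr (1/4)) \<le> z})
          \<longlongrightarrow> 1 / sqrt (2 * pi) * (LBINT y:{..z}. exp (- (y\<^sup>2) / 2))) at_top"
proof (rule tendsto_at_topI_sequentially)
  interpret lucas_pair \<phi> \<psi> P Q by unfold_locales (use assms in auto)
  let ?p = "\<lambda>x. measure_pmf.prob (pmf_of_set {N \<in> mult_monoid (prim_lucas \<phi> \<psi>). 1 \<le> real N \<and> real N \<le> x})
              {N. (real (omega (prim_lucas \<phi> \<psi>) N) - a1 * (ln x) powr (1/2)) / (sqrt a2 * (ln x) powr (1/4)) \<le> z}"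
  fix x :: "nat \<Rightarrow> real"
  assume x: "filterlim x at_top sequentially"
  \<comment> \<open>Truncation at 2 keeps the logarithm positive at every index and changes only
    finitely many terms.\<close>
  define y where "y j = max 2 (x j)" for j
  have ev: "\<forall>\<^sub>F j in sequentially. y j = x j"
    using filterlim_at_top[THEN iffD1, OF x, rule_format, of 2] by eventually_elim (simp add: y_def)
  have "filterlim y at_top sequentially"
    by (rule filterlim_at_top_mono[OF x]) (simp add: y_def)
  from omega_asymptotically_normal_seq[OF _ this]
  have "(\<lambda>j. measure_pmf.prob (pmf_of_set (sample (y j)))
      {N. (real (omega F N) - sqrt (6 / ln \<phi>) / pi * sqrt (ln (y j))) / (sqrt cvar * sqrt (sqrt (6 / ln \<phi>) / pi * sqrt (ln (y j)))) \<le> z})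
           \<longlonglongrightarrow> cdf std_normal_distribution z" by (simp add: y_def)
  moreover have "measure_pmf.prob (pmf_of_set (sample (y j)))
      {N. (real (omega F N) - sqrt (6 / ln \<phi>) / pi * sqrt (ln (y j))) / (sqrt cvar * sqrt (sqrt (6 / ln \<phi>) / pi * sqrt (ln (y j)))) \<le> z} = ?p (y j)" for j
  proof -
    have L: "ln (y j) > 0" by (simp add: y_def)
    have 1: "sqrt (6 / ln \<phi>) / pi * sqrt (ln (y j)) = a1 * ln (y j) powr (1/2)"
      using L unfolding assms by (simp add: powr_half_sqrt)
    \<comment> \<open>(pi^2 - 6) / (2 pi^3) is the conditional variance 1/2 - 3 / pi^2 divided by
      pi.\<close>
    have "a2 = cvar * (sqrt (6 / ln \<phi>) / pi)"
      unfolding assms cvar_def by (simp add: field_simps power2_eq_square power3_eq_cube)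
    then have "sqrt a2 = sqrt cvar * sqrt (sqrt (6 / ln \<phi>) / pi)" by (simp only: real_sqrt_mult)
    moreover have "ln (y j) powr (1/4) = sqrt (sqrt (ln (y j)))"
      using L by (simp add: powr_half_sqrt[symmetric] powr_powr)
    ultimately have 2: "sqrt cvar * sqrt (sqrt (6 / ln \<phi>) / pi * sqrt (ln (y j))) = sqrt a2 * ln (y j) powr (1/4)"
      by (simp only: real_sqrt_mult mult.assoc)
    show ?thesis unfolding 2 unfolding 1 ..
  qed
  ultimately have "(\<lambda>j. ?p (y j)) \<longlonglongrightarrow> cdf std_normal_distribution z" by (simp only:)
  then have "(\<lambda>j. ?p (x j)) \<longlonglongrightarrow> cdf std_normal_distribution z"
    by (rule Lim_transform_eventually) (use ev in eventually_elim, simp)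
  then show "(\<lambda>j. ?p (x j)) \<longlonglongrightarrow> 1 / sqrt (2 * pi) * (LBINT y:{..z}. exp (- (y\<^sup>2) / 2))"
    unfolding cdf_std_normal .
qed

end
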